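(* Let $p$ be an odd prime. For $n\ge 1$, the set of all elements $$\Big[u_1^{\epsilon_1}v_1^{[(p-1)(i_1+b(I))-\epsilon_1]}\cdots u_n^{\epsilon_n}v_n^{[p^{n-1}(p-1)(i_1+\cdots+i_n+b(I))-p^{n-1}\epsilon_n]}\Big]$$ (the $s$-th factor being $u_s^{\epsilon_s}v_s^{[p^{s-1}(p-1)(i_1+\cdots+i_s+b(I))-p^{s-1}\epsilon_s]}$), for $I=(\epsilon_1,i_1,\dots,\epsilon_n,i_n)$ with $i_1\in\mathbb{Z}$, $i_s\ge 0$ for $2\le s\le n$, $\epsilon_s\in\{0,1\}$ and $i_1+b(I)-m(I)\ge 0$, provides an additive basis for the coinvariants $(H_*B\mathbb{V}_n)_{GL_n}$.
   Context: $\mathbb{V}_n=(\mathbb{Z}/p)^n$; $H^*B\mathbb{V}_n=E(e_1,\dots,e_n)\otimes\mathbb{F}_p[x_1,\dots,x_n]$ (mod $p$ cohomology), $|e_i|=1$, $x_i=\beta e_i$, $|x_i|=2$. $H_*B\mathbb{V}_n$ is the tensor product of the exterior algebra on $u_1,\dots,u_n$ ($u_i\in H_1$ dual to $e_i$) and the divided power algebra on $v_1,\dots,v_n$ ($v_i\in H_2$ dual to $x_i$); $v_i^{[t]}$ is the $t$-th divided power of $v_i$. $GL_n=GL_n(\mathbb{F}_p)$ acts on $\mathbb{V}_n$, hence on $H_*B\mathbb{V}_n$; $(H_*B\mathbb{V}_n)_{GL_n}$ is the space of coinvariants (dual to the invariants $(H^*B\mathbb{V}_n)^{GL_n}$), and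 $[z]$ is the class of $z$ in it. $b(I)=\sum_s\epsilon_s$, $m(I)=\max_s\epsilon_s$. *)

theory Defs
  imports
    "Jordan_Normal_Form.VS_Connect"
    "Berlekamp_Zassenhaus.Finite_Field"
    "HOL-Library.Poly_Mapping"
    "HOL-Algebra.AbelCoset"
begin

hide_const (open) Multiset.mult Polynomial.smult Modules.module

section \<open>The homology algebra \<open>E(u\<^sub>1,\<dots>,u\<^sub>n) \<otimes> \<Gamma>(v\<^sub>1,\<dots>,v\<^sub>n)\<close>\<close>

text \<open>
  Indices are shifted by one: the generators are \<open>u\<^sub>0,\<dots>,u\<^sub>n\<^sub>-\<^sub>1\<close> and
  \<open>v\<^sub>0,\<dots>,v\<^sub>n\<^sub>-\<^sub>1\<close>.  The list \<open>[(\<epsilon>\<^sub>0, t\<^sub>0), \<dots>, (\<epsilon>\<^sub>n\<^sub>-\<^sub>1, t\<^sub>n\<^sub>-\<^sub>1)]\<close> stands for the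
  monomial \<open>u\<^sub>0^\<epsilon>\<^sub>0 v\<^sub>0^[t\<^sub>0] \<cdots> u\<^sub>n\<^sub>-\<^sub>1^\<epsilon>\<^sub>n\<^sub>-\<^sub>1 v\<^sub>n\<^sub>-\<^sub>1^[t\<^sub>n\<^sub>-\<^sub>1]\<close>; a Boolean encodes
  \<open>\<epsilon> \<in> {0,1}\<close>.  These monomials, for lists of length \<open>n\<close>, form the tensor product basis.
\<close>

type_synonym hmon = "(bool \<times> nat) list"
type_synonym 'k hom_elt = "hmon \<Rightarrow>\<^sub>0 'k"

abbreviation hmonomial :: "hmon \<Rightarrow> 'k::field hom_elt" where
  "hmonomial x \<equiv> Poly_Mapping.single x 1"

definition hmon_mult :: "hmon \<Rightarrow> hmon \<Rightarrow> hmon" where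
  "hmon_mult x y = map2 (\<lambda>(e, a) (f, b). (e \<or> f, a + b)) x y"

text \<open>
  The structure constants: \<open>u\<^sub>i u\<^sub>i = 0\<close>; moving the \<open>u\<close>'s of the second factor into place
  contributes a sign for every pair \<open>j < i\<close> with \<open>u\<^sub>i\<close> in the first and \<open>u\<^sub>j\<close> in the second
  factor; and \<open>v\<^sub>i^[a] v\<^sub>i^[b] = (a + b choose a) v\<^sub>i^[a+b]\<close>.
\<close>

definition hmon_coeff :: "hmon \<Rightarrow> hmon \<Rightarrow> 'k::field" where
  "hmon_coeff x y =
     (if \<exists>i<length x. fst (x ! i) \<and> fst (y ! i) then 0
      else (-1) ^ card {(i, j). j < i \<and> i < length x \<and> fst (x ! i) \<and> fst (y ! j)} *
           of_nat (\<Prod>i<length x. (snd (x ! i) + snd (y ! i)) choose snd (x ! i)))"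

definition hom_mult :: "'k::field hom_elt \<Rightarrow> 'k hom_elt \<Rightarrow> 'k hom_elt" where
  "hom_mult f g =
     (\<Sum>x\<in>Poly_Mapping.keys f. \<Sum>y\<in>Poly_Mapping.keys g.
        Poly_Mapping.single (hmon_mult x y)
          (Poly_Mapping.lookup f x * Poly_Mapping.lookup g y * hmon_coeff x y))"

definition hom_one :: "nat \<Rightarrow> 'k::field hom_elt" where
  "hom_one n = hmonomial (replicate n (False, 0))"

definition hom_smult :: "'k::field \<Rightarrow> 'k hom_elt \<Rightarrow> 'k hom_elt" where
  "hom_smult c f = Poly_Mapping.map (\<lambda>a. c * a) f"

definition homology :: "nat \<Rightarrow> ('k::field, 'k hom_elt) module" where
  "homology n =
     \<lparr>carrier = {f. \<forall>x\<in>Poly_Mapping.keys f. length x = n},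
      mult = hom_mult, one = hom_one n, zero = 0, add = (+), smult = hom_smult\<rparr>"

section \<open>The action of \<open>GL\<^sub>n\<close> and its coinvariants\<close>

definition GL :: "nat \<Rightarrow> 'k::field mat set" where
  "GL n = {g \<in> carrier_mat n n. invertible_mat g}"

text \<open>The element \<open>\<Sum>j<n. c j \<cdot> u\<^sub>j\<close>.\<close>

definition u_lin :: "nat \<Rightarrow> (nat \<Rightarrow> 'k::field) \<Rightarrow> 'k hom_elt" where
  "u_lin n c = (\<Sum>j<n. Poly_Mapping.single ((replicate n (False, 0))[j := (True, 0)]) (c j))"

text \<open>
  The divided power \<open>(\<Sum>j<n. c j \<cdot> v\<^sub>j)^[t]\<close>, expanded by the rules
  \<open>(x + y)^[t] = \<Sum>a+b=t. x^[a] y^[b]\<close> and \<open>(c x)^[t] = c^t x^[t]\<close>.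
\<close>

definition v_lin_divpow :: "nat \<Rightarrow> (nat \<Rightarrow> 'k::field) \<Rightarrow> nat \<Rightarrow> 'k hom_elt" where
  "v_lin_divpow n c t =
     (\<Sum>a\<in>{a. length a = n \<and> sum_list a = t}.
        Poly_Mapping.single (map (Pair False) a) (\<Prod>j<n. c j ^ (a ! j)))"

text \<open>
  A group homomorphism \<open>g\<close> of \<open>V\<^sub>n\<close> induces a homomorphism of algebras with divided powers, with
  \<open>u\<^sub>s \<mapsto> \<Sum>j. g\<^sub>j\<^sub>s u\<^sub>j\<close> and \<open>v\<^sub>s \<mapsto> \<Sum>j. g\<^sub>j\<^sub>s v\<^sub>j\<close>.  It is the transpose of the algebra map
  \<open>e\<^sub>j \<mapsto> \<Sum>s. g\<^sub>j\<^sub>s e\<^sub>s\<close>, \<open>x\<^sub>j \<mapsto> \<Sum>s. g\<^sub>j\<^sub>s x\<^sub>s\<close> on cohomology.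
\<close>

definition GL_act_mon :: "nat \<Rightarrow> 'k::field mat \<Rightarrow> hmon \<Rightarrow> 'k hom_elt" where
  "GL_act_mon n g x =
     foldr hom_mult
       (map (\<lambda>s. hom_mult
                   (if fst (x ! s) then u_lin n (\<lambda>j. g $$ (j, s)) else hom_one n)
                   (v_lin_divpow n (\<lambda>j. g $$ (j, s)) (snd (x ! s))))
            [0..<n])
       (hom_one n)"

definition GL_act :: "nat \<Rightarrow> 'k::field mat \<Rightarrow> 'k hom_elt \<Rightarrow> 'k hom_elt" where
  "GL_act n g f =
     (\<Sum>x\<in>Poly_Mapping.keys f. hom_smult (Poly_Mapping.lookup f x) (GL_act_mon n g x))"

definition coinv_relations :: "nat \<Rightarrow> 'k::field hom_elt set" where
  "coinv_relations n =
     LinearCombinations.module.span class_ring (homology n)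
       {GL_act n g z - z | g z. g \<in> GL n \<and> z \<in> carrier (homology n)}"

definition quotient_module :: "('a, 'b, 'c) module_scheme \<Rightarrow> 'b set \<Rightarrow> ('a, 'b set) module" where
  "quotient_module M N =
     \<lparr>carrier = a_rcosets\<^bsub>M\<^esub> N, mult = undefined, one = undefined, zero = N, add = set_add M,
      smult = (\<lambda>c X. \<Union>x\<in>X. N +>\<^bsub>M\<^esub> (c \<odot>\<^bsub>M\<^esub> x))\<rparr>"

definition coinvariants :: "nat \<Rightarrow> ('k::field, 'k hom_elt set) module" where
  "coinvariants n = quotient_module (homology n) (coinv_relations n)"

definition coinv_class :: "nat \<Rightarrow> 'k::field hom_elt \<Rightarrow> 'k hom_elt set" where
  "coinv_class n z = coinv_relations n +>\<^bsub>homology n\<^esub> z"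

subsection \<open>The coinvariants form a vector space\<close>

lemma lookup_hom_smult: "Poly_Mapping.lookup (hom_smult c f) x = c * Poly_Mapping.lookup f x"
  unfolding hom_smult_def by (simp add: map.rep_eq when_def)

lemma in_homology: "f \<in> carrier (homology n) \<longleftrightarrow> (\<forall>x\<in>Poly_Mapping.keys f. length x = n)"
  by (simp add: homology_def)

lemma hom_add_closed: "f \<in> carrier (homology n) \<Longrightarrow> g \<in> carrier (homology n) \<Longrightarrow> f + g \<in> carrier (homology n)"
  unfolding in_homology using Poly_Mapping.keys_add[of f g] by blast

lemma hom_minus_closed: "f \<in> carrier (homology n) \<Longrightarrow> g \<in> carrier (homology n) \<Longrightarrow> f - g \<in> carrier (homology n)"
  unfolding in_homology using keys_diff[of f g] by blast

lemma hom_zero_closed: "0 \<in> carrier (homology n)"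
  by (simp add: in_homology)

lemma hom_sum_closed: "(\<And>i. i \<in> I \<Longrightarrow> f i \<in> carrier (homology n)) \<Longrightarrow> sum f I \<in> carrier (homology n)"
  by (induction I rule: infinite_finite_induct) (auto simp: hom_zero_closed hom_add_closed)

lemma hom_single_closed: "length x = n \<Longrightarrow> Poly_Mapping.single x c \<in> carrier (homology n)"
  by (simp add: in_homology)

lemma hom_smult_closed: "f \<in> carrier (homology n) \<Longrightarrow> hom_smult c f \<in> carrier (homology n)"
  unfolding in_homology by (auto simp: in_keys_iff lookup_hom_smult)

lemma hom_mult_closed: "f \<in> carrier (homology n) \<Longrightarrow> g \<in> carrier (homology n) \<Longrightarrow> hom_mult f g \<in> carrier (homology n)"
  unfolding hom_mult_def
  by (intro hom_sum_closed hom_single_closed) (auto simp: in_homology hmon_mult_def)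

lemma hom_one_closed: "hom_one n \<in> carrier (homology n)"
  unfolding hom_one_def by (intro hom_single_closed) simp

lemma foldr_closed: "(\<And>f. f \<in> set fs \<Longrightarrow> f \<in> carrier (homology n)) \<Longrightarrow> foldr hom_mult fs (hom_one n) \<in> carrier (homology n)"
  by (induction fs) (auto simp: hom_one_closed hom_mult_closed)

lemma GL_act_closed: "f \<in> carrier (homology n) \<Longrightarrow> GL_act n g f \<in> carrier (homology n)"
  unfolding GL_act_def GL_act_mon_def
  by (intro hom_sum_closed hom_smult_closed foldr_closed)
     (auto intro!: hom_mult_closed hom_one_closed hom_sum_closed hom_single_closed simp: u_lin_def v_lin_divpow_def)

lemma vs_homology: "vectorspace class_ring (homology n :: ('k::field, 'k hom_elt) module)"
proof -
  let ?R = "class_ring :: 'k ring" and ?M = "homology n :: ('k::field, 'k hom_elt) module"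
  have s: "add ?M = (+)" "zero ?M = 0" "smult ?M = hom_smult" by (simp_all add: homology_def)
  have "module ?R ?M"
  proof (rule module_criteria)
    show "cring ?R" by unfold_locales
    show "\<zero>\<^bsub>?M\<^esub> \<in> carrier ?M" by (simp add: s hom_zero_closed)
    show "\<forall>v w. v \<in> carrier ?M \<and> w \<in> carrier ?M \<longrightarrow> v \<oplus>\<^bsub>?M\<^esub> w \<in> carrier ?M" by (simp add: s hom_add_closed)
    show "\<forall>v\<in>carrier ?M. (\<exists>neg_v\<in>carrier ?M. v \<oplus>\<^bsub>?M\<^esub> neg_v = \<zero>\<^bsub>?M\<^esub>)"
      unfolding s by (metis hom_minus_closed hom_zero_closed add.right_inverse diff_0)
    show "\<forall>c v. c \<in> carrier ?R \<and> v \<in> carrier ?M \<longrightarrow> c \<odot>\<^bsub>?M\<^esub> v \<in> carrier ?M" by (simp add: s hom_smult_closed)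
  qed (auto simp: s algebra_simps lookup_hom_smult lookup_add intro!: poly_mapping_eqI)
  then show ?thesis unfolding vectorspace_def by (auto intro: class_field)
qed

lemma module_quotient:
  assumes "module R M" "submodule R N M"
  shows "module R (quotient_module M N)"
proof -
  interpret M: Module.module R M by fact
  interpret N: LinearCombinations.submodule R N M by fact
  have neg: "\<ominus>\<^bsub>M\<^esub> v \<in> N" if "v \<in> N" for v
    using that N.subset M.smult_minus_1[of v] by (metis N.smult_closed M.R.add.inv_closed M.R.one_closed subsetD)
  interpret S: additive_subgroup N M
    apply unfold_locales
    using N.subset neg by (auto simp: a_inv_def)
  interpret S: abelian_subgroup N M
    by (rule abelian_subgroupI3) (unfold_locales)
  let ?Q = "quotient_module M N"
  have sm: "(\<Union>x\<in>N +>\<^bsub>M\<^esub> v. N +>\<^bsub>M\<^esub> (c \<odot>\<^bsub>M\<^esub> x)) = N +>\<^bsub>M\<^esub> (c \<odot>\<^bsub>M\<^esub> v)"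
    if c: "c \<in> carrier R" and v: "v \<in> carrier M" for c v
  proof -
    have "N +>\<^bsub>M\<^esub> (c \<odot>\<^bsub>M\<^esub> x) = N +>\<^bsub>M\<^esub> (c \<odot>\<^bsub>M\<^esub> v)" if xm: "x \<in> N +>\<^bsub>M\<^esub> v" for x
    proof -
      obtain w where w: "w \<in> N" "x = w \<oplus>\<^bsub>M\<^esub> v" using xm by (auto simp: a_r_coset_def')
      have "c \<odot>\<^bsub>M\<^esub> x = (c \<odot>\<^bsub>M\<^esub> w) \<oplus>\<^bsub>M\<^esub> (c \<odot>\<^bsub>M\<^esub> v)"
        using w c v N.subset by (auto simp: M.smult_r_distr)
      moreover have "c \<odot>\<^bsub>M\<^esub> w \<in> N" using w c by (simp add: N.smult_closed)
      ultimately have "c \<odot>\<^bsub>M\<^esub> x \<in> N +>\<^bsub>M\<^esub> (c \<odot>\<^bsub>M\<^esub> v)" by (auto simp: a_r_coset_def')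
      then show ?thesis using c v using S.a_repr_independence'[of _ "c \<odot>\<^bsub>M\<^esub> v"] by auto
    qed
    moreover have "v \<in> N +>\<^bsub>M\<^esub> v" using v by (rule S.a_rcos_self)
    ultimately show ?thesis by blast
  qed
  have Q: "carrier ?Q = {N +>\<^bsub>M\<^esub> v | v. v \<in> carrier M}" "zero ?Q = N" "add ?Q = set_add M"
    "smult ?Q = (\<lambda>c X. \<Union>x\<in>X. N +>\<^bsub>M\<^esub> (c \<odot>\<^bsub>M\<^esub> x))"
    by (auto simp: quotient_module_def A_RCOSETS_def')
  have smQ: "c \<odot>\<^bsub>?Q\<^esub> (N +>\<^bsub>M\<^esub> v) = N +>\<^bsub>M\<^esub> (c \<odot>\<^bsub>M\<^esub> v)"
    if "c \<in> carrier R" "v \<in> carrier M" for c v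
    using that sm by (simp add: Q)
  have addQ: "(N +>\<^bsub>M\<^esub> v) \<oplus>\<^bsub>?Q\<^esub> (N +>\<^bsub>M\<^esub> w) = N +>\<^bsub>M\<^esub> (v \<oplus>\<^bsub>M\<^esub> w)"
    if "v \<in> carrier M" "w \<in> carrier M" for v w
    using that by (simp add: Q S.a_rcos_sum)
  have zero: "N = N +>\<^bsub>M\<^esub> \<zero>\<^bsub>M\<^esub>" using N.subset by (auto simp: a_r_coset_def')
  show ?thesis
  proof (rule module_criteria)
    show "cring R" by unfold_locales
    show "\<zero>\<^bsub>?Q\<^esub> \<in> carrier ?Q" unfolding Q using zero by blast
    show "\<forall>v w. v \<in> carrier ?Q \<and> w \<in> carrier ?Q \<longrightarrow> v \<oplus>\<^bsub>?Q\<^esub> w \<in> carrier ?Q"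
      unfolding Q by (auto simp: S.a_rcos_sum)
    show "\<forall>v\<in>carrier ?Q. \<exists>neg_v\<in>carrier ?Q. v \<oplus>\<^bsub>?Q\<^esub> neg_v = \<zero>\<^bsub>?Q\<^esub>"
    proof
      fix X assume "X \<in> carrier ?Q"
      then obtain v where v: "v \<in> carrier M" "X = N +>\<^bsub>M\<^esub> v" by (auto simp: Q)
      then have "X <+>\<^bsub>M\<^esub> (N +>\<^bsub>M\<^esub> (\<ominus>\<^bsub>M\<^esub> v)) = N"
        using zero by (simp add: S.a_rcos_sum M.r_neg)
      then show "\<exists>neg_v\<in>carrier ?Q. X \<oplus>\<^bsub>?Q\<^esub> neg_v = \<zero>\<^bsub>?Q\<^esub>" unfolding Q using v by blast
    qed
    show "\<forall>c v. c \<in> carrier R \<and> v \<in> carrier ?Q \<longrightarrow> c \<odot>\<^bsub>?Q\<^esub> v \<in> carrier ?Q"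
      using M.smult_closed by (fastforce simp: smQ Q(1))
    have z: "v \<oplus>\<^bsub>?Q\<^esub> \<zero>\<^bsub>?Q\<^esub> = v" if "v \<in> carrier ?Q" for v
      using that unfolding Q by (subst zero) (auto simp: S.a_rcos_sum)
    then show "\<forall>v\<in>carrier ?Q. v \<oplus>\<^bsub>?Q\<^esub> \<zero>\<^bsub>?Q\<^esub> = v" by blast
  qed (auto simp: Q(1) smQ addQ M.a_ac M.smult_l_distr M.smult_r_distr M.smult_assoc1)
qed

lemma submodule_coinv: "submodule class_ring (coinv_relations n) (homology n)"
proof -
  interpret vectorspace class_ring "homology n" by (rule vs_homology)
  show ?thesis unfolding coinv_relations_def
    by (rule span_is_submodule) (auto intro: hom_minus_closed GL_act_closed)
qed

lemma vs_coinvariants: "vectorspace class_ring (coinvariants n)"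
proof -
  interpret vectorspace class_ring "homology n" by (rule vs_homology)
  have "module class_ring (coinvariants n)" unfolding coinvariants_def
    by (rule module_quotient[OF _ submodule_coinv]) unfold_locales
  then show ?thesis unfolding vectorspace_def by (auto intro: class_field)
qed

section \<open>The index sequences\<close>

text \<open>\<open>I = (\<epsilon>\<^sub>0, i\<^sub>0, \<dots>, \<epsilon>\<^sub>n\<^sub>-\<^sub>1, i\<^sub>n\<^sub>-\<^sub>1)\<close> is the list of the pairs \<open>(\<epsilon>\<^sub>s, i\<^sub>s)\<close>.\<close>

type_synonym ind_seq = "(bool \<times> int) list"

definition eps :: "ind_seq \<Rightarrow> nat \<Rightarrow> int" where
  "eps I s = of_bool (fst (I ! s))"

definition b_ind :: "ind_seq \<Rightarrow> int" where
  "b_ind I = (\<Sum>s<length I. eps I s)"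

definition m_ind :: "ind_seq \<Rightarrow> int" where
  "m_ind I = Max (eps I ` {..<length I})"

definition admissible :: "nat \<Rightarrow> ind_seq set" where
  "admissible n =
     {I. length I = n \<and> (\<forall>s. 1 \<le> s \<and> s < n \<longrightarrow> 0 \<le> snd (I ! s)) \<and>
         0 \<le> snd (I ! 0) + b_ind I - m_ind I}"

definition v_exponent :: "nat \<Rightarrow> ind_seq \<Rightarrow> nat \<Rightarrow> int" where
  "v_exponent p I s =
     int p ^ s * (int p - 1) * ((\<Sum>r\<le>s. snd (I ! r)) + b_ind I) - int p ^ s * eps I s"

text \<open>The integers \<open>v_exponent p I s\<close> are nonnegative for admissible \<open>I\<close>, so \<open>nat\<close> does not truncate.\<close>

lemma v_exponent_nonneg:
  assumes "p \<ge> 2" "I \<in> admissible n" "s < n"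
  shows "v_exponent p I s \<ge> 0"
proof -
  have n: "length I = n" and pos: "\<And>r. 1 \<le> r \<Longrightarrow> r < n \<Longrightarrow> 0 \<le> snd (I ! r)"
    and i0: "0 \<le> snd (I ! 0) + b_ind I - m_ind I" using assms by (auto simp: admissible_def)
  have "eps I s \<le> m_ind I" unfolding m_ind_def using assms n by (intro Max_ge) auto
  moreover have "snd (I ! 0) \<le> (\<Sum>r\<le>s. snd (I ! r))"
  proof -
    have "(\<Sum>r\<le>s. snd (I ! r)) = snd (I ! 0) + (\<Sum>r\<in>{1..s}. snd (I ! r))"
      by (simp add: atMost_atLeast0 sum.atLeast_Suc_atMost)
    moreover have "0 \<le> (\<Sum>r\<in>{1..s}. snd (I ! r))" using pos assms by (intro sum_nonneg) auto
    ultimately show ?thesis by linarith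
  qed
  ultimately have 1: "eps I s \<le> (\<Sum>r\<le>s. snd (I ! r)) + b_ind I" using i0 by linarith
  have e: "0 \<le> eps I s" by (simp add: eps_def)
  have "1 * ((\<Sum>r\<le>s. snd (I ! r)) + b_ind I) \<le> (int p - 1) * ((\<Sum>r\<le>s. snd (I ! r)) + b_ind I)"
    using assms 1 e by (intro mult_right_mono) auto
  then have "eps I s \<le> (int p - 1) * ((\<Sum>r\<le>s. snd (I ! r)) + b_ind I)" using 1 by (metis mult_1 order_trans)
  then have "0 \<le> int p ^ s * ((int p - 1) * ((\<Sum>r\<le>s. snd (I ! r)) + b_ind I) - eps I s)" by simp
  then show ?thesis by (simp add: v_exponent_def algebra_simps)
qed

definition basis_monomial :: "nat \<Rightarrow> ind_seq \<Rightarrow> hmon" where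
  "basis_monomial p I = map (\<lambda>s. (fst (I ! s), nat (v_exponent p I s))) [0..<length I]"

definition basis_class :: "nat \<Rightarrow> ind_seq \<Rightarrow> 'p::prime_card mod_ring hom_elt set" where
  "basis_class n I = coinv_class n (hmonomial (basis_monomial CARD('p) I))"

end

theory Submission
  imports Defs "Subresultants.More_Homomorphisms"
begin

hide_const (open) Multiset.mult Polynomial.smult Modules.module up_ring.monom up_ring.coeff

text \<open>
  A linear functional on homology which vanishes on the relations of the coinvariants is the same as
  a \<open>GL\<^sub>n\<close>-invariant alternating form with polynomial coefficients: its coefficient at
  \<open>x^t e\<^sub>J\<close> is its value at \<open>u\<^sub>J v^[t]\<close>. Monomials are ordered lexicographically, the last variable
  first, where \<open>u\<^sub>r\<close> weighs slightly less than \<open>v\<^sub>r^[p^r]\<close> (indices start at 0). Let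
  \<open>u\<^sub>J v^[t]\<close> be the leading monomial of an invariant form. Its value at the Frobenius powers \<open>X^(p^j)\<close>,
  \<open>j \<in> J\<close>, of the generic point \<open>X\<close> is an invariant polynomial with leading exponents
  \<open>T\<^sub>r = t\<^sub>r + [r \<in> J] p^r\<close>. Invariance under the torus and the translations and the order of
  vanishing along lines give \<open>p^r (p - 1) | T\<^sub>r\<close> and \<open>p T\<^sub>r \<le> T\<^sub>r\<^sub>+\<^sub>1\<close>, and \<open>T\<^sub>0 > 0\<close> if
  \<open>J \<noteq> {}\<close>; this says that the leading monomial is one of the listed ones. Hence a functional that
  vanishes on the relations and on the listed monomials is zero, so their classes span. Conversely,
  products of Dickson invariants and Mui forms are invariant forms, one for each listed monomial, which
  is its leading monomial; by triangularity the classes are independent.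
\<close>

section \<open>Exterior algebra\<close>

text \<open>An alternating form is not a polynomial, so the theory of invariant polynomials does not
  apply to it directly. Frobenius twists bridge the gap: the matrix entries lie in the prime field
  and are fixed by the Frobenius map, so the vector with entries \<open>X i ^ (p ^ j)\<close>
  transforms like \<open>X\<close>, and inserting such vectors into an invariant form leaves an
  invariant polynomial. Which twists are inserted depends on the leading monomial. For the twists in
  \<open>J\<close> the value contains a diagonal term, in which variable \<open>j\<close> receives
  twist \<open>j\<close>, and the order is tuned so that nothing cancels it: a generator u_r with
  its own twist contributes the same exponent as v_r^[p^r], and weighing u_r slightly less breaks
  this tie in the direction that keeps the diagonal term on top. The dictionary to the claim is that
  the quotients of \<open>T\<close> by p^r (p - 1) are the partial sums i_0 + ... + i_r + b(I):
  their growth says i_s \<ge> 0, and positivity of T_0 accounts for m(I). The spanning half needs no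
  count of dimensions, since a vector outside the span is separated from it by a functional.\<close>

text \<open>
  An element of the exterior algebra on generators indexed by naturals is given by its coordinates
  \<open>nat set \<Rightarrow> 'r\<close>; only finite index sets matter.
\<close>

definition wedge :: "(nat \<Rightarrow> 'r::comm_ring_1) \<Rightarrow> (nat set \<Rightarrow> 'r) \<Rightarrow> nat set \<Rightarrow> 'r" where
  "wedge w D J = (\<Sum>j\<in>J. w j * (-1) ^ card {l\<in>J. l < j} * D (J - {j}))"

definition ext_basis :: "nat set \<Rightarrow> nat set \<Rightarrow> 'r::comm_ring_1" where
  "ext_basis I J = of_bool (J = I)"

abbreviation wedges :: "(nat \<Rightarrow> 'r::comm_ring_1) list \<Rightarrow> nat set \<Rightarrow> 'r" where
  "wedges ws \<equiv> foldr wedge ws (ext_basis {})"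

lemma ext_basis_empty_sum:
  assumes "finite A" shows "(\<Sum>J\<in>A. ext_basis I J * f J) = (if I \<in> A then f I else (0::'r::comm_ring_1))"
proof -
  have "(\<Sum>J\<in>A. ext_basis I J * f J) = (\<Sum>J\<in>A. if J = I then f J else 0)"
    by (rule sum.cong) (auto simp: ext_basis_def)
  then show ?thesis using assms by simp
qed

lemma wedge_cong: "(\<And>j. j \<in> J \<Longrightarrow> v j = w j) \<Longrightarrow> (\<And>j. j \<in> J \<Longrightarrow> D (J - {j}) = E (J - {j})) \<Longrightarrow> wedge v D J = wedge w E J"
  unfolding wedge_def by (intro sum.cong) auto

lemma wedges_Cons:
  "foldr wedge (w # ws) D J = (\<Sum>j\<in>J. w j * (-1) ^ card {l\<in>J. l < j} * foldr wedge ws D (J - {j}))"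
  by (simp only: foldr.simps comp_def) (rule wedge_def)

text \<open>The terms cancel in pairs \<open>(i, j)\<close>, \<open>(j, i)\<close>. Splitting by
  \<open>i < j\<close> avoids a division by 2, so this holds over every commutative ring.\<close>

lemma sum_antisym:
  fixes f :: "nat \<Rightarrow> nat \<Rightarrow> 'r::comm_ring_1"
  assumes "finite J" and f: "\<And>i j. i \<in> J \<Longrightarrow> j \<in> J \<Longrightarrow> i < j \<Longrightarrow> f j i = - f i j"
  shows "(\<Sum>i\<in>J. \<Sum>j\<in>J - {i}. f i j) = 0"
proof -
  have "(\<Sum>i\<in>J. \<Sum>j\<in>J - {i}. f i j) = (\<Sum>i\<in>J. (\<Sum>j\<in>{j\<in>J. i < j}. f i j) + (\<Sum>j\<in>{j\<in>J. j < i}. f i j))"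
  proof (rule sum.cong[OF refl])
    fix i :: nat
    have "J - {i} = {j\<in>J. i < j} \<union> {j\<in>J. j < i}" by auto
    moreover have "{j\<in>J. i < j} \<inter> {j\<in>J. j < i} = {}"
      unfolding disjoint_iff mem_Collect_eq using less_asym by blast
    ultimately show "(\<Sum>j\<in>J - {i}. f i j) = (\<Sum>j\<in>{j\<in>J. i < j}. f i j) + (\<Sum>j\<in>{j\<in>J. j < i}. f i j)"
      using assms(1) by (simp only:) (rule sum.union_disjoint, simp_all)
  qed
  also have "\<dots> = (\<Sum>i\<in>J. \<Sum>j\<in>{j\<in>J. i < j}. f i j) + (\<Sum>i\<in>J. \<Sum>j\<in>{j\<in>J. j < i}. f i j)"
    by (rule sum.distrib)
  also have "(\<Sum>i\<in>J. \<Sum>j\<in>{j\<in>J. j < i}. f i j) = (\<Sum>j\<in>J. \<Sum>i\<in>{i\<in>J. j < i}. f i j)"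
    using assms(1) by (rule sum.swap_restrict) fact
  also have "\<dots> = - (\<Sum>j\<in>J. \<Sum>i\<in>{i\<in>J. j < i}. f j i)"
    unfolding sum_negf[symmetric] by (intro sum.cong refl) (auto simp: f)
  finally show ?thesis by simp
qed

text \<open>Deleting \<open>j\<close> does not change how many elements lie below the smaller
  \<open>i\<close>, whereas deleting \<open>i\<close> lowers the count below \<open>j\<close> by
  one; this is the single change of sign.\<close>

lemma wedge_sign:
  fixes J :: "nat set"
  assumes "finite J" "i \<in> J" "j \<in> J" "i < j"
  shows "(-1) ^ card {l\<in>J. l < j} * (-1) ^ card {l\<in>J - {j}. l < i}
       = - ((-1) ^ card {l\<in>J. l < i} * (-1) ^ card {l\<in>J - {i}. l < j} :: 'r::comm_ring_1)"
proof -
  have 1: "{l\<in>J - {j}. l < i} = {l\<in>J. l < i}" using assms by auto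
  have "{l\<in>J. l < j} = insert i {l\<in>J - {i}. l < j}" using assms by auto
  then have 2: "card {l\<in>J. l < j} = Suc (card {l\<in>J - {i}. l < j})" using assms(1) by simp
  show ?thesis unfolding 1 2 by simp
qed

lemma wedge_wedge_sum:
  "wedge v (wedge w D) J = (\<Sum>i\<in>J. \<Sum>j\<in>J - {i}. v i * w j *
      ((-1) ^ card {l\<in>J. l < i} * (-1) ^ card {l\<in>J - {i}. l < j}) * D (J - {i} - {j}))"
  unfolding wedge_def sum_distrib_left by (intro sum.cong refl) (simp add: algebra_simps)

text \<open>When both products are added, the coefficients from the two vectors are symmetric in
  \<open>(i, j)\<close> and the signs antisymmetric, so \<open>sum_antisym\<close> applies.\<close>

lemma wedge_anticommute:
  assumes "finite J"
  shows "wedge v (wedge w D) J = - wedge w (wedge v D) J"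
proof -
  let ?s = "\<lambda>i j. (-1) ^ card {l\<in>J. l < i} * (-1) ^ card {l\<in>J - {i}. l < j} :: 'a"
  have "wedge v (wedge w D) J + wedge w (wedge v D) J
      = (\<Sum>i\<in>J. \<Sum>j\<in>J - {i}. (v i * w j + w i * v j) * ?s i j * D (J - {i} - {j}))"
    unfolding wedge_wedge_sum sum.distrib[symmetric] by (intro sum.cong refl) (simp add: algebra_simps)
  also have "\<dots> = 0"
  proof (rule sum_antisym[OF assms])
    fix i j assume "i \<in> J" "j \<in> J" "i < j"
    moreover have "J - {j} - {i} = J - {i} - {j}" by auto
    ultimately show "(v j * w i + w j * v i) * ?s j i * D (J - {j} - {i})
        = - ((v i * w j + w i * v j) * ?s i j * D (J - {i} - {j}))"
      using wedge_sign[OF assms, of i j, where 'r='a] by (simp add: algebra_simps)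
  qed
  finally show ?thesis by (simp add: eq_neg_iff_add_eq_0)
qed

lemma wedge_same:
  assumes "finite J"
  shows "wedge w (wedge w D) J = 0"
  unfolding wedge_wedge_sum
proof (rule sum_antisym[OF assms])
  let ?s = "\<lambda>i j. (-1) ^ card {l\<in>J. l < i} * (-1) ^ card {l\<in>J - {i}. l < j} :: 'a"
  fix i j assume "i \<in> J" "j \<in> J" "i < j"
  moreover have "J - {j} - {i} = J - {i} - {j}" by auto
  ultimately show "w j * w i * ?s j i * D (J - {j} - {i}) = - (w i * w j * ?s i j * D (J - {i} - {j}))"
    using wedge_sign[OF assms, of i j, where 'r='a] by (simp add: algebra_simps)
qed

lemma wedges_repeat:
  assumes "finite J" "w \<in> set ws"
  shows "wedge w (foldr wedge ws D) J = 0"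
  using assms
proof (induction ws arbitrary: J)
  case (Cons v ws)
  show ?case
  proof (cases "v = w")
    case True then show ?thesis using wedge_same[OF Cons.prems(1)] by simp
  next
    case False
    then have "wedge v (wedge w (foldr wedge ws D)) J = 0"
      using Cons unfolding wedge_def[of v] by (auto intro!: sum.neutral)
    then show ?thesis using wedge_anticommute[OF Cons.prems(1), of w v] by simp
  qed
qed simp

text \<open>This later excludes that a Frobenius twist occurs twice when a Mui form is
  evaluated.\<close>

lemma wedges_not_distinct:
  assumes "finite J" "\<not> distinct ws"
  shows "foldr wedge ws D J = 0"
  using assms
proof (induction ws arbitrary: J)
  case (Cons v ws)
  show ?case
  proof (cases "v \<in> set ws")
    case True
    then show ?thesis using wedges_repeat[OF Cons.prems(1)] by simp
  next
    case False
    then show ?thesis unfolding wedges_Cons using Cons by (intro sum.neutral) auto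
  qed
qed simp

section \<open>Multilinear expansion and the Leibniz formula\<close>

lemma wedge_lin:
  assumes "finite J" "finite A"
  shows "wedge w (\<lambda>I. \<Sum>a\<in>A. c a * D a I) J = (\<Sum>a\<in>A. c a * wedge w (D a) J)"
  unfolding wedge_def sum_distrib_left
  by (subst sum.swap) (intro sum.cong refl, simp add: algebra_simps)

lemma wedges_lin:
  assumes "finite J" "finite A"
  shows "foldr wedge ws (\<lambda>I. \<Sum>a\<in>A. c a * D a I) J = (\<Sum>a\<in>A. c a * foldr wedge ws (D a) J)"
  using assms
proof (induction ws arbitrary: J)
  case (Cons w ws)
  have "foldr wedge (w # ws) (\<lambda>I. \<Sum>a\<in>A. c a * D a I) J = wedge w (\<lambda>I. \<Sum>a\<in>A. c a * foldr wedge ws (D a) I) J"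
    using Cons by (auto intro!: wedge_cong)
  then show ?case using wedge_lin[OF Cons.prems] by simp
qed simp

lemma wedges_cong:
  assumes "finite J" "\<And>I. I \<subseteq> J \<Longrightarrow> D I = E I"
  shows "foldr wedge ws D J = foldr wedge ws E J"
  using assms
proof (induction ws arbitrary: J)
  case (Cons w ws)
  then show ?case by (auto intro!: wedge_cong Cons.IH)
qed simp

lemma wedges_expand:
  assumes "J \<subseteq> A" "finite A"
  shows "foldr wedge ws D J = (\<Sum>I\<in>Pow A. D I * foldr wedge ws (ext_basis I) J)"
proof -
  have "foldr wedge ws D J = foldr wedge ws (\<lambda>K. \<Sum>I\<in>Pow A. D I * ext_basis I K) J"
  proof (rule wedges_cong)
    fix K assume "K \<subseteq> J"
    then have "K \<in> Pow A" using assms by auto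
    moreover have "(\<Sum>I\<in>Pow A. D I * ext_basis I K) = (\<Sum>I\<in>Pow A. if I = K then D I else 0)"
      by (rule sum.cong) (auto simp: ext_basis_def)
    ultimately show "D K = (\<Sum>I\<in>Pow A. D I * ext_basis I K)" using assms by simp
  qed (use assms finite_subset in auto)
  also have "\<dots> = (\<Sum>I\<in>Pow A. D I * foldr wedge ws (ext_basis I) J)"
    by (rule wedges_lin) (use assms finite_subset in auto)
  finally show ?thesis .
qed

lemma wedges_card:
  assumes "finite J" "card J \<noteq> length ws + card I" "finite I"
  shows "foldr wedge ws (ext_basis I) J = 0"
  using assms
proof (induction ws arbitrary: J)
  case Nil then show ?case by (auto simp: ext_basis_def)
next
  case (Cons w ws)
  show ?case unfolding wedges_Cons
  proof (rule sum.neutral, intro ballI)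
    fix j assume "j \<in> J"
    then have "card J = Suc (card (J - {j}))" using Cons.prems(1) card_Suc_Diff1 by metis
    then have "foldr wedge ws (ext_basis I) (J - {j}) = 0"
      using Cons.prems by (intro Cons.IH) auto
    then show "w j * (-1) ^ card {l \<in> J. l < j} * foldr wedge ws (ext_basis I) (J - {j}) = 0" by simp
  qed
qed

text \<open>The Leibniz formula for minors, \<open>ls ! i\<close> being the coordinate taken from
  the \<open>i\<close>th factor. Signs are recorded only as 1 or -1, because later only degrees and
  the nonvanishing of single terms matter.\<close>

lemma wedges_leibniz:
  "\<exists>sg :: nat list \<Rightarrow> 'r::comm_ring_1. (\<forall>ls. sg ls = 1 \<or> sg ls = -1) \<and>
     (\<forall>ws. \<forall>J. finite J \<longrightarrow> wedges ws J = (\<Sum>ls | length ls = length ws \<and> distinct ls \<and> set ls = J.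
         sg ls * (\<Prod>i<length ws. (ws ! i) (ls ! i))))"
proof -
  \<comment> \<open>The sign of \<open>i # ls\<close> starts with the Laplace sign of
    \<open>i\<close> in the index set \<open>insert i (set ls)\<close>.\<close>
  define sg :: "nat list \<Rightarrow> 'r" where
    "sg = rec_list 1 (\<lambda>i ls s. (-1) ^ card {l\<in>insert i (set ls). l < i} * s)"
  have sg: "sg [] = 1" "sg (i # ls) = (-1) ^ card {l\<in>insert i (set ls). l < i} * sg ls" for i ls
    by (simp_all add: sg_def)
  have 1: "sg ls = 1 \<or> sg ls = -1" for ls
    by (induction ls) (auto simp: sg minus_one_power_iff)
  have "wedges ws J = (\<Sum>ls | length ls = length ws \<and> distinct ls \<and> set ls = J.
         sg ls * (\<Prod>i<length ws. (ws ! i) (ls ! i)))" if "finite J" for ws J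
    using that
  proof (induction ws arbitrary: J)
    case Nil
    have "{ls :: nat list. length ls = length [] \<and> distinct ls \<and> set ls = J} = (if J = {} then {[]} else {})" by auto
    then show ?case by (auto simp: ext_basis_def sg)
  next
    case (Cons w ws)
    let ?L = "\<lambda>k J. {ls :: nat list. length ls = k \<and> distinct ls \<and> set ls = J}"
    have fin: "finite (?L k J)" if "finite J" for k J
      by (rule finite_subset[of _ "{ls. set ls \<subseteq> J \<and> length ls = k}"]) (auto simp: finite_lists_length_eq that)
    have L: "?L (length (w # ws)) J = (\<Union>i\<in>J. (#) i ` ?L (length ws) (J - {i}))"
    proof (intro equalityI subsetI)
      fix ls assume ls: "ls \<in> ?L (length (w # ws)) J"
      then obtain i ls' where l: "ls = i # ls'" by (cases ls) auto
      then have "ls' \<in> ?L (length ws) (J - {i})" "i \<in> J" using ls by auto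
      then show "ls \<in> (\<Union>i\<in>J. (#) i ` ?L (length ws) (J - {i}))" using l by blast
    next
      fix ls assume "ls \<in> (\<Union>i\<in>J. (#) i ` ?L (length ws) (J - {i}))"
      then obtain i ls' where l: "i \<in> J" "ls' \<in> ?L (length ws) (J - {i})" "ls = i # ls'" by blast
      then have "set ls = J" "length ls = length (w # ws)" "distinct ls" by auto
      then show "ls \<in> ?L (length (w # ws)) J" by blast
    qed
    have "wedges (w # ws) J = (\<Sum>i\<in>J. w i * (-1) ^ card {l\<in>J. l < i} *
        (\<Sum>ls\<in>?L (length ws) (J - {i}). sg ls * (\<Prod>i<length ws. (ws ! i) (ls ! i))))"
      unfolding wedges_Cons by (intro sum.cong refl arg_cong2[of _ _ _ _ "(*)"] Cons.IH) (use Cons in auto)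
    also have "\<dots> = (\<Sum>i\<in>J. \<Sum>ls\<in>(#) i ` ?L (length ws) (J - {i}).
        sg ls * (\<Prod>i<length (w # ws). ((w # ws) ! i) (ls ! i)))"
    proof (rule sum.cong[OF refl])
      fix i assume i: "i \<in> J"
      have "w i * (-1) ^ card {l\<in>J. l < i} * (\<Sum>ls\<in>?L (length ws) (J - {i}). sg ls * (\<Prod>i<length ws. (ws ! i) (ls ! i)))
        = (\<Sum>ls\<in>?L (length ws) (J - {i}). sg (i # ls) * (\<Prod>k<length (w # ws). ((w # ws) ! k) ((i # ls) ! k)))"
        unfolding sum_distrib_left
      proof (rule sum.cong[OF refl])
        fix ls assume "ls \<in> ?L (length ws) (J - {i})"
        then have "insert i (set ls) = J" using i by auto
        then show "w i * (-1) ^ card {l\<in>J. l < i} * (sg ls * (\<Prod>i<length ws. (ws ! i) (ls ! i)))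
           = sg (i # ls) * (\<Prod>k<length (w # ws). ((w # ws) ! k) ((i # ls) ! k))"
          by (simp add: sg prod.lessThan_Suc_shift mult_ac del: prod.lessThan_Suc)
      qed
      also have "\<dots> = (\<Sum>ls\<in>(#) i ` ?L (length ws) (J - {i}). sg ls * (\<Prod>i<length (w # ws). ((w # ws) ! i) (ls ! i)))"
        by (subst sum.reindex) auto
      finally show "w i * (-1) ^ card {l\<in>J. l < i} * (\<Sum>ls\<in>?L (length ws) (J - {i}). sg ls * (\<Prod>i<length ws. (ws ! i) (ls ! i)))
         = (\<Sum>ls\<in>(#) i ` ?L (length ws) (J - {i}). sg ls * (\<Prod>i<length (w # ws). ((w # ws) ! i) (ls ! i)))" .
    qed
    also have "\<dots> = (\<Sum>ls\<in>?L (length (w # ws)) J. sg ls * (\<Prod>i<length (w # ws). ((w # ws) ! i) (ls ! i)))"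
      unfolding L using Cons.prems by (intro sum.UNION_disjoint[symmetric]) (auto intro!: finite_imageI fin)
    finally show ?case .
  qed
  then show ?thesis using 1 by blast
qed

section \<open>The action of matrices on the exterior algebra\<close>

fun sel_wedges :: "(bool \<times> (nat \<Rightarrow> 'r::comm_ring_1)) list \<Rightarrow> nat set \<Rightarrow> 'r" where
  "sel_wedges [] = ext_basis {}"
| "sel_wedges ((e, w) # l) = (if e then wedge w (sel_wedges l) else sel_wedges l)"

text \<open>\<open>ext_cols G n J I\<close> is the minor of \<open>G\<close> with columns
  \<open>J\<close> and rows \<open>I\<close>, as a coordinate of the product of the columns in
  \<open>J\<close>; for \<open>I = J = {..<n}\<close> it is the determinant. Selecting columns by a
  list of flags matches the flags in the monomials of homology.\<close>

definition ext_cols :: "(nat \<Rightarrow> nat \<Rightarrow> 'r::comm_ring_1) \<Rightarrow> nat \<Rightarrow> nat set \<Rightarrow> nat set \<Rightarrow> 'r" where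
  "ext_cols G n J = sel_wedges (map (\<lambda>s. (s \<in> J, \<lambda>j. G j s)) [0..<n])"

definition ext_map :: "(nat \<Rightarrow> nat \<Rightarrow> 'r::comm_ring_1) \<Rightarrow> nat \<Rightarrow> (nat set \<Rightarrow> 'r) \<Rightarrow> nat set \<Rightarrow> 'r" where
  "ext_map G n D I = (\<Sum>J\<in>Pow {..<n}. D J * ext_cols G n J I)"

definition mat_app :: "(nat \<Rightarrow> nat \<Rightarrow> 'r::comm_ring_1) \<Rightarrow> nat \<Rightarrow> (nat \<Rightarrow> 'r) \<Rightarrow> nat \<Rightarrow> 'r" where
  "mat_app G n w j = (\<Sum>s<n. G j s * w s)"

lemma sel_wedges_eq_wedges: "sel_wedges l = wedges (map snd (filter fst l))"
  by (induction l rule: sel_wedges.induct) auto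

lemma ext_cols_card:
  assumes "finite I" "J \<subseteq> {..<n}" "card I \<noteq> card J"
  shows "ext_cols G n J I = 0"
proof -
  have "length (filter (\<lambda>s. s \<in> J) [0..<n]) = card J"
  proof -
    have "length (filter (\<lambda>s. s \<in> J) [0..<n]) = card (set (filter (\<lambda>s. s \<in> J) [0..<n]))"
      by (rule distinct_card[symmetric]) simp
    also have "set (filter (\<lambda>s. s \<in> J) [0..<n]) = J" using assms by auto
    finally show ?thesis .
  qed
  then show ?thesis using assms unfolding ext_cols_def sel_wedges_eq_wedges
    by (intro wedges_card) (auto simp: filter_map comp_def)
qed

text \<open>Column \<open>j\<close> moves past the selected columns before it, at the cost of one
  sign each, and is killed if it is already there. The start \<open>m\<close> is variable for the
  induction on \<open>n - m\<close>.\<close>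

lemma wedge_sel_wedges:
  assumes "finite I" "m \<le> j" "j < n"
  shows "wedge (\<lambda>i. G i j) (sel_wedges (map (\<lambda>s. (s \<in> J, \<lambda>i. G i s)) [m..<n])) I
       = (if j \<in> J then 0 else (-1) ^ card {l\<in>J. m \<le> l \<and> l < j} *
            sel_wedges (map (\<lambda>s. (s \<in> insert j J, \<lambda>i. G i s)) [m..<n]) I)"
  using assms(2,3,1)
proof (induction "n - m" arbitrary: m I)
  case 0 then show ?case by simp
next
  case (Suc d)
  have up: "[m..<n] = m # [Suc m..<n]" using Suc by (simp add: upt_conv_Cons)
  show ?case
  proof (cases "j = m")
    case True
    have eq: "map (\<lambda>s. (s = m \<or> s \<in> J, \<lambda>i. G i s)) [Suc m..<n] = map (\<lambda>s. (s \<in> J, \<lambda>i. G i s)) [Suc m..<n]"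
      by auto
    have "{l \<in> J. m \<le> l \<and> l < m} = {}" by (auto simp: not_less)
    then have "card {l \<in> J. m \<le> l \<and> l < m} = 0" by (simp only: card.empty)
    moreover have "(-1) ^ 0 = (1 :: 'a)" by simp
    ultimately show ?thesis unfolding up True using Suc.prems eq
      by (simp only: list.map sel_wedges.simps insert_iff simp_thms if_True if_False mult_1)
         (simp add: wedge_same)
  next
    case False
    then have j: "Suc m \<le> j" using Suc by simp
    have IH: "wedge (\<lambda>i. G i j) (sel_wedges (map (\<lambda>s. (s \<in> J, \<lambda>i. G i s)) [Suc m..<n])) K
       = (if j \<in> J then 0 else (-1) ^ card {l\<in>J. Suc m \<le> l \<and> l < j} *
            sel_wedges (map (\<lambda>s. (s \<in> insert j J, \<lambda>i. G i s)) [Suc m..<n]) K)" if "finite K" for K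
      using Suc that j by simp
    have mj: "m \<in> insert j J \<longleftrightarrow> m \<in> J" using False by auto
    show ?thesis
    proof (cases "m \<in> J")
      case False
      then have "{l\<in>J. Suc m \<le> l \<and> l < j} = {l\<in>J. m \<le> l \<and> l < j}" by (auto simp: Suc_le_eq order_le_less)
      with IH[OF Suc.prems(3)] show ?thesis unfolding up using False mj by simp
    next
      case True
      have "{l\<in>J. m \<le> l \<and> l < j} = insert m {l\<in>J. Suc m \<le> l \<and> l < j}" using True j by auto
      then have c: "card {l\<in>J. m \<le> l \<and> l < j} = Suc (card {l\<in>J. Suc m \<le> l \<and> l < j})" by simp
      let ?S = "sel_wedges (map (\<lambda>s. (s \<in> J, \<lambda>i. G i s)) [Suc m..<n])"
      let ?T = "sel_wedges (map (\<lambda>s. (s \<in> insert j J, \<lambda>i. G i s)) [Suc m..<n])"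
      have "wedge (\<lambda>i. G i j) (wedge (\<lambda>i. G i m) ?S) I = - wedge (\<lambda>i. G i m) (wedge (\<lambda>i. G i j) ?S) I"
        by (rule wedge_anticommute) fact
      also have "wedge (\<lambda>i. G i m) (wedge (\<lambda>i. G i j) ?S) I
          = (if j \<in> J then 0 else (-1) ^ card {l\<in>J. Suc m \<le> l \<and> l < j} * wedge (\<lambda>i. G i m) ?T I)"
        unfolding wedge_def[of "\<lambda>i. G i m"] using IH Suc.prems(3)
        by (auto simp: sum_distrib_left mult_ac intro!: sum.cong)
      finally show ?thesis unfolding up using True by (simp add: c)
    qed
  qed
qed

lemma wedge_ext_cols:
  assumes "finite I" "j < n"
  shows "wedge (\<lambda>i. G i j) (ext_cols G n J) I
       = (if j \<in> J then 0 else (-1) ^ card {l\<in>J. l < j} * ext_cols G n (insert j J) I)"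
  using wedge_sel_wedges[OF assms(1) _ assms(2), of 0 G J] unfolding ext_cols_def by simp

text \<open>The exterior power of \<open>G\<close> is multiplicative. Replacing the pairs
  \<open>(J, j)\<close> with \<open>j \<in> J\<close> by \<open>(j, J - {j})\<close> reduces this to
  the product with a single column, which is \<open>wedge_ext_cols\<close>.\<close>

lemma ext_map_wedge:
  assumes "finite I"
  shows "ext_map G n (wedge w D) I = wedge (mat_app G n w) (ext_map G n D) I"
proof -
  let ?N = "{..<n}"
  have card: "{l\<in>J. l \<noteq> j \<and> l < j} = {l\<in>J. l < j}" for J and j :: nat by auto
  have "ext_map G n (wedge w D) I = (\<Sum>J\<in>Pow ?N. \<Sum>j\<in>J. w j * (-1) ^ card {l\<in>J. l < j} * D (J - {j}) * ext_cols G n J I)"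
    unfolding ext_map_def wedge_def sum_distrib_right ..
  also have "\<dots> = (\<Sum>(J,j)\<in>Sigma (Pow ?N) (\<lambda>J. J). w j * (-1) ^ card {l\<in>J. l < j} * D (J - {j}) * ext_cols G n J I)"
    by (rule sum.Sigma) (auto intro: finite_subset)
  also have "\<dots> = (\<Sum>(j,J)\<in>Sigma ?N (\<lambda>j. {J\<in>Pow ?N. j \<notin> J}). w j * (-1) ^ card {l\<in>J. l < j} * D J * ext_cols G n (insert j J) I)"
    by (rule sum.reindex_bij_witness[of _ "\<lambda>(j,J). (insert j J, j)" "\<lambda>(J,j). (j, J - {j})"])
       (auto simp: insert_absorb card)
  also have "\<dots> = (\<Sum>j\<in>?N. \<Sum>J\<in>{J\<in>Pow ?N. j \<notin> J}. w j * (-1) ^ card {l\<in>J. l < j} * D J * ext_cols G n (insert j J) I)"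
    by (rule sum.Sigma[symmetric]) auto
  also have "\<dots> = (\<Sum>j\<in>?N. w j * (\<Sum>J\<in>Pow ?N. D J * wedge (\<lambda>i. G i j) (ext_cols G n J) I))"
    using assms by (intro sum.cong refl) (auto simp: sum_distrib_left wedge_ext_cols mult_ac intro!: sum.mono_neutral_cong_left)
  also have "\<dots> = (\<Sum>j\<in>?N. w j * (\<Sum>J\<in>Pow ?N. D J * (\<Sum>i\<in>I. G i j * (-1) ^ card {l\<in>I. l < i} * ext_cols G n J (I - {i}))))"
    unfolding wedge_def ..
  also have "\<dots> = (\<Sum>i\<in>I. \<Sum>j\<in>?N. G i j * w j * (-1) ^ card {l\<in>I. l < i} * (\<Sum>J\<in>Pow ?N. D J * ext_cols G n J (I - {i})))"
  proof -
    have "w j * (\<Sum>J\<in>Pow ?N. D J * (\<Sum>i\<in>I. G i j * (-1) ^ card {l\<in>I. l < i} * ext_cols G n J (I - {i})))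
        = (\<Sum>i\<in>I. G i j * w j * (-1) ^ card {l\<in>I. l < i} * (\<Sum>J\<in>Pow ?N. D J * ext_cols G n J (I - {i})))" for j
      unfolding sum_distrib_left by (subst sum.swap) (intro sum.cong refl, simp only: mult_ac)
    then show ?thesis by (simp only:) (rule sum.swap)
  qed
  also have "\<dots> = wedge (mat_app G n w) (ext_map G n D) I"
    unfolding wedge_def ext_map_def mat_app_def by (simp add: sum_distrib_right)
  finally show ?thesis .
qed

lemma ext_map_wedges:
  assumes "finite I"
  shows "ext_map G n (foldr wedge ws D) I = foldr wedge (map (mat_app G n) ws) (ext_map G n D) I"
  using assms
proof (induction ws arbitrary: I)
  case (Cons w ws)
  then show ?case by (auto simp: ext_map_wedge intro!: wedge_cong)
qed simp

lemma ext_map_empty: "finite I \<Longrightarrow> ext_map G n (ext_basis {}) I = ext_basis {} I"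
proof -
  have "sel_wedges (map (\<lambda>s. (s \<in> {}, \<lambda>j. G j s)) [0..<n]) = ext_basis {}"
    by (simp add: sel_wedges_eq_wedges)
  then show ?thesis by (simp add: ext_map_def ext_basis_empty_sum ext_cols_def)
qed

section \<open>Divided powers\<close>

definition expos :: "nat \<Rightarrow> nat \<Rightarrow> nat list set" where
  "expos n d = {t. length t = n \<and> sum_list t = d}"

definition mono_val :: "nat \<Rightarrow> (nat \<Rightarrow> 'r::comm_ring_1) \<Rightarrow> nat list \<Rightarrow> 'r" where
  "mono_val n X t = (\<Prod>i<n. X i ^ (t ! i))"

lemma finite_expos [simp]: "finite (expos n d)"
proof (rule finite_subset)
  show "expos n d \<subseteq> {t. set t \<subseteq> {..d} \<and> length t = n}"
    by (auto simp: expos_def intro: member_le_sum_list)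
qed (simp add: finite_lists_length_eq)

lemma expos_0: "expos 0 d = (if d = 0 then {[]} else {})"
  by (auto simp: expos_def)

lemma expos_Suc: "expos (Suc n) d = (\<Union>k\<in>{..d}. (#) k ` expos n (d - k))"
proof (intro equalityI subsetI)
  fix t assume "t \<in> expos (Suc n) d"
  then obtain k t' where "t = k # t'" "length t' = n" "k + sum_list t' = d"
    by (cases t) (auto simp: expos_def)
  then have "t' \<in> expos n (d - k)" "k \<in> {..d}" by (auto simp: expos_def)
  then show "t \<in> (\<Union>k\<in>{..d}. (#) k ` expos n (d - k))" using \<open>t = k # t'\<close> by blast
qed (auto simp: expos_def)

lemma sum_expos_Suc: "(\<Sum>t\<in>expos (Suc n) d. f t) = (\<Sum>k\<le>d. \<Sum>t\<in>expos n (d - k). f (k # t))"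
proof -
  have "(\<Sum>t\<in>expos (Suc n) d. f t) = (\<Sum>k\<le>d. \<Sum>t\<in>(#) k ` expos n (d - k). f t)"
    unfolding expos_Suc by (rule sum.UNION_disjoint) auto
  also have "\<dots> = (\<Sum>k\<le>d. \<Sum>t\<in>expos n (d - k). f (k # t))"
    by (rule sum.cong[OF refl]) (simp add: sum.reindex)
  finally show ?thesis .
qed

lemma sum_list_minus:
  "list_all2 (\<le>) a t \<Longrightarrow> sum_list (map2 (-) t a) = sum_list t - (sum_list a :: nat) \<and> sum_list a \<le> sum_list t"
  by (induction a t rule: list_all2_induct) auto

lemma box_Cons:
  "{a. list_all2 (\<le>) a (k # t)} = (\<lambda>(x, xs). x # xs) ` ({..k} \<times> {a. list_all2 (\<le>) a (t::nat list)})"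
proof (intro equalityI subsetI)
  fix a assume "a \<in> {a. list_all2 (\<le>) a (k # t)}"
  then show "a \<in> (\<lambda>(x, xs). x # xs) ` ({..k} \<times> {a. list_all2 (\<le>) a t})"
    by (cases a) (auto simp: image_iff)
qed auto

lemma finite_box [simp]: "finite {a. list_all2 (\<le>) a (t::nat list)}"
proof (induction t)
  case (Cons k t) then show ?case unfolding box_Cons by simp
qed simp

lemma sum_box_prod:
  fixes f :: "nat \<Rightarrow> nat \<Rightarrow> 'r::comm_semiring_1"
  shows "(\<Sum>a | list_all2 (\<le>) a t. \<Prod>j<length t. f j (a ! j)) = (\<Prod>j<length t. \<Sum>k\<le>t ! j. f j k)"
proof (induction t arbitrary: f)
  case (Cons k t)
  have "(\<Sum>a | list_all2 (\<le>) a (k # t). \<Prod>j<length (k # t). f j (a ! j))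
     = (\<Sum>(x, a)\<in>{..k} \<times> {a. list_all2 (\<le>) a t}. f 0 x * (\<Prod>j<length t. f (Suc j) (a ! j)))"
    unfolding box_Cons
    by (subst sum.reindex) (auto simp: inj_on_def prod.lessThan_Suc_shift simp del: prod.lessThan_Suc intro!: sum.cong)
  also have "\<dots> = (\<Sum>x\<le>k. f 0 x) * (\<Sum>a | list_all2 (\<le>) a t. \<Prod>j<length t. f (Suc j) (a ! j))"
    by (simp add: sum.cartesian_product[symmetric] sum_product)
  also have "\<dots> = (\<Prod>j<length (k # t). \<Sum>x\<le>(k # t) ! j. f j x)"
    unfolding Cons.IH[of "\<lambda>j. f (Suc j)"] by (simp add: prod.lessThan_Suc_shift del: prod.lessThan_Suc)
  finally show ?case .
qed simp

text \<open>The binomial theorem in every coordinate, multiplied out over the box of exponents below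
  \<open>t\<close>.\<close>

lemma multi_binomial:
  fixes c Y :: "nat \<Rightarrow> 'r::comm_ring_1"
  assumes "length t = n"
  shows "(\<Sum>a | list_all2 (\<le>) a t. mono_val n c a * of_nat (\<Prod>j<n. (t ! j) choose (a ! j)) * mono_val n Y (map2 (-) t a))
       = mono_val n (\<lambda>j. c j + Y j) t"
proof -
  have "(\<Sum>a | list_all2 (\<le>) a t. mono_val n c a * of_nat (\<Prod>j<n. (t ! j) choose (a ! j)) * mono_val n Y (map2 (-) t a))
     = (\<Sum>a | list_all2 (\<le>) a t. \<Prod>j<length t. of_nat ((t ! j) choose (a ! j)) * c j ^ (a ! j) * Y j ^ (t ! j - a ! j))"
  proof (rule sum.cong[OF refl])
    fix a assume "a \<in> {a. list_all2 (\<le>) a t}"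
    then have "length a = n" using assms by (auto dest: list_all2_lengthD)
    then show "mono_val n c a * of_nat (\<Prod>j<n. (t ! j) choose (a ! j)) * mono_val n Y (map2 (-) t a)
      = (\<Prod>j<length t. of_nat ((t ! j) choose (a ! j)) * c j ^ (a ! j) * Y j ^ (t ! j - a ! j))"
      unfolding mono_val_def of_nat_prod prod.distrib[symmetric] using assms
      by (intro prod.cong) (simp_all add: mult_ac)
  qed
  also have "\<dots> = (\<Prod>j<length t. \<Sum>k\<le>t ! j. of_nat ((t ! j) choose k) * c j ^ k * Y j ^ (t ! j - k))"
    by (rule sum_box_prod)
  also have "\<dots> = mono_val n (\<lambda>j. c j + Y j) t"
    unfolding mono_val_def assms binomial_ring ..
  finally show ?thesis .
qed

text \<open>
  \<open>div_coeff n cs ts t\<close> is the coefficient of \<open>v^[t]\<close> in the product of the divided powers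
  \<open>(\<Sum>j<n. c j \<cdot> v\<^sub>j)^[k]\<close>, where \<open>c\<close> and \<open>k\<close> run through \<open>cs\<close> and \<open>ts\<close>.
\<close>

fun div_coeff :: "nat \<Rightarrow> (nat \<Rightarrow> 'r::comm_ring_1) list \<Rightarrow> nat list \<Rightarrow> nat list \<Rightarrow> 'r" where
  "div_coeff n (c # cs) (k # ks) t = (\<Sum>a | list_all2 (\<le>) a t \<and> sum_list a = k.
     mono_val n c a * of_nat (\<Prod>j<n. (t ! j) choose (a ! j)) * div_coeff n cs ks (map2 (-) t a))"
| "div_coeff n cs ks t = of_bool (t = replicate n 0)"

lemma replicate_iff_sum_list: "length t = n \<Longrightarrow> t = replicate n 0 \<longleftrightarrow> sum_list t = (0::nat)"
  by (metis in_set_replicate replicate_eqI sum_list_eq_0_iff)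

lemma div_coeff_degree:
  "length cs = length ks \<Longrightarrow> length t = n \<Longrightarrow> div_coeff n cs ks t \<noteq> 0 \<Longrightarrow> sum_list ks = sum_list t"
proof (induction n cs ks t rule: div_coeff.induct)
  case (1 n c cs k ks t)
  then obtain a where a: "list_all2 (\<le>) a t" "sum_list a = k" "div_coeff n cs ks (map2 (-) t a) \<noteq> 0"
    by (auto elim!: sum.not_neutral_contains_not_neutral) (metis mult_zero_right)
  have "length (map2 (-) t a) = n" using a(1) 1(3) by (auto dest: list_all2_lengthD)
  then have "sum_list ks = sum_list (map2 (-) t a)"
    using 1(1)[of a] 1(2) a by simp
  then show ?case using sum_list_minus[OF a(1)] a(2) by simp
qed (auto split: if_splits)

text \<open>
  In generating function form, the product of the divided powers becomes the product of the series
  \<open>exp (X\<^sub>i c\<^sub>i \<cdot> v)\<close>.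
\<close>

lemma div_coeff_generating:
  "length t = n \<Longrightarrow> (\<Sum>ks\<in>expos (length cs) (sum_list t). mono_val (length cs) X ks * div_coeff n cs ks t)
     = mono_val n (\<lambda>j. \<Sum>i<length cs. X i * (cs ! i) j) t"
proof (induction cs arbitrary: X t)
  case Nil
  show ?case
  proof (cases "sum_list t = 0")
    case True
    then have "t = replicate n 0" using replicate_iff_sum_list Nil by blast
    then show ?thesis by (simp add: expos_0 mono_val_def)
  next
    case False
    then obtain x where x: "x \<in> set t" "x \<noteq> 0" by auto
    then obtain i where i: "i < n" "t ! i = x" using Nil by (auto simp: in_set_conv_nth)
    have "(\<Prod>i<n. (0::'a) ^ (t ! i)) = 0"
      by (rule prod_zero) (use x i in \<open>auto simp: power_0_left\<close>)
    moreover have "t \<noteq> replicate n 0" using False by (metis sum_list_replicate mult_0_right)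
    ultimately show ?thesis by (simp add: expos_0 mono_val_def)
  qed
next
  case (Cons c cs)
  let ?m = "length cs" and ?d = "sum_list t"
  have mv: "mono_val (Suc ?m) X (k # ks) = X 0 ^ k * mono_val ?m (\<lambda>i. X (Suc i)) ks" for k ks
    by (simp add: mono_val_def prod.lessThan_Suc_shift del: prod.lessThan_Suc)
  let ?b = "\<lambda>a. mono_val n c a * of_nat (\<Prod>j<n. (t ! j) choose (a ! j))"
  let ?Y = "\<lambda>j. \<Sum>i<?m. X (Suc i) * (cs ! i) j"
  have "(\<Sum>ks\<in>expos (length (c # cs)) ?d. mono_val (length (c # cs)) X ks * div_coeff n (c # cs) ks t)
     = (\<Sum>k\<le>?d. \<Sum>ks\<in>expos ?m (?d - k). X 0 ^ k * mono_val ?m (\<lambda>i. X (Suc i)) ks *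
         (\<Sum>a | list_all2 (\<le>) a t \<and> sum_list a = k. ?b a * div_coeff n cs ks (map2 (-) t a)))"
    by (simp add: sum_expos_Suc mv)
  also have "\<dots> = (\<Sum>k\<le>?d. \<Sum>a | list_all2 (\<le>) a t \<and> sum_list a = k. X 0 ^ k * ?b a *
         (\<Sum>ks\<in>expos ?m (?d - k). mono_val ?m (\<lambda>i. X (Suc i)) ks * div_coeff n cs ks (map2 (-) t a)))"
    unfolding sum_distrib_left by (subst sum.swap) (intro sum.cong refl, simp only: mult_ac)
  also have "\<dots> = (\<Sum>k\<le>?d. \<Sum>a | list_all2 (\<le>) a t \<and> sum_list a = k. X 0 ^ sum_list a * ?b a *
         mono_val n ?Y (map2 (-) t a))"
  proof (intro sum.cong refl)
    fix k a assume "k \<in> {..?d}" and a: "a \<in> {a. list_all2 (\<le>) a t \<and> sum_list a = k}"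
    then have "length (map2 (-) t a) = n" "sum_list (map2 (-) t a) = ?d - k"
      using sum_list_minus[of a t] Cons.prems by (auto dest: list_all2_lengthD)
    with Cons.IH[of "map2 (-) t a" "\<lambda>i. X (Suc i)"] a
    show "X 0 ^ k * ?b a * (\<Sum>ks\<in>expos ?m (?d - k). mono_val ?m (\<lambda>i. X (Suc i)) ks * div_coeff n cs ks (map2 (-) t a))
       = X 0 ^ sum_list a * ?b a * mono_val n ?Y (map2 (-) t a)" by simp
  qed
  also have "\<dots> = (\<Sum>k\<in>{..?d}. \<Sum>a\<in>{a\<in>{a. list_all2 (\<le>) a t}. sum_list a = k}. X 0 ^ sum_list a * ?b a *
         mono_val n ?Y (map2 (-) t a))" by simp
  \<comment> \<open>Each \<open>a\<close> below \<open>t\<close> has exactly one degree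
    \<open>k\<close>, so the two sums merge into one over the whole box, where
    \<open>multi_binomial\<close> applies.\<close>
  also have "\<dots> = (\<Sum>a | list_all2 (\<le>) a t. X 0 ^ sum_list a * ?b a * mono_val n ?Y (map2 (-) t a))"
    by (rule sum.group) (use sum_list_minus in auto)
  also have "\<dots> = (\<Sum>a | list_all2 (\<le>) a t. mono_val n (\<lambda>j. X 0 * c j) a * of_nat (\<Prod>j<n. (t ! j) choose (a ! j)) * mono_val n ?Y (map2 (-) t a))"
  proof (intro sum.cong refl)
    fix a assume "a \<in> {a. list_all2 (\<le>) a t}"
    then have "length a = n" using Cons.prems by (auto dest: list_all2_lengthD)
    then have "(\<Sum>i<n. a ! i) = sum_list a" by (simp add: sum_list_sum_nth atLeast0LessThan)
    then have "mono_val n (\<lambda>j. X 0 * c j) a = X 0 ^ sum_list a * mono_val n c a"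
      unfolding mono_val_def power_mult_distrib prod.distrib power_sum[symmetric] by simp
    then show "X 0 ^ sum_list a * ?b a * mono_val n ?Y (map2 (-) t a)
       = mono_val n (\<lambda>j. X 0 * c j) a * of_nat (\<Prod>j<n. (t ! j) choose (a ! j)) * mono_val n ?Y (map2 (-) t a)"
      by (simp add: mult_ac)
  qed
  also have "\<dots> = mono_val n (\<lambda>j. X 0 * c j + ?Y j) t" by (rule multi_binomial) fact
  also have "(\<lambda>j. X 0 * c j + ?Y j) = (\<lambda>j. \<Sum>i<length (c # cs). X i * ((c # cs) ! i) j)"
    by (simp add: sum.lessThan_Suc_shift del: sum.lessThan_Suc)
  finally show ?case .
qed

section \<open>The coefficients of the action on homology\<close>

definition hmon_of :: "nat \<Rightarrow> nat set \<Rightarrow> nat list \<Rightarrow> hmon" where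
  "hmon_of n J t = map (\<lambda>i. (i \<in> J, t ! i)) [0..<n]"

definition u_set :: "hmon \<Rightarrow> nat set" where
  "u_set x = {i. i < length x \<and> fst (x ! i)}"

lemma length_hmon_of [simp]: "length (hmon_of n J t) = n"
  by (simp add: hmon_of_def)

lemma nth_hmon_of [simp]: "i < n \<Longrightarrow> hmon_of n J t ! i = (i \<in> J, t ! i)"
  by (simp add: hmon_of_def)

lemma hmon_of_eta: "length x = n \<Longrightarrow> hmon_of n (u_set x) (map snd x) = x"
  by (rule nth_equalityI) (auto simp: u_set_def)

lemma u_set_hmon_of [simp]: "J \<subseteq> {..<n} \<Longrightarrow> u_set (hmon_of n J t) = J"
  by (auto simp: u_set_def)

lemma map_snd_hmon_of [simp]: "length t = n \<Longrightarrow> map snd (hmon_of n J t) = t"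
  by (rule nth_equalityI) auto

lemma u_set_subset: "length x = n \<Longrightarrow> u_set x \<subseteq> {..<n}"
  by (auto simp: u_set_def)

lemma hmon_of_eq_iff:
  assumes "J \<subseteq> {..<n}" "I \<subseteq> {..<n}" "length s = n" "length t = n"
  shows "hmon_of n I s = hmon_of n J t \<longleftrightarrow> I = J \<and> s = t"
  using assms by (metis u_set_hmon_of map_snd_hmon_of)

text \<open>A pair of monomials with the given product and a nonzero structure constant is
  determined by its first factor, that is, by a subset of \<open>J\<close> and exponents below
  \<open>t\<close>. The sum over the keys is reindexed accordingly; pairs outside the keys
  contribute 0.\<close>

lemma lookup_hom_mult:
  fixes f g :: "'k::field hom_elt"
  assumes f: "f \<in> carrier (homology n)" and g: "g \<in> carrier (homology n)"
    and J: "J \<subseteq> {..<n}" and t: "length t = n"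
  shows "Poly_Mapping.lookup (hom_mult f g) (hmon_of n J t) =
     (\<Sum>I\<in>Pow J. \<Sum>a | list_all2 (\<le>) a t.
        Poly_Mapping.lookup f (hmon_of n I a) * Poly_Mapping.lookup g (hmon_of n (J - I) (map2 (-) t a)) *
        ((-1) ^ card {(i, j). j < i \<and> i \<in> I \<and> j \<in> J - I} * of_nat (\<Prod>i<n. (t ! i) choose (a ! i))))"
proof -
  let ?P = "Pow J \<times> {a. list_all2 (\<le>) a t}"
  let ?h = "\<lambda>(I, a). (hmon_of n I a, hmon_of n (J - I) (map2 (-) t a))"
  let ?K = "Poly_Mapping.keys f \<times> Poly_Mapping.keys g"
  let ?T = "\<lambda>(x, y). Poly_Mapping.lookup f x * Poly_Mapping.lookup g y * hmon_coeff x y :: 'k"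
  have fJ: "finite J" using J finite_subset by blast
  have len: "length a = n" if "list_all2 (\<le>) a t" for a using that t by (auto dest: list_all2_lengthD)
  have inj: "inj_on ?h ?P"
  proof (rule inj_onI, clarify)
    fix I a I' a' assume *: "I \<subseteq> J" "list_all2 (\<le>) a t" "I' \<subseteq> J" "list_all2 (\<le>) a' t" "hmon_of n I a = hmon_of n I' a'"
    then have "I \<subseteq> {..<n}" "I' \<subseteq> {..<n}" using J by auto
    then show "I = I' \<and> a = a'" using * len by (simp add: hmon_of_eq_iff)
  qed
  have in_h: "(x, y) \<in> ?h ` ?P"
    if len: "length x = n" "length y = n" and m: "hmon_mult x y = hmon_of n J t" and c: "hmon_coeff x y \<noteq> (0::'k)" for x y
  proof -
    have xy: "(fst (x ! i) \<or> fst (y ! i)) = (i \<in> J)" "snd (x ! i) + snd (y ! i) = t ! i" if "i < n" for i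
    proof -
      have "hmon_mult x y ! i = (i \<in> J, t ! i)" unfolding m using that by simp
      then show "(fst (x ! i) \<or> fst (y ! i)) = (i \<in> J)" "snd (x ! i) + snd (y ! i) = t ! i"
        using that len by (auto simp: hmon_mult_def split: prod.splits)
    qed
    have d: "\<not> (fst (x ! i) \<and> fst (y ! i))" if "i < n" for i
    proof
      assume "fst (x ! i) \<and> fst (y ! i)"
      then have "\<exists>i<length x. fst (x ! i) \<and> fst (y ! i)" using that len by blast
      then have "hmon_coeff x y = (0::'k)" unfolding hmon_coeff_def by (rule if_P)
      then show False using c by contradiction
    qed
    have "snd (x ! i) \<le> t ! i" if "i < n" for i using xy(2)[OF that] by linarith
    then have "list_all2 (\<le>) (map snd x) t" by (simp add: list_all2_conv_all_nth len t)
    moreover have "u_set x \<subseteq> J" using xy(1) len by (auto simp: u_set_def)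
    moreover have "hmon_of n (J - u_set x) (map2 (-) t (map snd x)) = y"
    proof (rule nth_equalityI)
      fix i assume "i < length (hmon_of n (J - u_set x) (map2 (-) t (map snd x)))"
      then have i: "i < n" by simp
      have "fst (y ! i) = (i \<in> J \<and> i \<notin> u_set x)" using xy(1)[OF i] d[OF i] i len by (auto simp: u_set_def)
      moreover have "snd (y ! i) = t ! i - snd (x ! i)" using xy(2)[OF i] by linarith
      ultimately show "hmon_of n (J - u_set x) (map2 (-) t (map snd x)) ! i = y ! i"
        using i len t by (simp add: prod_eq_iff)
    qed (simp add: len)
    ultimately have "(u_set x, map snd x) \<in> ?P" "(x, y) = ?h (u_set x, map snd x)"
      using hmon_of_eta[OF len(1)] by simp_all
    then show ?thesis by (rule rev_image_eqI)
  qed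
  have coeff: "hmon_mult (hmon_of n I a) (hmon_of n (J - I) (map2 (-) t a)) = hmon_of n J t
      \<and> hmon_coeff (hmon_of n I a) (hmon_of n (J - I) (map2 (-) t a)) =
        ((-1) ^ card {(i, j). j < i \<and> i \<in> I \<and> j \<in> J - I} * of_nat (\<Prod>i<n. (t ! i) choose (a ! i)) :: 'k)"
    if "(I, a) \<in> ?P" for I a
  proof
    have I: "I \<subseteq> J" and a0: "list_all2 (\<le>) a t" using that by simp_all
    then have a: "length a = n" "\<And>i. i < n \<Longrightarrow> a ! i \<le> t ! i"
      using t by (simp_all add: list_all2_conv_all_nth)
    show "hmon_mult (hmon_of n I a) (hmon_of n (J - I) (map2 (-) t a)) = hmon_of n J t"
    proof (rule nth_equalityI)
      fix i assume "i < length (hmon_mult (hmon_of n I a) (hmon_of n (J - I) (map2 (-) t a)))"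
      then have "i < n" by (simp add: hmon_mult_def)
      then show "hmon_mult (hmon_of n I a) (hmon_of n (J - I) (map2 (-) t a)) ! i = hmon_of n J t ! i"
        using I a t by (simp add: hmon_mult_def) blast
    qed (simp add: hmon_mult_def)
    have nex: "\<not> (\<exists>i<n. fst (hmon_of n I a ! i) \<and> fst (hmon_of n (J - I) (map2 (-) t a) ! i))"
      by auto
    have "{(i, j). j < i \<and> i < n \<and> fst (hmon_of n I a ! i) \<and> fst (hmon_of n (J - I) (map2 (-) t a) ! j)}
        = {(i, j). j < i \<and> i \<in> I \<and> j \<in> J - I}" (is "?A = ?B")
    proof -
      have "(i, j) \<in> ?A \<longleftrightarrow> (i, j) \<in> ?B" for i j
      proof (cases "j < i \<and> i < n")
        case True then show ?thesis by simp
      next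
        case False
        moreover have "i < n" if "i \<in> I" using that I J by auto
        ultimately show ?thesis by auto
      qed
      then have "x \<in> ?A \<longleftrightarrow> x \<in> ?B" for x by (cases x) (simp only:)
      then show ?thesis by (rule Set.set_eqI)
    qed
    moreover have "(\<Prod>i<n. (snd (hmon_of n I a ! i) + snd (hmon_of n (J - I) (map2 (-) t a) ! i)) choose snd (hmon_of n I a ! i))
       = (\<Prod>i<n. (t ! i) choose (a ! i))"
      by (rule prod.cong) (use a t in auto)
    ultimately show "hmon_coeff (hmon_of n I a) (hmon_of n (J - I) (map2 (-) t a)) =
        ((-1) ^ card {(i, j). j < i \<and> i \<in> I \<and> j \<in> J - I} * of_nat (\<Prod>i<n. (t ! i) choose (a ! i)) :: 'k)"
      unfolding hmon_coeff_def length_hmon_of by (simp only: nex if_False)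
  qed
  have "Poly_Mapping.lookup (hom_mult f g) (hmon_of n J t)
      = (\<Sum>(x, y)\<in>?K. if hmon_mult x y = hmon_of n J t then ?T (x, y) else 0)"
    unfolding hom_mult_def lookup_sum lookup_single when_def sum.cartesian_product
    by (intro sum.cong refl) (simp add: lookup_single when_def case_prod_unfold)
  also have "\<dots> = (\<Sum>xy\<in>?h ` ?P. ?T xy)"
  proof (rule sum.mono_neutral_cong)
    show "finite (?h ` ?P)" using fJ by simp
    show "(case xy of (x, y) \<Rightarrow> if hmon_mult x y = hmon_of n J t then ?T (x, y) else 0) = 0"
      if "xy \<in> ?K - ?h ` ?P" for xy
    proof -
      obtain x y where xy: "xy = (x, y)" by fastforce
      then have "length x = n" "length y = n" using that f g by (auto simp: in_homology)
      moreover have "(x, y) \<notin> ?h ` ?P" using that xy by blast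
      ultimately have "hmon_mult x y \<noteq> hmon_of n J t \<or> hmon_coeff x y = (0::'k)" using in_h by blast
      then show ?thesis unfolding xy by auto
    qed
    show "?T xy = 0" if "xy \<in> ?h ` ?P - ?K" for xy
      using that by (cases xy) (auto simp: in_keys_iff)
    show "(case xy of (x, y) \<Rightarrow> if hmon_mult x y = hmon_of n J t then ?T (x, y) else 0) = ?T xy"
      if "xy \<in> ?K \<inter> ?h ` ?P" for xy
    proof -
      have "xy \<in> ?h ` ?P" using that by (rule IntD2)
      then obtain p where p: "xy = ?h p" "p \<in> ?P" by (rule imageE)
      obtain I a where "p = (I, a)" by fastforce
      then show ?thesis using p coeff[of I a] by simp
    qed
  qed simp
  also have "\<dots> = (\<Sum>p\<in>?P. ?T (?h p))" by (rule sum.reindex_cong[OF inj]) auto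
  also have "\<dots> = (\<Sum>(I, a)\<in>?P.
        Poly_Mapping.lookup f (hmon_of n I a) * Poly_Mapping.lookup g (hmon_of n (J - I) (map2 (-) t a)) *
        ((-1) ^ card {(i, j). j < i \<and> i \<in> I \<and> j \<in> J - I} * of_nat (\<Prod>i<n. (t ! i) choose (a ! i))))"
  proof (rule sum.cong[OF refl])
    fix p assume p: "p \<in> ?P"
    obtain I a where Ia: "p = (I, a)" by fastforce
    show "?T (?h p) = (case p of (I, a) \<Rightarrow>
        Poly_Mapping.lookup f (hmon_of n I a) * Poly_Mapping.lookup g (hmon_of n (J - I) (map2 (-) t a)) *
        ((-1) ^ card {(i, j). j < i \<and> i \<in> I \<and> j \<in> J - I} * of_nat (\<Prod>i<n. (t ! i) choose (a ! i))))"
      using coeff[of I a] p unfolding Ia by simp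
  qed
  finally show ?thesis by (simp add: sum.cartesian_product)
qed

lemma lookup_hom_one:
  assumes "J \<subseteq> {..<n}" "length t = n"
  shows "Poly_Mapping.lookup (hom_one n :: 'k::field hom_elt) (hmon_of n J t) = ext_basis {} J * of_bool (t = replicate n 0)"
proof -
  have "replicate n (False, 0) = hmon_of n {} (replicate n 0)" by (rule nth_equalityI) auto
  moreover have "hmon_of n {} (replicate n 0) = hmon_of n J t \<longleftrightarrow> J = {} \<and> t = replicate n 0"
    using assms by (subst hmon_of_eq_iff) auto
  ultimately show ?thesis
    by (auto simp: hom_one_def lookup_single when_def ext_basis_def)
qed

lemma lookup_u_lin:
  fixes c :: "nat \<Rightarrow> 'k::field"
  assumes "J \<subseteq> {..<n}" "length t = n"
  shows "Poly_Mapping.lookup (u_lin n c) (hmon_of n J t)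
    = (\<Sum>j<n. c j * ext_basis {j} J) * of_bool (t = replicate n 0)"
proof -
  have "(replicate n (False, 0))[j := (True, 0)] = hmon_of n {j} (replicate n 0)" if "j < n" for j
    using that by (intro nth_equalityI) (auto simp: nth_list_update split: if_splits)
  moreover have "hmon_of n {j} (replicate n 0) = hmon_of n J t \<longleftrightarrow> J = {j} \<and> t = replicate n 0" if "j < n" for j
    using assms that by (subst hmon_of_eq_iff) auto
  ultimately have "Poly_Mapping.lookup (Poly_Mapping.single ((replicate n (False, 0))[j := (True, 0)]) (c j)) (hmon_of n J t)
      = c j * ext_basis {j} J * of_bool (t = replicate n 0)" if "j < n" for j
    using that by (simp add: lookup_single when_def ext_basis_def)
  then show ?thesis
    unfolding u_lin_def lookup_sum sum_distrib_right by (intro sum.cong) auto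
qed

lemma lookup_v_lin_divpow:
  fixes c :: "nat \<Rightarrow> 'k::field"
  assumes "J \<subseteq> {..<n}" "length t = n"
  shows "Poly_Mapping.lookup (v_lin_divpow n c k) (hmon_of n J t) = ext_basis {} J * (if sum_list t = k then mono_val n c t else 0)"
proof -
  have "map (Pair False) a = hmon_of n {} a" if "length a = n" for a
    by (rule nth_equalityI) (auto simp: that)
  moreover have "hmon_of n {} a = hmon_of n J t \<longleftrightarrow> J = {} \<and> t = a" if "length a = n" for a
    using assms that by (subst hmon_of_eq_iff) auto
  ultimately have "Poly_Mapping.lookup (v_lin_divpow n c k) (hmon_of n J t)
     = (\<Sum>a\<in>expos n k. if J = {} \<and> a = t then mono_val n c a else 0)"
    by (auto simp: v_lin_divpow_def lookup_sum lookup_single when_def mono_val_def expos_def intro!: sum.cong)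
  also have "\<dots> = (if J = {} \<and> t \<in> expos n k then mono_val n c t else 0)"
    by (cases "J = {}") simp_all
  finally show ?thesis using assms by (auto simp: ext_basis_def expos_def)
qed

lemma u_lin_closed: "u_lin n c \<in> carrier (homology n)"
  unfolding u_lin_def by (intro hom_sum_closed hom_single_closed) simp

lemma v_lin_divpow_closed: "v_lin_divpow n c k \<in> carrier (homology n)"
  unfolding v_lin_divpow_def by (intro hom_sum_closed hom_single_closed) simp

text \<open>The second factor contains no u and the first no v, so only \<open>I = J\<close> with
  exponents zero survives in the product formula.\<close>

lemma lookup_factor:
  fixes c :: "nat \<Rightarrow> 'k::field"
  assumes "J \<subseteq> {..<n}" "length t = n"
  shows "Poly_Mapping.lookup (hom_mult (if e then u_lin n c else hom_one n) (v_lin_divpow n c k)) (hmon_of n J t)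
     = (if e then \<Sum>j<n. c j * ext_basis {j} J else ext_basis {} J) * (if sum_list t = k then mono_val n c t else 0)"
proof -
  let ?f = "if e then u_lin n c else hom_one n" and ?z = "replicate n (0::nat)"
  let ?E = "\<lambda>J. if e then \<Sum>j<n. c j * ext_basis {j} J else (ext_basis {} J :: 'k)"
  have fJ: "finite J" using assms finite_subset by blast
  have f: "?f \<in> carrier (homology n)" by (simp add: u_lin_closed hom_one_closed)
  have z: "list_all2 (\<le>) ?z t" using assms by (simp add: list_all2_conv_all_nth)
  have len: "length a = n" if "list_all2 (\<le>) a t" for a using that assms by (auto dest: list_all2_lengthD)
  have "Poly_Mapping.lookup (hom_mult ?f (v_lin_divpow n c k)) (hmon_of n J t) =
     (\<Sum>I\<in>Pow J. \<Sum>a | list_all2 (\<le>) a t. (?E I * of_bool (a = ?z)) *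
        (ext_basis {} (J - I) * (if sum_list (map2 (-) t a) = k then mono_val n c (map2 (-) t a) else 0)) *
        ((-1) ^ card {(i, j). j < i \<and> i \<in> I \<and> j \<in> J - I} * of_nat (\<Prod>i<n. (t ! i) choose (a ! i))))"
    unfolding lookup_hom_mult[OF f v_lin_divpow_closed assms]
  proof (intro sum.cong refl, goal_cases)
    case (1 I a)
    then have *: "I \<subseteq> {..<n}" "J - I \<subseteq> {..<n}" "length a = n" "length (map2 (-) t a) = n"
      using assms len[of a] by auto
    show ?case
      unfolding lookup_v_lin_divpow[OF *(2,4)] using lookup_u_lin[OF *(1,3), of c] lookup_hom_one[OF *(1,3), where 'k='k]
      by (cases e) simp_all
  qed
  also have "\<dots> = (\<Sum>I\<in>{J}. \<Sum>a\<in>{?z}. (?E I * of_bool (a = ?z)) *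
        (ext_basis {} (J - I) * (if sum_list (map2 (-) t a) = k then mono_val n c (map2 (-) t a) else 0)) *
        ((-1) ^ card {(i, j). j < i \<and> i \<in> I \<and> j \<in> J - I} * of_nat (\<Prod>i<n. (t ! i) choose (a ! i))))"
    using z fJ by (intro sum.mono_neutral_cong_right ballI sum.neutral) (auto simp: ext_basis_def)
  also have "map2 (-) t ?z = t" using assms by (intro nth_equalityI) auto
  then have "(\<Sum>I\<in>{J}. \<Sum>a\<in>{?z}. (?E I * of_bool (a = ?z)) *
        (ext_basis {} (J - I) * (if sum_list (map2 (-) t a) = k then mono_val n c (map2 (-) t a) else 0)) *
        ((-1) ^ card {(i, j). j < i \<and> i \<in> I \<and> j \<in> J - I} * of_nat (\<Prod>i<n. (t ! i) choose (a ! i))))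
     = ?E J * (if sum_list t = k then mono_val n c t else 0)"
    by (simp add: ext_basis_def)
  finally show ?thesis .
qed

text \<open>The coefficient splits into an exterior and a divided power part because the divided
  powers commute with everything without a sign.\<close>

lemma lookup_foldr_hom_mult:
  fixes l :: "(bool \<times> (nat \<Rightarrow> 'k::field) \<times> nat) list"
  assumes "J \<subseteq> {..<n}" "length t = n"
  shows "Poly_Mapping.lookup (foldr hom_mult (map (\<lambda>(e, c, k).
             hom_mult (if e then u_lin n c else hom_one n) (v_lin_divpow n c k)) l) (hom_one n)) (hmon_of n J t)
    = sel_wedges (map (\<lambda>(e, c, k). (e, c)) l) J * div_coeff n (map (\<lambda>(e, c, k). c) l) (map (\<lambda>(e, c, k). k) l) t"
  using assms
proof (induction l arbitrary: J t)
  case Nil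
  then show ?case by (simp add: lookup_hom_one)
next
  case (Cons ec l)
  obtain e c k where ec: "ec = (e, c, k)" by (cases ec) auto
  let ?P = "foldr hom_mult (map (\<lambda>(e, c, k). hom_mult (if e then u_lin n c else hom_one n) (v_lin_divpow n c k)) l) (hom_one n)"
  let ?F = "hom_mult (if e then u_lin n c else hom_one n) (v_lin_divpow n c k)"
  let ?S = "sel_wedges (map (\<lambda>(e, c, k). (e, c)) l)"
  let ?D = "div_coeff n (map (\<lambda>(e, c, k). c) l) (map (\<lambda>(e, c, k). k) l)"
  let ?E = "\<lambda>J. if e then \<Sum>j<n. c j * ext_basis {j} J else (ext_basis {} J :: 'k)"
  have fJ: "finite J" using Cons finite_subset by blast
  have F: "?F \<in> carrier (homology n)"
    by (simp add: hom_mult_closed u_lin_closed v_lin_divpow_closed hom_one_closed)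
  have P: "?P \<in> carrier (homology n)"
    by (rule foldr_closed) (auto simp: hom_mult_closed u_lin_closed v_lin_divpow_closed hom_one_closed)
  have "Poly_Mapping.lookup (hom_mult ?F ?P) (hmon_of n J t) =
     (\<Sum>I\<in>Pow J. \<Sum>a | list_all2 (\<le>) a t.
        ?E I * (if sum_list a = k then mono_val n c a else 0) * (?S (J - I) * ?D (map2 (-) t a)) *
        ((-1) ^ card {(i, j). j < i \<and> i \<in> I \<and> j \<in> J - I} * of_nat (\<Prod>i<n. (t ! i) choose (a ! i))))"
    unfolding lookup_hom_mult[OF F P Cons.prems]
  proof (intro sum.cong refl, goal_cases)
    case (1 I a)
    then have *: "I \<subseteq> {..<n}" "J - I \<subseteq> {..<n}" "length a = n" "length (map2 (-) t a) = n"
      using Cons.prems by (auto dest: list_all2_lengthD)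
    show ?case unfolding Cons.IH[OF *(2,4)] lookup_factor[OF *(1,3)] ..
  qed
  also have "\<dots> = (\<Sum>I\<in>Pow J. ?E I * (-1) ^ card {(i, j). j < i \<and> i \<in> I \<and> j \<in> J - I} * ?S (J - I)) *
     (\<Sum>a | list_all2 (\<le>) a t. (if sum_list a = k then mono_val n c a else 0) * of_nat (\<Prod>i<n. (t ! i) choose (a ! i)) * ?D (map2 (-) t a))"
    unfolding sum_product by (intro sum.cong refl) (simp only: mult_ac)
  also have "(\<Sum>a | list_all2 (\<le>) a t. (if sum_list a = k then mono_val n c a else 0) * of_nat (\<Prod>i<n. (t ! i) choose (a ! i)) * ?D (map2 (-) t a))
     = div_coeff n (map (\<lambda>(e, c, k). c) (ec # l)) (map (\<lambda>(e, c, k). k) (ec # l)) t"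
    unfolding ec list.map prod.case div_coeff.simps
    by (rule sum.mono_neutral_cong_right) (auto split: if_splits)
  also have "(\<Sum>I\<in>Pow J. ?E I * (-1) ^ card {(i, j). j < i \<and> i \<in> I \<and> j \<in> J - I} * ?S (J - I))
     = sel_wedges (map (\<lambda>(e, c, k). (e, c)) (ec # l)) J"
  proof (cases e)
    case False
    then show ?thesis using fJ by (simp add: ec ext_basis_empty_sum mult.assoc)
  next
    case True
    have card: "card {(i, j'). j' < i \<and> i \<in> {j} \<and> j' \<in> J - {j}} = card {l\<in>J. l < j}" for j
    proof -
      have "{(i, j'). j' < i \<and> i \<in> {j} \<and> j' \<in> J - {j}} = Pair j ` {l\<in>J. l < j}" by auto
      then show ?thesis by (simp add: card_image inj_on_def)
    qed
    have "(\<Sum>I\<in>Pow J. ?E I * (-1) ^ card {(i, j). j < i \<and> i \<in> I \<and> j \<in> J - I} * ?S (J - I))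
      = (\<Sum>j<n. c j * (\<Sum>I\<in>Pow J. ext_basis {j} I * ((-1) ^ card {(i, j). j < i \<and> i \<in> I \<and> j \<in> J - I} * ?S (J - I))))"
      using True by (simp add: sum_distrib_right sum_distrib_left mult.assoc) (rule sum.swap)
    also have "\<dots> = (\<Sum>j<n. if j \<in> J then c j * (-1) ^ card {l\<in>J. l < j} * ?S (J - {j}) else 0)"
      unfolding ext_basis_empty_sum[OF finite_Pow_iff[THEN iffD2, OF fJ]]
    proof (intro sum.cong refl, goal_cases)
      case (1 j)
      show ?case unfolding card by (simp add: mult.assoc)
    qed
    also have "\<dots> = (\<Sum>j\<in>J. c j * (-1) ^ card {l\<in>J. l < j} * ?S (J - {j}))"
      using Cons.prems by (intro sum.mono_neutral_cong_right) auto
    finally show ?thesis using True by (simp add: ec wedge_def)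
  qed
  finally show ?case by (simp add: ec)
qed

definition mat_fun :: "'k mat \<Rightarrow> nat \<Rightarrow> nat \<Rightarrow> 'k" where
  "mat_fun g j s = g $$ (j, s)"

abbreviation mat_cols :: "(nat \<Rightarrow> nat \<Rightarrow> 'r) \<Rightarrow> nat \<Rightarrow> (nat \<Rightarrow> 'r) list" where
  "mat_cols G n \<equiv> map (\<lambda>s j. G j s) [0..<n]"

lemma lookup_GL_act_mon:
  fixes g :: "'k::field mat"
  assumes "I \<subseteq> {..<n}" "length s = n" "J \<subseteq> {..<n}" "length t = n"
  shows "Poly_Mapping.lookup (GL_act_mon n g (hmon_of n I s)) (hmon_of n J t)
    = ext_cols (mat_fun g) n I J * div_coeff n (mat_cols (mat_fun g) n) s t"
proof -
  let ?l = "map (\<lambda>i. (i \<in> I, \<lambda>j. mat_fun g j i, s ! i)) [0..<n]"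
  have "GL_act_mon n g (hmon_of n I s) = foldr hom_mult (map (\<lambda>(e, c, k).
             hom_mult (if e then u_lin n c else hom_one n) (v_lin_divpow n c k)) ?l) (hom_one n)"
    unfolding GL_act_mon_def map_map
    by (intro arg_cong[where f = "\<lambda>l. foldr hom_mult l (hom_one n)"] map_cong refl) (auto simp: mat_fun_def)
  moreover have "map (\<lambda>(e, c, k). k) ?l = s" using assms(2) by (intro nth_equalityI) auto
  moreover have "map (\<lambda>(e, c, k). c) ?l = mat_cols (mat_fun g) n" unfolding map_map by (simp add: comp_def)
  moreover have "sel_wedges (map (\<lambda>(e, c, k). (e, c)) ?l) = ext_cols (mat_fun g) n I"
    unfolding ext_cols_def by (simp add: comp_def)
  ultimately show ?thesis using lookup_foldr_hom_mult[OF assms(3,4), of ?l] by (simp only:)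
qed

lemma GL_act_mon_closed: "GL_act_mon n g x \<in> carrier (homology n)"
  unfolding GL_act_mon_def
  by (rule foldr_closed) (auto intro!: hom_mult_closed simp: hom_one_closed u_lin_closed v_lin_divpow_closed)

section \<open>Polynomial functions\<close>

text \<open>Over a finite field distinct polynomials can define the same function. Points are
  therefore taken with coordinates in the infinite domain \<open>'k poly\<close>, which also leaves
  room for the substitution \<open>kron\<close>.\<close>

lemma infinite_UNIV_poly: "infinite (UNIV :: 'k::field poly set)"
proof -
  have "inj (monom (1::'k))" by (rule injI) (metis degree_monom_eq one_neq_zero[where 'a='k])
  then have "infinite (range (monom (1::'k)))" by (simp add: finite_image_iff)
  then show ?thesis by (rule infinite_super[OF subset_UNIV])
qed

lemma poly_eqI_infinite:
  fixes P Q :: "'r::idom poly"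
  assumes "infinite (UNIV :: 'r set)" "\<And>z. poly P z = poly Q z"
  shows "P = Q"
proof (rule ccontr)
  assume "P \<noteq> Q"
  then have "finite {z. poly (P - Q) z = 0}" by (intro poly_roots_finite) simp
  moreover have "{z. poly (P - Q) z = 0} = UNIV" using assms(2) by auto
  ultimately show False using assms(1) by simp
qed

text \<open>Induction on the variables: with the other coordinates fixed, the sum is a polynomial in
  the first one that vanishes on an infinite domain, so each of its coefficients vanishes.\<close>

lemma poly_fun_zero:
  fixes c :: "nat list \<Rightarrow> 'r::idom"
  assumes inf: "infinite (UNIV :: 'r set)" and "finite A" and len: "\<And>t. t \<in> A \<Longrightarrow> length t = n"
    and z: "\<And>X. (\<Sum>t\<in>A. mono_val n X t * c t) = 0" and "t \<in> A"
  shows "c t = 0"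
  using assms(2-)
proof (induction n arbitrary: A c t)
  case 0
  then have "A = {[]}" by auto
  then show ?case using 0 by (auto simp: mono_val_def)
next
  case (Suc n)
  obtain k s where t: "t = k # s" using Suc.prems(2)[OF Suc.prems(4)] by (cases t) auto
  let ?A = "{s. k # s \<in> A}"
  have fin: "finite ?A" using finite_vimageI[OF Suc.prems(1), of "(#) k"] by (simp add: vimage_def)
  have mv: "mono_val (Suc n) X t = X 0 ^ hd t * mono_val n (\<lambda>i. X (Suc i)) (tl t)" if "t \<in> A" for t X
    using Suc.prems(2)[OF that] by (cases t) (auto simp: mono_val_def prod.lessThan_Suc_shift simp del: prod.lessThan_Suc)
  have "(\<Sum>s\<in>?A. mono_val n X s * c (k # s)) = 0" for X
  proof -
    let ?P = "\<Sum>t\<in>A. monom (mono_val n X (tl t) * c t) (hd t)"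
    have "?P = 0"
    proof (rule poly_eqI_infinite[OF inf])
      fix z
      have "poly ?P z = (\<Sum>t\<in>A. mono_val (Suc n) (case_nat z X) t * c t)"
        unfolding poly_sum by (intro sum.cong refl) (simp add: mv poly_monom mult_ac)
      then show "poly ?P z = poly 0 z" using Suc.prems(3) by simp
    qed
    then have "coeff ?P k = 0" by simp
    then have "(\<Sum>t\<in>A. if hd t = k then mono_val n X (tl t) * c t else 0) = 0" by (simp add: coeff_sum)
    also have "(\<Sum>t\<in>A. if hd t = k then mono_val n X (tl t) * c t else 0)
        = (\<Sum>t\<in>(#) k ` ?A. mono_val n X (tl t) * c t)"
    proof (rule sum.mono_neutral_cong_right)
      show "\<forall>t\<in>A - (#) k ` ?A. (if hd t = k then mono_val n X (tl t) * c t else 0) = 0"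
      proof
        fix t assume t: "t \<in> A - (#) k ` ?A"
        then obtain k' s' where "t = k' # s'" using Suc.prems(2)[of t] by (cases t) auto
        then show "(if hd t = k then mono_val n X (tl t) * c t else 0) = 0" using t by auto
      qed
    qed (use Suc.prems in auto)
    also have "\<dots> = (\<Sum>s\<in>?A. mono_val n X s * c (k # s))" by (simp add: sum.reindex)
    finally show ?thesis .
  qed
  from Suc.IH[OF fin _ this, of s] show ?case using Suc.prems t by fastforce
qed

text \<open>A homogeneous polynomial with coefficients in \<open>'k\<close>, viewed as a function on
  points over \<open>'k poly\<close>; by \<open>hev_unique\<close> the function determines the
  coefficients.\<close>

definition hev :: "nat \<Rightarrow> nat \<Rightarrow> (nat list \<Rightarrow> 'k::field) \<Rightarrow> (nat \<Rightarrow> 'k poly) \<Rightarrow> 'k poly" where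
  "hev n d c X = (\<Sum>t\<in>expos n d. [:c t:] * mono_val n X t)"

definition hpoly :: "nat \<Rightarrow> nat \<Rightarrow> ((nat \<Rightarrow> 'k::field poly) \<Rightarrow> 'k poly) \<Rightarrow> bool" where
  "hpoly n d f \<longleftrightarrow> (\<exists>c. \<forall>X. f X = hev n d c X)"

lemma hev_unique:
  assumes "\<And>X. hev n d c X = hev n d c' X" "t \<in> expos n d"
  shows "c t = c' t"
proof -
  have "(\<Sum>t\<in>expos n d. mono_val n X t * ([:c t:] - [:c' t:])) = 0" for X
    using assms(1)[of X] by (simp add: hev_def smult_diff_left sum_subtractf)
  from poly_fun_zero[OF infinite_UNIV_poly finite_expos _ this assms(2)]
  show ?thesis by (simp add: expos_def)
qed

text \<open>Collects equal monomials, so that sums and products below only have to exhibit their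
  monomials with repetitions.\<close>

lemma hpoly_general:
  assumes "finite A" "\<And>x. x \<in> A \<Longrightarrow> \<tau> x \<in> expos n d"
  shows "hpoly n d (\<lambda>X. \<Sum>x\<in>A. [:c x:] * mono_val n X (\<tau> x))"
proof -
  have "(\<Sum>x\<in>A. [:c x:] * mono_val n X (\<tau> x)) = hev n d (\<lambda>t. \<Sum>x\<in>{x\<in>A. \<tau> x = t}. c x) X" for X
  proof -
    have "(\<Sum>x\<in>A. [:c x:] * mono_val n X (\<tau> x)) = (\<Sum>t\<in>expos n d. \<Sum>x\<in>{x\<in>A. \<tau> x = t}. [:c x:] * mono_val n X (\<tau> x))"
      by (rule sum.group[symmetric]) (use assms in auto)
    also have "\<dots> = (\<Sum>t\<in>expos n d. [:\<Sum>x\<in>{x\<in>A. \<tau> x = t}. c x:] * mono_val n X t)"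
      by (intro sum.cong refl) (auto simp: coeff_lift_hom.hom_sum sum_distrib_right intro!: sum.cong)
    finally show ?thesis by (simp add: hev_def)
  qed
  then show ?thesis unfolding hpoly_def by blast
qed

section \<open>Closure properties of homogeneous polynomial functions\<close>

lemma hpoly_hev: "hpoly n d (hev n d c)"
  unfolding hpoly_def by blast

lemma expos_n_0: "expos n 0 = {replicate n 0}"
  using replicate_iff_sum_list by (fastforce simp: expos_def)

lemma hpoly_const: "hpoly n 0 (\<lambda>X. [:c:])"
  unfolding hpoly_def by (rule exI[of _ "\<lambda>_. c"]) (simp add: hev_def expos_n_0 mono_val_def)

lemma hpoly_1: "hpoly n 0 (\<lambda>X. 1)"
  using hpoly_const[of n 1] by simp

lemma mono_val_unit:
  assumes "i < n" shows "mono_val n X ((replicate n 0)[i := 1]) = X i" "(replicate n 0)[i := 1] \<in> expos n 1"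
proof -
  have "(\<Prod>j<n. X j ^ ((replicate n 0)[i := 1] ! j)) = (\<Prod>j<n. if j = i then X i else 1)"
    by (rule prod.cong) (auto simp: nth_list_update)
  then show "mono_val n X ((replicate n 0)[i := 1]) = X i" using assms by (simp add: mono_val_def)
  show "(replicate n 0)[i := 1] \<in> expos n 1" using assms by (simp add: expos_def sum_list_update)
qed

lemma hpoly_var:
  assumes "i < n" shows "hpoly n 1 (\<lambda>X. X i)"
proof -
  have "hpoly n 1 (\<lambda>X. \<Sum>x\<in>{()}. [:1:] * mono_val n X ((replicate n 0)[i := 1]))"
    by (rule hpoly_general) (use mono_val_unit(2)[OF assms] in simp_all)
  then show ?thesis by (simp add: mono_val_unit(1)[OF assms] one_pCons[symmetric] del: One_nat_def)
qed

lemma mono_val_add: "length s = n \<Longrightarrow> length t = n \<Longrightarrow> mono_val n X (map2 (+) s t) = mono_val n X s * mono_val n X t"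
  unfolding mono_val_def prod.distrib[symmetric] by (intro prod.cong) (simp_all add: power_add)

lemma expos_add: "s \<in> expos n d \<Longrightarrow> t \<in> expos n e \<Longrightarrow> map2 (+) s t \<in> expos n (d + e)"
  by (auto simp: expos_def sum_list_sum_nth sum.distrib)

lemma hpoly_sum:
  assumes "finite A" "\<And>a. a \<in> A \<Longrightarrow> hpoly n d (f a)"
  shows "hpoly n d (\<lambda>X. \<Sum>a\<in>A. f a X)"
proof -
  obtain c where c: "\<And>a X. a \<in> A \<Longrightarrow> f a X = hev n d (c a) X"
    using assms(2) unfolding hpoly_def by metis
  have "(\<lambda>X. \<Sum>a\<in>A. f a X) = (\<lambda>X. \<Sum>(a, t)\<in>A \<times> expos n d. [:c a t:] * mono_val n X t)"
    by (rule ext) (auto simp: c hev_def sum.cartesian_product intro!: sum.cong)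
  moreover have "hpoly n d (\<lambda>X. \<Sum>x\<in>A \<times> expos n d. [:c (fst x) (snd x):] * mono_val n X (snd x))"
    using assms by (intro hpoly_general) auto
  ultimately show ?thesis by (simp add: case_prod_unfold)
qed

lemma hpoly_mult:
  assumes "hpoly n d f" "hpoly n e g"
  shows "hpoly n (d + e) (\<lambda>X. f X * g X)"
proof -
  obtain b c where bc: "\<And>X. f X = hev n d b X" "\<And>X. g X = hev n e c X"
    using assms unfolding hpoly_def by metis
  have "f X * g X = (\<Sum>(s, t)\<in>expos n d \<times> expos n e. [:b s * c t:] * mono_val n X (map2 (+) s t))" for X
    unfolding bc hev_def sum_product sum.cartesian_product
  proof (intro sum.cong refl, clarify)
    fix s t assume "s \<in> expos n d" "t \<in> expos n e"
    then have "mono_val n X (map2 (+) s t) = mono_val n X s * mono_val n X t"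
      by (intro mono_val_add) (simp_all add: expos_def)
    moreover have "[:b s * c t:] = [:b s:] * [:c t:]" by simp
    ultimately show "[:b s:] * mono_val n X s * ([:c t:] * mono_val n X t) = [:b s * c t:] * mono_val n X (map2 (+) s t)"
      by (simp only: mult_ac)
  qed
  moreover have "hpoly n (d + e) (\<lambda>X. \<Sum>x\<in>expos n d \<times> expos n e. [:b (fst x) * c (snd x):] * mono_val n X (map2 (+) (fst x) (snd x)))"
    by (intro hpoly_general) (auto intro: expos_add)
  ultimately show ?thesis by (simp add: case_prod_unfold)
qed

lemma hpoly_scale: "hpoly n d f \<Longrightarrow> hpoly n d (\<lambda>X. [:c:] * f X)"
  using hpoly_mult[OF hpoly_const, of n d f c] by simp

lemma hpoly_sign: "hpoly n d f \<Longrightarrow> hpoly n d (\<lambda>X. (-1) ^ k * f X)"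
  using hpoly_scale[of n d f "(-1) ^ k"] by (simp add: coeff_lift_hom.hom_power coeff_lift_hom.hom_uminus one_pCons[symmetric])

lemma hpoly_power:
  assumes "hpoly n d f" shows "hpoly n (k * d) (\<lambda>X. f X ^ k)"
proof (induction k)
  case 0 then show ?case by (simp add: hpoly_1)
next
  case (Suc k)
  from hpoly_mult[OF assms Suc] show ?case by simp
qed

lemma hpoly_prod:
  assumes "finite A" "\<And>a. a \<in> A \<Longrightarrow> hpoly n (d a) (f a)"
  shows "hpoly n (\<Sum>a\<in>A. d a) (\<lambda>X. \<Prod>a\<in>A. f a X)"
  using assms
proof (induction A rule: finite_induct)
  case empty then show ?case by (simp add: hpoly_1)
next
  case (insert a A)
  from hpoly_mult[of n "d a" "f a" "\<Sum>a\<in>A. d a" "\<lambda>X. \<Prod>a\<in>A. f a X"] insert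
  show ?case by simp
qed

section \<open>Leading exponents\<close>

text \<open>
  Substituting \<open>z^(B^i)\<close> for the \<open>i\<close>th variable turns the lexicographic order of the exponents
  (last variable first) into the order of the degrees.
\<close>

definition kron :: "nat \<Rightarrow> nat \<Rightarrow> 'k::field poly" where
  "kron B i = monom 1 (B ^ i)"

definition enc :: "nat \<Rightarrow> nat \<Rightarrow> (nat \<Rightarrow> nat) \<Rightarrow> nat" where
  "enc B n t = (\<Sum>i<n. t i * B ^ i)"

definition lexless :: "nat \<Rightarrow> (nat \<Rightarrow> nat) \<Rightarrow> (nat \<Rightarrow> nat) \<Rightarrow> bool" where
  "lexless n s t \<longleftrightarrow> (\<exists>r<n. s r < t r \<and> (\<forall>i. r < i \<and> i < n \<longrightarrow> s i = t i))"

text \<open>All large \<open>B\<close> are demanded so that two functions can be compared at a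
  common base, and so that the first \<open>n\<close> entries of \<open>T\<close> are
  unique.\<close>

definition lead :: "nat \<Rightarrow> ((nat \<Rightarrow> 'k::field poly) \<Rightarrow> 'k poly) \<Rightarrow> (nat \<Rightarrow> nat) \<Rightarrow> bool" where
  "lead n f T \<longleftrightarrow> (\<exists>B0. \<forall>B\<ge>B0. f (kron B) \<noteq> 0 \<and> degree (f (kron B)) = enc B n T)"

lemma enc_less_power: "(\<And>i. i < r \<Longrightarrow> s i < B) \<Longrightarrow> enc B r s < B ^ r"
proof (induction r)
  case (Suc r)
  have "enc B r s < B ^ r" using Suc by simp
  moreover have "Suc (s r) * B ^ r \<le> B * B ^ r" using Suc.prems[of r] by (intro mult_right_mono) auto
  ultimately show ?case by (simp add: enc_def)
qed (simp add: enc_def)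

text \<open>Only the smaller vector needs digits below \<open>B\<close>: the entries of
  \<open>t\<close> below the deciding position can only enlarge its code.\<close>

lemma enc_lexless:
  assumes "lexless n s t" "\<And>i. i < n \<Longrightarrow> s i < B"
  shows "enc B n s < enc B n t"
proof -
  obtain r where r: "r < n" "s r < t r" "\<And>i. r < i \<Longrightarrow> i < n \<Longrightarrow> s i = t i"
    using assms(1) by (auto simp: lexless_def)
  have split: "{..<n} = {..<r} \<union> {r} \<union> {r<..<n}" using r by auto
  have e: "enc B n u = enc B r u + u r * B ^ r + (\<Sum>i\<in>{r<..<n}. u i * B ^ i)" for u
    unfolding enc_def split by (subst sum.union_disjoint, auto)+
  have "enc B r s < B ^ r" by (rule enc_less_power) (use assms r in auto)
  then have "enc B r s + s r * B ^ r < Suc (s r) * B ^ r" by simp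
  also have "\<dots> \<le> t r * B ^ r" using r by (intro mult_right_mono) auto
  also have "\<dots> \<le> enc B r t + t r * B ^ r" by simp
  finally show ?thesis unfolding e using r by simp
qed

lemma last_difference:
  fixes n :: nat
  assumes "i < n" "P i"
  obtains r where "r < n" "P r" "\<And>j. r < j \<Longrightarrow> j < n \<Longrightarrow> \<not> P j"
proof -
  let ?A = "{i. i < n \<and> P i}"
  have f: "finite ?A" by simp
  have "Max ?A \<in> ?A" using assms f by (intro Max_in) auto
  moreover have "\<not> P j" if "Max ?A < j" "j < n" for j
  proof
    assume "P j"
    then have "j \<le> Max ?A" using that by (intro Max_ge[OF f]) simp
    then show False using that by linarith
  qed
  ultimately show ?thesis using that by blast
qed

lemma lexless_cases:
  obtains "\<And>i. i < n \<Longrightarrow> s i = t i" | "lexless n s t" | "lexless n t s"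
proof (cases "\<exists>i<n. s i \<noteq> t i")
  case True
  then obtain i where "i < n" "s i \<noteq> t i" by blast
  then obtain r where "r < n" "s r \<noteq> t r" "\<And>j. r < j \<Longrightarrow> j < n \<Longrightarrow> \<not> s j \<noteq> t j"
    using last_difference[of i n "\<lambda>i. s i \<noteq> t i"] by metis
  then have "lexless n s t \<or> lexless n t s" unfolding lexless_def by (metis linorder_neqE_nat)
  then show ?thesis using that by blast
qed (use that in blast)

lemma degree_sum_unique_max:
  fixes g :: "'a \<Rightarrow> 'r::comm_ring_1 poly"
  assumes "finite A" "a \<in> A" "g a \<noteq> 0" "\<And>x. x \<in> A \<Longrightarrow> x \<noteq> a \<Longrightarrow> g x = 0 \<or> degree (g x) < degree (g a)"
  shows "(\<Sum>x\<in>A. g x) \<noteq> 0 \<and> degree (\<Sum>x\<in>A. g x) = degree (g a)"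
proof -
  have "coeff (g x) (degree (g a)) = 0" if "x \<in> A - {a}" for x
    using assms(4)[of x] that by (auto simp: coeff_eq_0)
  then have 1: "coeff (\<Sum>x\<in>A. g x) (degree (g a)) = lead_coeff (g a)"
    using assms(1,2) by (simp add: coeff_sum sum.remove)
  have "degree (\<Sum>x\<in>A. g x) \<le> degree (g a)"
  proof (rule degree_sum_le[OF assms(1)])
    fix x assume "x \<in> A"
    then show "degree (g x) \<le> degree (g a)" using assms(4)[of x] by (cases "x = a") auto
  qed
  moreover have "degree (g a) \<le> degree (\<Sum>x\<in>A. g x)" using 1 assms(3) by (intro le_degree) simp
  moreover have "(\<Sum>x\<in>A. g x) \<noteq> 0"
  proof
    assume "(\<Sum>x\<in>A. g x) = 0"
    then have "lead_coeff (g a) = 0" using 1 by (simp only: coeff_0)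
    then show False using assms(3) by simp
  qed
  ultimately show ?thesis by (simp only: not_False_eq_True simp_thms order_antisym)
qed

lemma mono_val_kron: "mono_val n (kron B) t = monom 1 (enc B n ((!) t))"
proof -
  have "(\<Prod>i<n. monom 1 (B ^ i) ^ (t ! i)) = monom (1::'a) (\<Sum>i<n. t ! i * B ^ i)"
    by (induction n) (simp_all add: monom_power mult_monom mult.commute add.commute)
  then show ?thesis by (simp add: mono_val_def kron_def enc_def)
qed

lemma expos_nth_le: "t \<in> expos n d \<Longrightarrow> i < n \<Longrightarrow> t ! i \<le> d"
  by (auto simp: expos_def intro!: member_le_sum_list)

lemma lead_hev:
  assumes "t0 \<in> expos n d" "c t0 \<noteq> 0" "\<And>t. t \<in> expos n d \<Longrightarrow> c t \<noteq> 0 \<Longrightarrow> t \<noteq> t0 \<Longrightarrow> lexless n ((!) t) ((!) t0)"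
  shows "lead n (hev n d c) ((!) t0)"
  unfolding lead_def
\<comment> \<open>The exponents of a monomial of degree \<open>d\<close> are at most
  \<open>d\<close>, hence digits in this base.\<close>
proof (intro exI[of _ "Suc d"] allI impI)
  fix B assume B: "Suc d \<le> B"
  let ?g = "\<lambda>t. [:c t:] * mono_val n (kron B) t"
  have deg: "?g t \<noteq> 0 \<and> degree (?g t) = enc B n ((!) t)" if "c t \<noteq> 0" for t
    using that by (simp add: mono_val_kron smult_monom degree_monom_eq)
  have "(\<Sum>t\<in>expos n d. ?g t) \<noteq> 0 \<and> degree (\<Sum>t\<in>expos n d. ?g t) = degree (?g t0)"
  proof (rule degree_sum_unique_max)
    fix t assume t: "t \<in> expos n d" "t \<noteq> t0"
    show "?g t = 0 \<or> degree (?g t) < degree (?g t0)"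
    proof (cases "c t = 0")
      case False
      then have "enc B n ((!) t) < enc B n ((!) t0)"
        using assms(3)[OF t(1) False t(2)] expos_nth_le[OF t(1)] B by (intro enc_lexless) fastforce+
      then show ?thesis unfolding conjunct2[OF deg[OF False]] conjunct2[OF deg[OF assms(2)]] by (rule disjI2)
    qed simp
  qed (use assms deg[OF assms(2)] in simp_all)
  then show "hev n d c (kron B) \<noteq> 0 \<and> degree (hev n d c (kron B)) = enc B n ((!) t0)"
    unfolding hev_def conjunct2[OF deg[OF assms(2)]] .
qed

lemma lead_unique:
  assumes "lead n f S" "lead n f T" "i < n"
  shows "S i = T i"
proof -
  obtain B1 B2 where B: "\<And>B. B \<ge> B1 \<Longrightarrow> degree (f (kron B)) = enc B n S" "\<And>B. B \<ge> B2 \<Longrightarrow> degree (f (kron B)) = enc B n T"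
    using assms unfolding lead_def by metis
  define B where "B = B1 + B2 + (\<Sum>i<n. S i + T i) + 1"
  have eq: "enc B n S = enc B n T" using B(1)[of B] B(2)[of B] by (simp add: B_def)
  have lt: "S i < B" "T i < B" if "i < n" for i
    using member_le_sum[of i "{..<n}" "\<lambda>i. S i + T i"] that by (auto simp: B_def)
  show ?thesis
    by (rule lexless_cases[of n S T]) (use eq enc_lexless[of n S T B] enc_lexless[of n T S B] lt assms(3) in auto)
qed

text \<open>A converse of \<open>lead_hev\<close>: the monomial of maximal code dominates all
  others, so \<open>lead_hev\<close> applies to it, and its exponents agree with \<open>T\<close> by
  uniqueness.\<close>

lemma lead_coeffs:
  assumes "lead n (hev n d c) T"
  obtains t0 where "t0 \<in> expos n d" "c t0 \<noteq> 0" "\<And>i. i < n \<Longrightarrow> t0 ! i = T i"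
    "\<And>t. t \<in> expos n d \<Longrightarrow> c t \<noteq> 0 \<Longrightarrow> t \<noteq> t0 \<Longrightarrow> lexless n ((!) t) ((!) t0)"
proof -
  let ?A = "{t\<in>expos n d. c t \<noteq> 0}" and ?e = "\<lambda>t. enc (Suc d) n ((!) t)"
  have fin: "finite ?A" by simp
  obtain B where "hev n d c (kron B) \<noteq> 0" using assms unfolding lead_def by blast
  moreover have "hev n d c (kron B) = 0" if "?A = {}" using that by (auto simp: hev_def intro: sum.neutral)
  ultimately have "?A \<noteq> {}" by blast
  then have "Max (?e ` ?A) \<in> ?e ` ?A" using fin by (intro Max_in) simp_all
  then obtain t0 where t0: "Max (?e ` ?A) = ?e t0" "t0 \<in> ?A" by (rule imageE)
  then have "?e t \<le> ?e t0" if "t \<in> ?A" for t using fin that by (metis (lifting) Max_ge finite_imageI imageI)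
  note t0 = t0(2) this
  have less: "lexless n ((!) t) ((!) t0)" if t: "t \<in> expos n d" "c t \<noteq> 0" "t \<noteq> t0" for t
  proof (rule lexless_cases[of n "(!) t" "(!) t0"])
    assume "\<And>i. i < n \<Longrightarrow> t ! i = t0 ! i"
    then have "t = t0" using t(1) t0(1) by (intro nth_equalityI) (auto simp: expos_def)
    then show ?thesis using t by simp
  next
    assume "lexless n ((!) t0) ((!) t)"
    then have "?e t0 < ?e t" using t0(1) expos_nth_le[of t0 n d] by (intro enc_lexless) (auto simp: less_Suc_eq_le)
    then show ?thesis using t0(2)[of t] t by simp
  qed
  have "lead n (hev n d c) ((!) t0)" using t0(1) less by (intro lead_hev) auto
  then have "t0 ! i = T i" if "i < n" for i using lead_unique[OF _ assms that] by blast
  then show ?thesis using that[of t0] t0(1) less by blast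
qed

lemma lead_cong: "lead n f S \<Longrightarrow> (\<And>i. i < n \<Longrightarrow> S i = T i) \<Longrightarrow> lead n f T"
  unfolding lead_def enc_def by simp

lemma lead_1: "lead n (\<lambda>X. 1) (\<lambda>i. 0)"
  by (simp add: lead_def enc_def)

text \<open>\<open>enc\<close> is additive whether or not carries occur, and degrees add over a
  field.\<close>

lemma lead_mult:
  assumes "lead n f S" "lead n g T" shows "lead n (\<lambda>X. f X * g X) (\<lambda>i. S i + T i)"
proof -
  obtain B1 B2 where "\<And>B. B \<ge> B1 \<Longrightarrow> f (kron B) \<noteq> 0 \<and> degree (f (kron B)) = enc B n S"
      "\<And>B. B \<ge> B2 \<Longrightarrow> g (kron B) \<noteq> 0 \<and> degree (g (kron B)) = enc B n T"
    using assms unfolding lead_def by metis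
  then show ?thesis unfolding lead_def
    by (intro exI[of _ "max B1 B2"]) (simp add: degree_mult_eq enc_def distrib_right sum.distrib)
qed

lemma lead_power:
  assumes "lead n f S" shows "lead n (\<lambda>X. f X ^ k) (\<lambda>i. k * S i)"
proof (induction k)
  case 0 then show ?case by (simp add: lead_1)
next
  case (Suc k)
  from lead_mult[OF assms Suc] show ?case by simp
qed

lemma lead_prod:
  assumes "finite A" "\<And>a. a \<in> A \<Longrightarrow> lead n (f a) (S a)"
  shows "lead n (\<lambda>X. \<Prod>a\<in>A. f a X) (\<lambda>i. \<Sum>a\<in>A. S a i)"
  using assms
proof (induction A rule: finite_induct)
  case empty then show ?case by (simp add: lead_1)
next
  case (insert a A)
  from lead_mult[of n "f a" "S a" "\<lambda>X. \<Prod>a\<in>A. f a X" "\<lambda>i. \<Sum>a\<in>A. S a i"] insert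
  show ?case by simp
qed

section \<open>Leading exponents of invariant polynomials\<close>

lemma sum_expos_snoc: "(\<Sum>t\<in>expos (Suc n) d. f t) = (\<Sum>l\<le>d. \<Sum>t\<in>expos n (d - l). f (t @ [l]))"
proof -
  have "expos (Suc n) d = (\<Union>l\<in>{..d}. (\<lambda>t. t @ [l]) ` expos n (d - l))" (is "_ = ?R")
  proof (intro equalityI subsetI)
    fix t assume t: "t \<in> expos (Suc n) d"
    then have "t \<noteq> []" by (auto simp: expos_def)
    then obtain s l where s: "t = s @ [l]" by (metis append_butlast_last_id)
    then have "s \<in> expos n (d - l)" "l \<le> d" using t by (auto simp: expos_def)
    then show "t \<in> ?R" using s by blast
  next
    fix t assume "t \<in> ?R" then show "t \<in> expos (Suc n) d" by (auto simp: expos_def)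
  qed
  then have "(\<Sum>t\<in>expos (Suc n) d. f t) = (\<Sum>l\<le>d. \<Sum>t\<in>(\<lambda>t. t @ [l]) ` expos n (d - l). f t)"
    by (simp only:) (rule sum.UNION_disjoint, auto)
  also have "\<dots> = (\<Sum>l\<le>d. \<Sum>t\<in>expos n (d - l). f (t @ [l]))"
    by (rule sum.cong[OF refl]) (simp add: sum.reindex inj_on_def)
  finally show ?thesis .
qed

lemma mono_val_cong: "(\<And>i. i < n \<Longrightarrow> X i = Y i) \<Longrightarrow> mono_val n X t = mono_val n Y t"
  by (simp add: mono_val_def)

lemma hev_cong: "(\<And>i. i < n \<Longrightarrow> X i = Y i) \<Longrightarrow> hev n d c X = hev n d c Y"
  by (simp add: hev_def cong: mono_val_cong)

lemma mono_val_snoc: "length t = n \<Longrightarrow> mono_val (Suc n) X (t @ [l]) = mono_val n X t * X n ^ l"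
  by (simp add: mono_val_def nth_append)

lemma hev_snoc: "hev (Suc n) d c X = (\<Sum>l\<le>d. X n ^ l * hev n (d - l) (\<lambda>t. c (t @ [l])) X)"
  unfolding hev_def sum_expos_snoc sum_distrib_left
proof (intro sum.cong refl)
  fix l t assume "t \<in> expos n (d - l)"
  then have "length t = n" by (simp add: expos_def)
  then show "[:c (t @ [l]):] * mono_val (Suc n) X (t @ [l]) = X n ^ l * ([:c (t @ [l]):] * mono_val n X t)"
    by (simp add: mono_val_snoc mult.commute)
qed

definition last_poly :: "nat \<Rightarrow> nat \<Rightarrow> (nat list \<Rightarrow> 'k::field) \<Rightarrow> (nat \<Rightarrow> 'k poly) \<Rightarrow> 'k poly poly" where
  "last_poly n d c X = (\<Sum>l\<le>d. monom (hev n (d - l) (\<lambda>t. c (t @ [l])) X) l)"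

lemma poly_last_poly: "poly (last_poly n d c X) z = hev (Suc n) d c (X(n := z))"
proof -
  have "hev n (d - l) (\<lambda>t. c (t @ [l])) (X(n := z)) = hev n (d - l) (\<lambda>t. c (t @ [l])) X" for l
    by (rule hev_cong) simp
  then show ?thesis unfolding last_poly_def hev_snoc poly_sum poly_monom by (simp add: mult.commute)
qed

lemma coeff_last_poly: "coeff (last_poly n d c X) l = (if l \<le> d then hev n (d - l) (\<lambda>t. c (t @ [l])) X else 0)"
  unfolding last_poly_def coeff_sum coeff_monom by simp

definition transv_inv :: "nat \<Rightarrow> ((nat \<Rightarrow> 'k::field poly) \<Rightarrow> 'k poly) \<Rightarrow> bool" where
  "transv_inv n f \<longleftrightarrow> (\<forall>i<n. \<forall>r<n. i \<noteq> r \<longrightarrow> (\<forall>a X. f (X(r := X r + [:a:] * X i)) = f X))"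

lemma transv_invD:
  "transv_inv n f \<Longrightarrow> i < n \<Longrightarrow> r < n \<Longrightarrow> i \<noteq> r \<Longrightarrow> f (X(r := X r + [:a:] * X i)) = f X"
  unfolding transv_inv_def by blast

definition leading :: "nat \<Rightarrow> nat \<Rightarrow> (nat list \<Rightarrow> 'k::zero) \<Rightarrow> nat list \<Rightarrow> bool" where
  "leading n d c t0 \<longleftrightarrow> t0 \<in> expos n d \<and> c t0 \<noteq> 0 \<and>
     (\<forall>t\<in>expos n d. c t \<noteq> 0 \<longrightarrow> t \<noteq> t0 \<longrightarrow> lexless n ((!) t) ((!) t0))"

text \<open>Transvections among the first \<open>n\<close> variables leave the last one alone, so
  they fix each coefficient of the expansion in its powers.\<close>

lemma transv_inv_butlast:
  assumes "transv_inv (Suc n) (hev (Suc n) d c)" "l \<le> d"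
  shows "transv_inv n (hev n (d - l) (\<lambda>t. c (t @ [l])))"
  unfolding transv_inv_def
proof (intro allI impI)
  fix i r a and X :: "nat \<Rightarrow> 'a poly" assume ir: "i < n" "r < n" "i \<noteq> r"
  let ?Y = "X(r := X r + [:a:] * X i)"
  have "last_poly n d c ?Y = last_poly n d c X"
  proof (rule poly_eqI_infinite[OF infinite_UNIV_poly])
    fix z
    let ?Z = "X(n := z)"
    have "?Y(n := z) = ?Z(r := ?Z r + [:a:] * ?Z i)" using ir by (simp add: fun_upd_twist)
    moreover have "hev (Suc n) d c (?Z(r := ?Z r + [:a:] * ?Z i)) = hev (Suc n) d c ?Z"
      using ir by (intro transv_invD[OF assms(1)]) simp_all
    ultimately show "poly (last_poly n d c ?Y) z = poly (last_poly n d c X) z" unfolding poly_last_poly by simp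
  qed
  then have "coeff (last_poly n d c ?Y) l = coeff (last_poly n d c X) l" by simp
  then show "hev n (d - l) (\<lambda>t. c (t @ [l])) ?Y = hev n (d - l) (\<lambda>t. c (t @ [l])) X"
    unfolding coeff_last_poly using assms(2) by simp
qed

text \<open>The last variable is compared first, so \<open>l\<close> is its top exponent and the
  rest of the comparison takes place inside the coefficient of its \<open>l\<close>th power.\<close>

lemma leading_snoc:
  assumes "leading (Suc n) d c (t @ [l])"
  shows "length t = n" "l \<le> d" "leading n (d - l) (\<lambda>s. c (s @ [l])) t"
    "\<And>s k. s @ [k] \<in> expos (Suc n) d \<Longrightarrow> l < k \<Longrightarrow> c (s @ [k]) = 0"
proof -
  have t: "t @ [l] \<in> expos (Suc n) d" "c (t @ [l]) \<noteq> 0"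
    and less: "\<And>s. s \<in> expos (Suc n) d \<Longrightarrow> c s \<noteq> 0 \<Longrightarrow> s \<noteq> t @ [l] \<Longrightarrow> lexless (Suc n) ((!) s) ((!) (t @ [l]))"
    using assms unfolding leading_def by blast+
  show len: "length t = n" and ld: "l \<le> d" using t(1) by (auto simp: expos_def)
  show "leading n (d - l) (\<lambda>s. c (s @ [l])) t"
    unfolding leading_def
  proof (intro conjI ballI impI)
    show "t \<in> expos n (d - l)" using t(1) by (auto simp: expos_def)
    show "c (t @ [l]) \<noteq> 0" by fact
    fix s assume s: "s \<in> expos n (d - l)" "c (s @ [l]) \<noteq> 0" "s \<noteq> t"
    then have ls: "length s = n" by (simp add: expos_def)
    have "s @ [l] \<in> expos (Suc n) d" using s ld by (simp add: expos_def)
    from less[OF this] s have "lexless (Suc n) ((!) (s @ [l])) ((!) (t @ [l]))" by simp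
    then obtain r where r: "r < Suc n" "(s @ [l]) ! r < (t @ [l]) ! r"
      "\<And>i. r < i \<Longrightarrow> i < Suc n \<Longrightarrow> (s @ [l]) ! i = (t @ [l]) ! i" unfolding lexless_def by blast
    have "r \<noteq> n" using r(2) len ls by (auto simp: nth_append)
    then have "r < n" using r(1) by simp
    moreover have "s ! r < t ! r" using r(2) \<open>r < n\<close> len ls by (simp add: nth_append)
    moreover have "s ! i = t ! i" if "r < i" "i < n" for i using r(3)[of i] that len ls by (simp add: nth_append)
    ultimately show "lexless n ((!) s) ((!) t)" unfolding lexless_def by blast
  qed
  fix s k assume s: "s @ [k] \<in> expos (Suc n) d" "l < k"
  show "c (s @ [k]) = 0"
  proof (rule ccontr)
    assume "c (s @ [k]) \<noteq> 0"
    then have "lexless (Suc n) ((!) (s @ [k])) ((!) (t @ [l]))" using less[OF s(1)] s(2) by simp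
    then obtain r where r: "r < Suc n" "(s @ [k]) ! r < (t @ [l]) ! r"
      "\<And>i. r < i \<Longrightarrow> i < Suc n \<Longrightarrow> (s @ [k]) ! i = (t @ [l]) ! i" unfolding lexless_def by blast
    have ls: "length s = n" using s(1) by (simp add: expos_def)
    show False
    proof (cases "r = n")
      case True then show False using r(2) ls len s(2) by (simp add: nth_append)
    next
      case False then show False using r(1) r(3)[of n] ls len s(2) by (simp add: nth_append)
    qed
  qed
qed

section \<open>Translation invariance and the exponent of the last variable\<close>

lemma prod_linear_dvd:
  fixes P :: "'r::idom poly"
  assumes "finite W" "\<And>w. w \<in> W \<Longrightarrow> poly P w = 0"
  shows "(\<Prod>w\<in>W. [:- w, 1:]) dvd P"
  using assms
proof (induction W arbitrary: P rule: finite_induct)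
  case (insert w W)
  then obtain Q where Q: "P = [:- w, 1:] * Q" using poly_eq_0_iff_dvd[of P w] by (auto elim: dvdE)
  have "poly Q v = 0" if "v \<in> W" for v
  proof -
    have "poly P v = 0" "v \<noteq> w" using insert that by auto
    then show ?thesis unfolding Q by simp
  qed
  then have "(\<Prod>w\<in>W. [:- w, 1:]) dvd Q" by (rule insert.IH)
  then show ?case unfolding Q prod.insert[OF insert.hyps] by (rule mult_dvd_mono[OF dvd_refl])
qed simp

text \<open>Such a \<open>P\<close> is a polynomial in the product \<open>?V\<close> of all
  \<open>[:- w, 1:]\<close>: minus its constant term it vanishes on \<open>W\<close>, and dividing
  by \<open>?V\<close> leaves an invariant quotient whose degree is smaller by
  \<open>card W\<close>.\<close>

lemma translation_invariant_degree:
  fixes P :: "'r::idom poly"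
  assumes W: "finite W" "0 \<in> W" "\<And>v w. v \<in> W \<Longrightarrow> w \<in> W \<Longrightarrow> v - w \<in> W"
    and inv: "\<And>w. w \<in> W \<Longrightarrow> pcompose P [:w, 1:] = P"
  shows "card W dvd degree P"
  using inv
proof (induction "degree P" arbitrary: P rule: less_induct)
  case less
  show ?case
  proof (cases "degree P = 0")
    case False
    let ?V = "\<Prod>w\<in>W. [:- w, 1:]" and ?P = "P - [:poly P 0:]"
    have V0: "?V \<noteq> 0" using W by simp
    have dV: "degree ?V = card W" by (simp add: degree_prod_eq_sum_degree)
    have Vinv: "pcompose ?V [:w, 1:] = ?V" if "w \<in> W" for w
    proof -
      have neg: "- w \<in> W" using W(3)[OF W(2) that] by simp
      have "pcompose ?V [:w, 1:] = (\<Prod>v\<in>W. [:- (v - w), 1:])"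
        by (simp add: pcompose_prod pcompose_pCons)
      also have "\<dots> = ?V"
      proof (rule prod.reindex_bij_witness[of _ "\<lambda>v. v + w" "\<lambda>v. v - w"])
        show "v + w \<in> W" if "v \<in> W" for v using W(3)[OF that neg] by simp
      qed (use W(3) that in auto)
      finally show ?thesis .
    qed
    have Pinv: "pcompose ?P [:w, 1:] = ?P" if "w \<in> W" for w
      using less.prems[OF that] by (simp add: pcompose_diff pcompose_const)
    have "poly ?P w = 0" if "w \<in> W" for w
    proof -
      have "poly P 0 = poly (pcompose P [:w, 1:]) 0" using less.prems[OF that] by simp
      then show ?thesis by (simp add: poly_pcompose)
    qed
    from prod_linear_dvd[OF W(1) this] obtain Q where Q: "?P = ?V * Q" by (rule dvdE)
    have "degree (P + - [:poly P 0:]) = degree P" using False by (intro degree_add_eq_left) simp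
    then have dP: "degree ?P = degree P" by (simp only: diff_conv_add_uminus)
    then have "?P \<noteq> 0" using False by auto
    then have Q0: "Q \<noteq> 0" using Q by auto
    have deg: "degree P = card W + degree Q" using dP Q degree_mult_eq[OF V0 Q0] dV by simp
    have Qinv: "pcompose Q [:w, 1:] = Q" if "w \<in> W" for w
    proof -
      have "?V * pcompose Q [:w, 1:] = ?V * Q"
        using Pinv[OF that] unfolding Q pcompose_mult Vinv[OF that] .
      then show ?thesis using V0 by simp
    qed
    have "card W > 0" using W by (auto simp: card_gt_0_iff)
    then have "card W dvd degree Q" using deg Qinv by (intro less.hyps) auto
    then show ?thesis unfolding deg by simp
  qed simp
qed

lemma transv_inv_span:
  assumes "transv_inv (Suc n) f" "finite A" "A \<subseteq> {..<n}"
  shows "f (X(n := X n + (\<Sum>i\<in>A. [:a i:] * X i))) = f X"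
  using assms(2,3)
proof (induction A rule: finite_induct)
  case (insert i A)
  let ?Y = "X(n := X n + (\<Sum>i\<in>A. [:a i:] * X i))"
  have "i < Suc n" "i \<noteq> n" using insert by auto
  then have "f (?Y(n := ?Y n + [:a i:] * ?Y i)) = f ?Y" by (intro transv_invD[OF assms(1)]) simp_all
  moreover have "?Y(n := ?Y n + [:a i:] * ?Y i) = X(n := X n + (\<Sum>i\<in>insert i A. [:a i:] * X i))"
    using insert \<open>i \<noteq> n\<close> by (auto simp: algebra_simps)
  moreover have "f ?Y = f X" using insert by blast
  ultimately show ?case by (simp only:)
qed simp

text \<open>The exponents \<open>B ^ i\<close> are distinct for \<open>B \<ge> 2\<close>, so the
  coordinates of \<open>kron B\<close> are linearly independent over the field.\<close>

lemma card_span_kron: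
  assumes "B \<ge> 2"
  shows "card ((\<lambda>a. \<Sum>i<n. [:a i:] * kron B i) ` (\<Pi>\<^sub>E i\<in>{..<n}. UNIV :: 'k::{field,finite} set)) = CARD('k) ^ n"
proof -
  have coeff: "coeff (\<Sum>i<n. [:a i:] * kron B i) (B ^ j) = a j" if "j < n" for a :: "nat \<Rightarrow> 'k" and j
  proof -
    have "coeff (\<Sum>i<n. [:a i:] * kron B i) (B ^ j) = (\<Sum>i<n. if i = j then a i else 0)"
      unfolding coeff_sum by (rule sum.cong) (use assms in \<open>simp_all add: kron_def smult_monom\<close>)
    then show ?thesis using that by simp
  qed
  have "inj_on (\<lambda>a. \<Sum>i<n. [:a i:] * kron B i) (\<Pi>\<^sub>E i\<in>{..<n}. UNIV :: 'k set)"
  proof (rule inj_onI)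
    fix a b :: "nat \<Rightarrow> 'k"
    assume ab: "a \<in> (\<Pi>\<^sub>E i\<in>{..<n}. UNIV)" "b \<in> (\<Pi>\<^sub>E i\<in>{..<n}. UNIV)"
      and eq: "(\<Sum>i<n. [:a i:] * kron B i) = (\<Sum>i<n. [:b i:] * kron B i)"
    show "a = b"
    proof (rule PiE_ext[OF ab])
      fix i assume i: "i \<in> {..<n}"
      have "a i = coeff (\<Sum>i<n. [:a i:] * kron B i) (B ^ i)" using coeff[of i a] i by simp
      also have "\<dots> = b i" unfolding eq using coeff[of i b] i by simp
      finally show "a i = b i" .
    qed
  qed
  then show ?thesis by (simp add: card_image card_PiE)
qed

text \<open>With the first \<open>n\<close> coordinates at \<open>kron B\<close>, the polynomial in
  the last variable has degree \<open>l\<close> and is invariant under translation by their span,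
  which has \<open>CARD('k) ^ n\<close> elements.\<close>

lemma leading_last_dvd:
  fixes c :: "nat list \<Rightarrow> 'k::{field,finite}"
  assumes inv: "transv_inv (Suc n) (hev (Suc n) d c)" and lt: "leading (Suc n) d c (t @ [l])"
  shows "CARD('k) ^ n dvd l"
proof -
  note l = leading_snoc[OF lt]
  have "lead n (hev n (d - l) (\<lambda>s. c (s @ [l]))) ((!) t)"
    using l(3) unfolding leading_def by (intro lead_hev) blast+
  then obtain B0 where B0: "\<And>B. B \<ge> B0 \<Longrightarrow> hev n (d - l) (\<lambda>s. c (s @ [l])) (kron B) \<noteq> 0"
    unfolding lead_def by blast
  \<comment> \<open>Beyond \<open>B0\<close> the coefficient of the \<open>l\<close>th power does
    not vanish, and \<open>B \<ge> 2\<close> gives the span its full size.\<close>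
  define B where "B = B0 + 2"
  define P where "P = last_poly n d c (kron B)"
  have cl: "coeff P l \<noteq> 0" unfolding P_def coeff_last_poly using l(2) B0[of B] by (simp add: B_def)
  have "coeff P k = 0" if "k > l" for k
  proof (cases "k \<le> d")
    case True
    have "c (s @ [k]) = 0" if "s \<in> expos n (d - k)" for s
      using that True \<open>k > l\<close> by (intro l(4)) (auto simp: expos_def)
    then show ?thesis unfolding P_def coeff_last_poly hev_def by simp
  qed (simp add: P_def coeff_last_poly)
  then have "degree P \<le> l" by (auto intro: degree_le)
  then have deg: "degree P = l" using le_degree[OF cl] by simp
  let ?w = "\<lambda>a. \<Sum>i<n. [:a i:] * kron B i"
  let ?W = "?w ` (\<Pi>\<^sub>E i\<in>{..<n}. UNIV :: 'k set)"
  have w_restrict: "?w a \<in> ?W" for a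
  proof -
    have "?w a = ?w (restrict a {..<n})" by (rule sum.cong) auto
    moreover have "restrict a {..<n} \<in> (\<Pi>\<^sub>E i\<in>{..<n}. UNIV)" by simp
    ultimately show ?thesis by (rule rev_image_eqI[rotated])
  qed
  have "card ?W dvd degree P"
  proof (rule translation_invariant_degree)
    show "finite ?W" by (intro finite_imageI finite_PiE) auto
    show "0 \<in> ?W" using w_restrict[of "\<lambda>_. 0"] by simp
    fix v w assume "v \<in> ?W" "w \<in> ?W"
    then obtain a b where "v = ?w a" "w = ?w b" by (elim imageE)
    then have eq: "v - w = ?w (\<lambda>i. a i - b i)" by (simp add: sum_subtractf smult_diff_left)
    show "v - w \<in> ?W" unfolding eq by (rule w_restrict)
  next
    fix w assume "w \<in> ?W"
    then obtain a where w: "w = ?w a" by (elim imageE)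
    show "pcompose P [:w, 1:] = P"
    proof (rule poly_eqI_infinite[OF infinite_UNIV_poly])
      fix z :: "'k poly"
      let ?X = "(kron B)(n := z)"
      have "hev (Suc n) d c (?X(n := ?X n + (\<Sum>i<n. [:a i:] * ?X i))) = hev (Suc n) d c ?X"
        by (rule transv_inv_span[OF inv]) auto
      moreover have "(\<Sum>i<n. [:a i:] * ?X i) = w" unfolding w by (rule sum.cong) auto
      ultimately have "hev (Suc n) d c ((kron B)(n := z + w)) = hev (Suc n) d c ((kron B)(n := z))" by simp
      then show "poly (pcompose P [:w, 1:]) z = poly P z"
        unfolding P_def poly_pcompose poly_last_poly by (simp add: add.commute)
    qed
  qed
  then show ?thesis using deg card_span_kron[of B n, where 'k='k] by (simp add: B_def)
qed

text \<open>The first \<open>n\<close> variables are free in the hypothesis, so the identity holds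
  for the coefficient of each of their monomials; what remains is a binary form of degree
  \<open>D\<close>.\<close>

lemma hev_extract:
  assumes inv: "\<And>X. hev (Suc (Suc n)) d c (X(n := y, Suc n := z)) = hev (Suc (Suc n)) d c (X(n := y', Suc n := z'))"
    and t: "length t = n" "sum_list t + D = d"
  shows "(\<Sum>j\<le>D. [:c (t @ [D - j, j]):] * y ^ (D - j) * z ^ j) = (\<Sum>j\<le>D. [:c (t @ [D - j, j]):] * y' ^ (D - j) * z' ^ j)"
proof -
  let ?E = "expos (Suc (Suc n)) d"
  let ?A = "take n ` ?E"
  let ?e = "\<lambda>y z s. \<Sum>u\<in>{u\<in>?E. take n u = s}. [:c u:] * y ^ (u ! n) * z ^ (u ! Suc n)"
  have hev: "hev (Suc (Suc n)) d c (X(n := y, Suc n := z)) = (\<Sum>s\<in>?A. mono_val n X s * ?e y z s)" for X y z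
  proof -
    have mv: "mono_val (Suc (Suc n)) (X(n := y, Suc n := z)) u = mono_val n X (take n u) * y ^ (u ! n) * z ^ (u ! Suc n)" for u
      by (simp add: mono_val_def)
    have "hev (Suc (Suc n)) d c (X(n := y, Suc n := z)) = (\<Sum>u\<in>?E. mono_val n X (take n u) * ([:c u:] * y ^ (u ! n) * z ^ (u ! Suc n)))"
      unfolding hev_def by (intro sum.cong refl) (simp only: mv mult_ac)
    also have "\<dots> = (\<Sum>s\<in>?A. \<Sum>u\<in>{u\<in>?E. take n u = s}. mono_val n X (take n u) * ([:c u:] * y ^ (u ! n) * z ^ (u ! Suc n)))"
      by (rule sum.image_gen) simp
    also have "\<dots> = (\<Sum>s\<in>?A. mono_val n X s * ?e y z s)"
      unfolding sum_distrib_left by (intro sum.cong refl) simp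
    finally show ?thesis .
  qed
  have z: "(\<Sum>s\<in>?A. mono_val n X s * (?e y z s - ?e y' z' s)) = 0" for X
    using inv[of X] unfolding hev by (simp only: right_diff_distrib sum_subtractf diff_self)
  have e: "?e y z t = ?e y' z' t" if "t \<in> ?A"
  proof -
    have "?e y z t - ?e y' z' t = 0"
    proof (rule poly_fun_zero[OF infinite_UNIV_poly _ _ z that])
      show "finite ?A" by simp
      fix s assume "s \<in> ?A"
      then obtain u where "u \<in> ?E" "s = take n u" by (elim imageE)
      then show "length s = n" by (simp add: expos_def)
    qed
    then show ?thesis by (simp only: right_minus_eq)
  qed
  have set: "{u\<in>?E. take n u = t} = (\<lambda>j. t @ [D - j, j]) ` {..D}" (is "?L = ?R")
  proof (intro equalityI subsetI)
    fix u assume u: "u \<in> ?L"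
    then have "length (drop n u) = Suc (Suc 0)" by (simp add: expos_def)
    then obtain i j where ij: "drop n u = [i, j]" by (auto simp: length_Suc_conv simp del: length_drop)
    then have ue: "u = t @ [i, j]" using u append_take_drop_id[of n u] by simp
    then have "sum_list t + i + j = d" using u by (simp add: expos_def)
    then have "i = D - j" "j \<le> D" using t(2) by linarith+
    then show "u \<in> ?R" using ue by blast
  next
    fix u assume "u \<in> ?R" then show "u \<in> ?L" using t by (auto simp: expos_def)
  qed
  have ev: "?e y z t = (\<Sum>j\<le>D. [:c (t @ [D - j, j]):] * y ^ (D - j) * z ^ j)" for y z
  proof -
    have "inj_on (\<lambda>j. t @ [D - j, j]) {..D}" by (rule inj_onI) simp
    then show ?thesis unfolding set by (simp add: sum.reindex nth_append t(1))
  qed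
  have "t @ [D - 0, 0] \<in> {u\<in>?E. take n u = t}" unfolding set by blast
  then have "t @ [D - 0, 0] \<in> ?E" "t = take n (t @ [D - 0, 0])" by simp_all
  then have "t \<in> ?A" by (rule rev_image_eqI)
  then show ?thesis using e unfolding ev by blast
qed

text \<open>The binary form in the last two variables that multiplies the monomial \<open>t\<close>
  is invariant under transvections. It vanishes to order at least \<open>a\<close> on the line
  \<open>z = 0\<close>, hence on each of the \<open>CARD('k)\<close> lines \<open>z = b y\<close>;
  as its degree in \<open>z\<close> is \<open>l\<close>, this gives the bound.\<close>

lemma leading_pair:
  fixes c :: "nat list \<Rightarrow> 'k::{field,finite}"
  assumes inv: "transv_inv (Suc (Suc n)) (hev (Suc (Suc n)) d c)" and lt: "leading (Suc (Suc n)) d c (t @ [a, l])"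
  shows "CARD('k) * a \<le> l"
proof -
  have lt': "leading (Suc (Suc n)) d c ((t @ [a]) @ [l])" using lt by simp
  note l = leading_snoc[OF lt']
  define D where "D = a + l"
  define e where "e j = c (t @ [D - j, j])" for j
  define h :: "'k poly \<Rightarrow> 'k poly \<Rightarrow> 'k poly" where "h y z = (\<Sum>j\<le>D. [:e j:] * y ^ (D - j) * z ^ j)" for y z
  have lent: "length t = n" using l(1) by simp
  have "t @ [a, l] \<in> expos (Suc (Suc n)) d" "c (t @ [a, l]) \<noteq> 0" using lt unfolding leading_def by blast+
  then have sum: "sum_list t + D = d" and el: "e l \<noteq> 0" by (simp_all add: expos_def D_def e_def)
  have e0: "e j = 0" if "j > l" "j \<le> D" for j
    unfolding e_def using l(4)[of "t @ [D - j]" j] that sum lent by (simp add: expos_def)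
  have h1: "h y (z + [:b:] * y) = h y z" for y z b
    unfolding h_def e_def
  proof (rule hev_extract[OF _ lent sum])
    fix X :: "nat \<Rightarrow> 'k poly"
    let ?Y = "X(n := y, Suc n := z)"
    have "hev (Suc (Suc n)) d c (?Y(Suc n := ?Y (Suc n) + [:b:] * ?Y n)) = hev (Suc (Suc n)) d c ?Y"
      by (rule transv_invD[OF inv]) simp_all
    then show "hev (Suc (Suc n)) d c (X(n := y, Suc n := z + [:b:] * y)) = hev (Suc (Suc n)) d c (X(n := y, Suc n := z))"
      by simp
  qed
  have h2: "h (y + [:b:] * z) z = h y z" for y z b
    unfolding h_def e_def
  proof (rule hev_extract[OF _ lent sum])
    fix X :: "nat \<Rightarrow> 'k poly"
    let ?Y = "X(n := y, Suc n := z)"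
    have "hev (Suc (Suc n)) d c (?Y(n := ?Y n + [:b:] * ?Y (Suc n))) = hev (Suc (Suc n)) d c ?Y"
      by (rule transv_invD[OF inv]) simp_all
    moreover have "?Y(n := ?Y n + [:b:] * ?Y (Suc n)) = X(n := y + [:b:] * z, Suc n := z)" by auto
    ultimately show "hev (Suc (Suc n)) d c (X(n := y + [:b:] * z, Suc n := z)) = hev (Suc (Suc n)) d c (X(n := y, Suc n := z))"
      by simp
  qed
  \<comment> \<open>This rotation is a product of three transvections; it exchanges the roles of the
    two exponents.\<close>
  have swap: "h y z = h z (- y)" for y z
  proof -
    have "h y z = h (y + z) z" using h2[of y 1 z] by simp
    also have "\<dots> = h (y + z) (- y)" using h1[of "y + z" z "-1"] by simp
    also have "\<dots> = h z (- y)" using h2[of "y + z" 1 "- y"] by simp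
    finally show ?thesis .
  qed
  define q where "q = (\<Sum>j\<le>D. monom [:e j:] j)"
  have pq: "poly q z = h 1 z" for z by (simp add: q_def h_def poly_sum poly_monom)
  have cq: "coeff q j = (if j \<le> D then [:e j:] else 0)" for j
    unfolding q_def coeff_sum coeff_monom by simp
  have degq: "degree q = l"
  proof (rule antisym)
    show "degree q \<le> l" by (rule degree_le) (auto simp: cq e0)
    show "l \<le> degree q" by (rule le_degree) (simp add: cq D_def el)
  qed
  have q0: "q \<noteq> 0" using cq[of l] el by (auto simp: D_def)
  have "q = (\<Sum>j\<le>D. monom ([:e j:] * (-1) ^ j) (D - j))"
  proof (rule poly_eqI_infinite[OF infinite_UNIV_poly])
    fix z
    have "poly q z = h z (-1)" unfolding pq by (rule swap)
    then show "poly q z = poly (\<Sum>j\<le>D. monom ([:e j:] * (-1) ^ j) (D - j)) z"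
      unfolding h_def poly_sum poly_monom by (simp only: mult_ac)
  qed
  then have cq': "coeff q k = (\<Sum>j\<le>D. if D - j = k then [:e j:] * (-1) ^ j else 0)" for k
    by (simp only: coeff_sum coeff_monom)
  have "coeff q k = 0" if "k < a" for k
  proof -
    show ?thesis unfolding cq'
    proof (intro sum.neutral ballI)
      fix j assume j: "j \<in> {..D}"
      show "(if D - j = k then [:e j:] * (-1) ^ j else 0) = 0"
      proof (cases "D - j = k")
        case True
        then have "j > l" using that j by (simp add: D_def)
        then show ?thesis using e0[of j] j by simp
      qed simp
    qed
  qed
  \<comment> \<open>The degree in \<open>z\<close> is at most \<open>l\<close>, hence by
    \<open>swap\<close> so is the degree in \<open>y\<close>, and every term contains
    \<open>z\<close> at least \<open>D - l = a\<close> times.\<close>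
  then have dvd0: "monom 1 a dvd q" unfolding monom_1_dvd_iff' by blast
  \<comment> \<open>Translation by \<open>b\<close> carries the zero of order \<open>a\<close> at 0
    to a zero at \<open>b\<close>.\<close>
  have dvd: "[:- [:b:], 1:] ^ a dvd q" for b :: 'k
  proof -
    have inv: "pcompose q [:- [:b:], 1:] = q"
    proof (rule poly_eqI_infinite[OF infinite_UNIV_poly])
      fix z
      have "poly [:- [:b:], 1:] z = z + [:- b:] * 1" by simp
      then show "poly (pcompose q [:- [:b:], 1:]) z = poly q z" by (simp only: poly_pcompose pq h1)
    qed
    obtain r where "q = monom 1 a * r" using dvd0 by (rule dvdE)
    then have "pcompose q [:- [:b:], 1:] = pcompose ([:0, 1:] ^ a) [:- [:b:], 1:] * pcompose r [:- [:b:], 1:]"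
      by (simp add: pcompose_mult monom_altdef)
    also have "pcompose ([:0, 1:] ^ a) [:- [:b:], 1:] = [:- [:b:], 1:] ^ a"
      by (induction a) (simp_all add: pcompose_mult pcompose_pCons)
    finally show ?thesis unfolding inv by (metis dvd_triv_left)
  qed
  let ?S = "range (\<lambda>b::'k. [:b:])"
  have fin: "finite ?S" by simp
  have "CARD('k) * a = (\<Sum>w\<in>?S. a)"
  proof -
    have "card ?S = CARD('k)" by (rule card_image) (auto simp: inj_on_def)
    then show ?thesis by simp
  qed
  also have "\<dots> \<le> (\<Sum>w\<in>?S. count (proots q) w)"
  proof (rule sum_mono)
    fix w assume "w \<in> ?S"
    then obtain b where "w = [:b:]" by blast
    then show "a \<le> count (proots q) w" using order_max[OF dvd[of b] q0] q0 by simp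
  qed
  also have "\<dots> \<le> (\<Sum>w\<in>?S \<union> set_mset (proots q). count (proots q) w)"
    by (rule sum_mono2) (use fin in auto)
  also have "\<dots> = size (proots q)"
    unfolding size_multiset_overloaded_eq by (rule sum.mono_neutral_right) (use fin in \<open>auto simp: not_in_iff\<close>)
  also have "\<dots> \<le> degree q" by (rule size_proots_le)
  finally show ?thesis unfolding degq .
qed

text \<open>Induction that strips the last variable: the coefficient of its top power is again
  invariant, and only the statements about the last exponents are new.\<close>

theorem leading_exponents:
  fixes c :: "nat list \<Rightarrow> 'k::{field,finite}"
  assumes "transv_inv n (hev n d c)" "leading n d c t"
  shows "(\<forall>r<n. CARD('k) ^ r dvd t ! r) \<and> (\<forall>r. Suc r < n \<longrightarrow> CARD('k) * t ! r \<le> t ! Suc r)"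
  using assms
proof (induction n arbitrary: d c t)
  case (Suc n)
  have "length t = Suc n" using Suc.prems(2) by (auto simp: leading_def expos_def)
  then obtain s l where t: "t = s @ [l]" by (metis append_butlast_last_id length_0_conv nat.distinct(1))
  note l = leading_snoc[OF Suc.prems(2)[unfolded t]]
  have IH: "(\<forall>r<n. CARD('k) ^ r dvd s ! r) \<and> (\<forall>r. Suc r < n \<longrightarrow> CARD('k) * s ! r \<le> s ! Suc r)"
    by (rule Suc.IH[OF transv_inv_butlast[OF Suc.prems(1) l(2)] l(3)])
  have last: "CARD('k) ^ n dvd l" by (rule leading_last_dvd[OF Suc.prems(1) Suc.prems(2)[unfolded t]])
  show ?case
  proof (intro conjI allI impI)
    fix r assume "r < Suc n"
    then show "CARD('k) ^ r dvd t ! r" using IH last l(1) unfolding t by (cases "r = n") (auto simp: nth_append)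
  next
    fix r assume r: "Suc r < Suc n"
    show "CARD('k) * t ! r \<le> t ! Suc r"
    proof (cases "Suc r < n")
      case True then show ?thesis using IH l(1) unfolding t by (simp add: nth_append)
    next
      case False
      then have n: "n = Suc r" using r by simp
      then obtain u a where s: "s = u @ [a]" using l(1) by (metis append_butlast_last_id length_0_conv nat.distinct(1))
      have "leading (Suc (Suc r)) d c (u @ [a, l])" using Suc.prems(2) unfolding t s n by simp
      from leading_pair[OF _ this] have "CARD('k) * a \<le> l" using Suc.prems(1) unfolding n by blast
      then show ?thesis using l(1) unfolding t s n by (simp add: nth_append)
    qed
  qed
qed simp

section \<open>Invariant functionals as alternating forms\<close>

text \<open>
  A functional \<open>\<phi>\<close> on the monomials \<open>u\<^sub>J v^[t]\<close> with \<open>|t| = d\<close> becomes a form with polynomial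
  coefficients, evaluated at a point \<open>X\<close> and an element \<open>D\<close> of the exterior algebra.
\<close>

definition form :: "nat \<Rightarrow> nat \<Rightarrow> (nat set \<Rightarrow> nat list \<Rightarrow> 'k::field) \<Rightarrow> (nat \<Rightarrow> 'k poly) \<Rightarrow> (nat set \<Rightarrow> 'k poly) \<Rightarrow> 'k poly" where
  "form n d \<phi> X D = (\<Sum>J\<in>Pow {..<n}. hev n d (\<phi> J) X * D J)"

definition lift_mat :: "(nat \<Rightarrow> nat \<Rightarrow> 'k::field) \<Rightarrow> nat \<Rightarrow> nat \<Rightarrow> 'k poly" where
  "lift_mat G j s = [:G j s:]"

text \<open>The double sum is the value of \<open>\<phi>\<close> on the image of u_I v^[s] under
  \<open>G\<close>, by \<open>lookup_GL_act_mon\<close>; it is spelled out in coefficients to be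
  compared with \<open>form_act\<close>.\<close>

definition act_inv :: "nat \<Rightarrow> nat \<Rightarrow> (nat set \<Rightarrow> nat list \<Rightarrow> 'k::field) \<Rightarrow> (nat \<Rightarrow> nat \<Rightarrow> 'k) \<Rightarrow> bool" where
  "act_inv n d \<phi> G \<longleftrightarrow> (\<forall>I\<in>Pow {..<n}. \<forall>s\<in>expos n d.
     (\<Sum>J\<in>Pow {..<n}. \<Sum>t\<in>expos n d. ext_cols G n I J * div_coeff n (mat_cols G n) s t * \<phi> J t) = \<phi> I s)"

lemma pCons_sign: "[:(-1) ^ k:] = ((-1) ^ k :: 'k::field poly)"
  by (simp only: coeff_lift_hom.hom_power coeff_lift_hom.hom_uminus coeff_lift_hom.hom_one)

lemma const_poly_mult: "[:a * b:] = [:a:] * [:b:]" for a b :: "'k::field"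
  by simp

lemma const_wedge: "[:wedge w D J:] = wedge (\<lambda>j. [:w j:]) (\<lambda>J. [:D J:]) J" for w :: "nat \<Rightarrow> 'k::field"
  unfolding wedge_def by (simp only: const_poly_mult coeff_lift_hom.hom_sum pCons_sign)

lemma const_sel_wedges: "[:sel_wedges l J:] = sel_wedges (map (\<lambda>(e, w). (e, \<lambda>j. [:w j :: 'k::field:])) l) J"
proof (induction l arbitrary: J)
  case Nil
  show ?case by (simp add: ext_basis_def one_pCons[symmetric])
next
  case (Cons a l)
  then show ?case by (cases a) (simp add: const_wedge)
qed

lemma const_ext_cols: "[:ext_cols G n I J:] = ext_cols (lift_mat G) n I J"
  unfolding ext_cols_def const_sel_wedges by (simp add: comp_def lift_mat_def)

lemma const_mono_val: "[:mono_val n c t:] = mono_val n (\<lambda>j. [:c j :: 'k::field:]) t"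
  unfolding mono_val_def by (simp only: coeff_lift_hom.hom_prod coeff_lift_hom.hom_power)

lemma const_of_nat: "[:of_nat m:] = (of_nat m :: 'k::field poly)"
  by (rule coeff_lift_hom.hom_of_nat)

lemma const_div_coeff:
  "[:div_coeff n cs ks t:] = div_coeff n (map (\<lambda>c j. [:c j :: 'k::field:]) cs) ks t"
proof (induction n cs ks t rule: div_coeff.induct)
  case (1 n c cs k ks t)
  show ?case unfolding div_coeff.simps list.map coeff_lift_hom.hom_sum const_poly_mult const_mono_val const_of_nat
    by (intro sum.cong refl) (use 1 in simp)
qed (simp_all add: one_pCons[symmetric])

text \<open>Here divided powers become ordinary polynomials: the coefficients of the action on
  divided powers are those of a linear substitution in monomials.\<close>

lemma mono_val_mat_app:
  assumes "t \<in> expos n d"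
  shows "mono_val n (mat_app (lift_mat G) n X) t
    = (\<Sum>s\<in>expos n d. mono_val n X s * [:div_coeff n (mat_cols G n) s t:])"
proof -
  have t: "length t = n" "sum_list t = d" using assms by (simp_all add: expos_def)
  let ?cs = "mat_cols (lift_mat G) n"
  have "mono_val n (\<lambda>j. \<Sum>i<length ?cs. X i * (?cs ! i) j) t = (\<Sum>s\<in>expos n d. mono_val n X s * div_coeff n ?cs s t)"
    using div_coeff_generating[OF t(1), of ?cs X] t(2) by simp
  moreover have "(\<lambda>j. \<Sum>i<length ?cs. X i * (?cs ! i) j) = mat_app (lift_mat G) n X"
    by (rule ext) (auto simp: mat_app_def intro!: sum.cong)
  moreover have "?cs = map (\<lambda>c j. [:c j:]) (mat_cols G n)" by (simp add: lift_mat_def)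
  ultimately show ?thesis by (simp only: const_div_coeff)
qed

text \<open>Substituting in the point yields the divided power coefficients and
  \<open>ext_map\<close> yields the minors, so both substitutions together are the transpose of the
  action on homology.\<close>

lemma form_act:
  "form n d \<phi> (mat_app (lift_mat G) n X) (ext_map (lift_mat G) n D) =
   (\<Sum>I\<in>Pow {..<n}. \<Sum>s\<in>expos n d. D I * mono_val n X s *
      [:\<Sum>J\<in>Pow {..<n}. \<Sum>t\<in>expos n d. ext_cols G n I J * div_coeff n (mat_cols G n) s t * \<phi> J t:])"
proof -
  let ?P = "Pow {..<n}" and ?E = "expos n d" and ?c = "\<lambda>s t. [:div_coeff n (mat_cols G n) s t:]"
  let ?x = "ext_cols (lift_mat G) n"
  have "form n d \<phi> (mat_app (lift_mat G) n X) (ext_map (lift_mat G) n D)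
      = (\<Sum>J\<in>?P. (\<Sum>t\<in>?E. [:\<phi> J t:] * (\<Sum>s\<in>?E. mono_val n X s * ?c s t)) * (\<Sum>I\<in>?P. D I * ?x I J))"
    unfolding form_def hev_def ext_map_def by (intro sum.cong arg_cong2[of _ _ _ _ "(*)"] refl) (simp only: mono_val_mat_app)
  also have "\<dots> = (\<Sum>J\<in>?P. \<Sum>I\<in>?P. \<Sum>t\<in>?E. \<Sum>s\<in>?E. D I * mono_val n X s * (?x I J * ?c s t * [:\<phi> J t:]))"
    unfolding sum_distrib_left sum_distrib_right by (intro sum.cong refl) (simp only: mult_ac)
  also have "\<dots> = (\<Sum>I\<in>?P. \<Sum>J\<in>?P. \<Sum>t\<in>?E. \<Sum>s\<in>?E. D I * mono_val n X s * (?x I J * ?c s t * [:\<phi> J t:]))"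
    by (rule sum.swap)
  also have "\<dots> = (\<Sum>I\<in>?P. \<Sum>J\<in>?P. \<Sum>s\<in>?E. \<Sum>t\<in>?E. D I * mono_val n X s * (?x I J * ?c s t * [:\<phi> J t:]))"
    by (rule sum.cong[OF refl], rule sum.cong[OF refl], rule sum.swap)
  also have "\<dots> = (\<Sum>I\<in>?P. \<Sum>s\<in>?E. \<Sum>J\<in>?P. \<Sum>t\<in>?E. D I * mono_val n X s * (?x I J * ?c s t * [:\<phi> J t:]))"
    by (rule sum.cong[OF refl], rule sum.swap)
  also have "\<dots> = (\<Sum>I\<in>?P. \<Sum>s\<in>?E. D I * mono_val n X s *
      [:\<Sum>J\<in>?P. \<Sum>t\<in>?E. ext_cols G n I J * div_coeff n (mat_cols G n) s t * \<phi> J t:])"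
    unfolding coeff_lift_hom.hom_sum const_poly_mult const_ext_cols sum_distrib_left ..
  finally show ?thesis .
qed

lemma form_alt: "form n d \<phi> X D = (\<Sum>I\<in>Pow {..<n}. \<Sum>s\<in>expos n d. D I * mono_val n X s * [:\<phi> I s:])"
  unfolding form_def hev_def sum_distrib_right by (intro sum.cong refl) (simp only: mult_ac)

lemma form_invariant:
  assumes "act_inv n d \<phi> G"
  shows "form n d \<phi> (mat_app (lift_mat G) n X) (ext_map (lift_mat G) n D) = form n d \<phi> X D"
proof -
  have "(\<Sum>J\<in>Pow {..<n}. \<Sum>t\<in>expos n d. ext_cols G n I J * div_coeff n (mat_cols G n) s t * \<phi> J t) = \<phi> I s"
    if "I \<in> Pow {..<n}" "s \<in> expos n d" for I s
    using assms that unfolding act_inv_def by blast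
  then show ?thesis unfolding form_act by (simp only: form_alt) (intro sum.cong refl, simp only:)
qed

lemma form_ext_basis:
  assumes "I \<subseteq> {..<n}" shows "form n d \<phi> X (ext_basis I) = hev n d (\<phi> I) X"
  using ext_basis_empty_sum[of "Pow {..<n}" I "\<lambda>J. hev n d (\<phi> J) X"] assms
  by (simp add: form_def mult.commute)

text \<open>Converse of \<open>form_invariant\<close>. Basis elements suffice as exterior arguments,
  and \<open>hev_unique\<close> recovers the single coefficients.\<close>

lemma act_invI:
  assumes "\<And>X I. I \<subseteq> {..<n} \<Longrightarrow> form n d \<phi> (mat_app (lift_mat G) n X) (ext_map (lift_mat G) n (ext_basis I)) = form n d \<phi> X (ext_basis I)"
  shows "act_inv n d \<phi> G"
  unfolding act_inv_def
proof (intro ballI)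
  fix I s assume I: "I \<in> Pow {..<n}" and s: "s \<in> expos n d"
  let ?c = "\<lambda>I s. \<Sum>J\<in>Pow {..<n}. \<Sum>t\<in>expos n d. ext_cols G n I J * div_coeff n (mat_cols G n) s t * \<phi> J t"
  have "form n d \<phi> (mat_app (lift_mat G) n X) (ext_map (lift_mat G) n (ext_basis I)) = hev n d (?c I) X" for X
  proof -
    have "form n d \<phi> (mat_app (lift_mat G) n X) (ext_map (lift_mat G) n (ext_basis I)) = form n d ?c X (ext_basis I)"
      unfolding form_act by (simp only: form_alt)
    then show ?thesis using I by (simp only: form_ext_basis Pow_iff)
  qed
  then have "hev n d (?c I) X = hev n d (\<phi> I) X" for X
    using assms[of I X] I by (simp only: form_ext_basis Pow_iff)
  then show "?c I s = \<phi> I s" by (rule hev_unique) fact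
qed

lemma form_cong: "(\<And>J. J \<subseteq> {..<n} \<Longrightarrow> D J = E J) \<Longrightarrow> form n d \<phi> X D = form n d \<phi> X E"
  unfolding form_def by (intro sum.cong refl) simp

lemma form_add: "form n d \<phi> X (\<lambda>J. D J + E J) = form n d \<phi> X D + form n d \<phi> X E"
  by (simp add: form_def distrib_left sum.distrib)

lemma form_sum: "form n d \<phi> X (\<lambda>J. \<Sum>a\<in>A. c a * D a J) = (\<Sum>a\<in>A. c a * form n d \<phi> X (D a))"
  unfolding form_def sum_distrib_left by (subst sum.swap) (intro sum.cong refl, simp only: mult_ac)

subsection \<open>The leading exponents of a form\<close>

text \<open>For \<open>D = ext_basis {}\<close> the coordinates are minors of the matrix with
  entries \<open>X i ^ (p ^ j)\<close>, Moore's analogue of the Vandermonde matrix over a finite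
  field.\<close>

abbreviation frob_wedge :: "nat \<Rightarrow> nat list \<Rightarrow> (nat \<Rightarrow> 'r::comm_ring_1) \<Rightarrow> (nat set \<Rightarrow> 'r) \<Rightarrow> nat set \<Rightarrow> 'r" where
  "frob_wedge p js X D \<equiv> foldr wedge (map (\<lambda>j i. X i ^ (p ^ j)) js) D"

text \<open>
  In the order on the monomials \<open>u\<^sub>J v^[t]\<close> the generator \<open>u\<^sub>r\<close> counts slightly less than
  \<open>v\<^sub>r^[p^r]\<close>, namely like the exponent \<open>p^r - 1/2\<close>.
\<close>

definition mon_key :: "nat \<Rightarrow> nat set \<Rightarrow> nat list \<Rightarrow> nat \<Rightarrow> nat" where
  "mon_key p J t r = 2 * t ! r + (if r \<in> J then 2 * p ^ r - 1 else 0)"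

text \<open>The parity of the key tells whether \<open>r \<in> J\<close>, since
  \<open>2 * p ^ r - 1\<close> is odd.\<close>

lemma mon_key_inj:
  assumes "J \<subseteq> {..<n}" "I \<subseteq> {..<n}" "length s = n" "length t = n" "p > 0"
    and eq: "\<And>r. r < n \<Longrightarrow> mon_key p I s r = mon_key p J t r"
  shows "I = J \<and> s = t"
proof -
  have *: "(r \<in> I) = (r \<in> J) \<and> s ! r = t ! r" if "r < n" for r
  proof -
    have pos: "p ^ r > 0" using assms by simp
    have e: "2 * s ! r + (if r \<in> I then 2 * p ^ r - 1 else 0) = 2 * t ! r + (if r \<in> J then 2 * p ^ r - 1 else 0)"
      using eq[OF that] by (simp add: mon_key_def)
    have parity: "2 * a + (2 * q - 1) \<noteq> 2 * b" if "q > 0" for a b q :: nat using that by presburger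
    show ?thesis using e parity[OF pos, of "s ! r" "t ! r"] parity[OF pos, of "t ! r" "s ! r"]
      by (cases "r \<in> I"; cases "r \<in> J") auto
  qed
  have "I = J" using * assms(1,2) by blast
  moreover have "s = t" using * assms(3,4) by (intro nth_equalityI) auto
  ultimately show ?thesis ..
qed

text \<open>In a Leibniz term, variable \<open>ls ! i\<close> receives the twist
  \<open>js ! i\<close>. Every term except the diagonal one of the leading monomial is smaller: at
  the last position \<open>r\<close> where the data differ, all higher variables in \<open>J\<close>
  hold their own twists, so only twists \<open>j \<le> r\<close> remain for
  \<open>r\<close>.\<close>

lemma key_lexless:
  fixes p n :: nat
  assumes p: "p \<ge> 2" and js: "distinct js" "set js = J" "J \<subseteq> {..<n}"
    and ls: "distinct ls" "set ls = I" "I \<subseteq> {..<n}" "length ls = length js"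
    and st: "length s = n" "length t = n"
    and le: "(I, s) = (J, t) \<or> lexless n (mon_key p I s) (mon_key p J t)"
    and ne: "(I, s, ls) \<noteq> (J, t, js)"
  shows "lexless n (\<lambda>r. s ! r + (\<Sum>i<length js. if ls ! i = r then p ^ (js ! i) else 0))
           (\<lambda>r. t ! r + (if r \<in> J then p ^ r else 0))"
proof -
  let ?k = "length js"
  define \<mu> where "\<mu> r = (\<Sum>i<?k. if ls ! i = r then p ^ (js ! i) else 0)" for r
  have mu_in: "\<mu> (ls ! i) = p ^ (js ! i)" if "i < ?k" for i
  proof -
    have "\<mu> (ls ! i) = (\<Sum>i'<?k. if i' = i then p ^ (js ! i') else 0)"
      unfolding \<mu>_def using ls that by (intro sum.cong refl) (simp add: nth_eq_iff_index_eq)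
    then show ?thesis using that by simp
  qed
  have mu_out: "\<mu> r = 0" if "r \<notin> I" for r
    unfolding \<mu>_def using that ls by (intro sum.neutral ballI) auto
  have inj: "p ^ a = p ^ b \<longleftrightarrow> a = b" for a b using p by (simp add: power_inject_exp)
  \<comment> \<open>The last clause matters when \<open>I = J\<close> and \<open>s = t\<close>: then
    only the assignment of the twists differs.\<close>
  let ?same = "\<lambda>r. s ! r = t ! r \<and> (r \<in> I \<longleftrightarrow> r \<in> J) \<and> (r \<in> J \<longrightarrow> \<mu> r = p ^ r)"
  have "\<exists>r<n. \<not> ?same r"
  proof (rule ccontr)
    assume "\<not> ?thesis"
    then have same: "?same r" if "r < n" for r using that by blast
    have "I = J" using same ls(3) js(3) by blast
    moreover have "s = t" using same st by (intro nth_equalityI) auto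
    moreover have "ls = js"
    proof (rule nth_equalityI)
      fix i assume "i < length ls"
      then have i: "i < ?k" using ls by simp
      then have "ls ! i \<in> J" using \<open>I = J\<close> ls by auto
      then have "\<mu> (ls ! i) = p ^ (ls ! i)" using same js(3) by blast
      then show "ls ! i = js ! i" using mu_in[OF i] inj by simp
    qed (use ls in simp)
    ultimately show False using ne by simp
  qed
  then obtain i0 where i0: "i0 < n" "\<not> ?same i0" by (elim exE conjE)
  obtain r where r: "r < n" "\<not> ?same r" and r': "\<And>i. r < i \<Longrightarrow> i < n \<Longrightarrow> \<not> \<not> ?same i"
  proof (rule last_difference[where P = "\<lambda>r. \<not> ?same r", OF i0])
    fix r assume a: "r < n" "\<not> ?same r" "\<And>i. r < i \<Longrightarrow> i < n \<Longrightarrow> \<not> \<not> ?same i"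
    show thesis by (rule that[OF a])
  qed
  have r3: "?same i" if "r < i" "i < n" for i by (rule notnotD[OF r'[OF that]])
  have key: "mon_key p I s r \<le> mon_key p J t r"
  proof (cases "(I, s) = (J, t)")
    case False
    then obtain q where q: "q < n" "mon_key p I s q < mon_key p J t q"
      "\<And>i. q < i \<Longrightarrow> i < n \<Longrightarrow> mon_key p I s i = mon_key p J t i" using le unfolding lexless_def by blast
    have "q \<le> r"
    proof (rule ccontr)
      assume "\<not> q \<le> r"
      then have "?same q" using q by (intro r3) simp_all
      then have "mon_key p I s q = mon_key p J t q" by (simp add: mon_key_def)
      then show False using q by simp
    qed
    then show ?thesis using q(2) q(3)[of r] r(1) by (cases "q = r") simp_all
  qed simp
  \<comment> \<open>A twist above \<open>r\<close> is held by the variable of the same index, and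
    each twist is given out only once.\<close>
  have mu_le: "\<exists>j\<in>J. j \<le> r \<and> \<mu> r = p ^ j" if "r \<in> I"
  proof -
    obtain i where i: "i < ?k" "ls ! i = r" using \<open>r \<in> I\<close> ls by (metis in_set_conv_nth)
    have jJ: "js ! i \<in> J" using i js by auto
    have "js ! i \<le> r"
    proof (rule ccontr)
      assume gt: "\<not> js ! i \<le> r"
      then have "?same (js ! i)" using jJ js(3) by (intro r3) auto
      then have m: "js ! i \<in> I" "\<mu> (js ! i) = p ^ (js ! i)" using jJ by auto
      then obtain i' where i': "i' < ?k" "ls ! i' = js ! i" using ls by (metis in_set_conv_nth)
      then have "p ^ (js ! i') = p ^ (js ! i)" using mu_in[of i'] m by simp
      then have "js ! i' = js ! i" using inj by simp
      then have "i' = i" using js(1) i i' by (simp add: nth_eq_iff_index_eq)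
      then show False using i' i gt by simp
    qed
    then show ?thesis using jJ mu_in[OF i(1)] i by auto
  qed
  have pos: "p ^ r > 0" using p by simp
  have "s ! r + \<mu> r < t ! r + (if r \<in> J then p ^ r else 0)"
  proof (cases "r \<in> I")
    case True
    then obtain j where j: "j \<in> J" "j \<le> r" "\<mu> r = p ^ j" using mu_le by blast
    show ?thesis
    proof (cases "r \<in> J")
      case rJ: True
      have "s ! r \<le> t ! r" using key True rJ by (simp add: mon_key_def)
      moreover have "\<mu> r \<le> p ^ r" using j p by (simp add: power_increasing)
      moreover have "s ! r \<noteq> t ! r \<or> \<mu> r \<noteq> p ^ r" using r(2) True rJ by blast
      ultimately show ?thesis using rJ by auto
    next
      case rJ: False
      then have "j < r" using j by (metis order_le_less)
      then have "\<mu> r < p ^ r" using j p by (simp add: power_strict_increasing)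
      moreover have "2 * s ! r + (2 * p ^ r - 1) \<le> 2 * t ! r" using key True rJ by (simp add: mon_key_def)
      ultimately show ?thesis using rJ pos by simp
    qed
  next
    case False
    then have m0: "\<mu> r = 0" by (rule mu_out)
    show ?thesis
    proof (cases "r \<in> J")
      case rJ: True
      \<comment> \<open>Here the half in the key produces the strict inequality; with weight exactly
        \<open>p ^ r\<close> a tie would remain possible.\<close>
      have "2 * s ! r \<le> 2 * t ! r + (2 * p ^ r - 1)" using key False rJ by (simp add: mon_key_def)
      then have "s ! r < t ! r + p ^ r" using pos by linarith
      then show ?thesis using rJ m0 by simp
    next
      case rJ: False
      have "s ! r \<le> t ! r" using key False rJ by (simp add: mon_key_def)
      moreover have "s ! r \<noteq> t ! r" using r(2) False rJ by blast
      ultimately show ?thesis using rJ m0 by simp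
    qed
  qed
  moreover have "s ! i + \<mu> i = t ! i + (if i \<in> J then p ^ i else 0)" if "r < i" "i < n" for i
    using r3[OF that] mu_out[of i] by auto
  ultimately show ?thesis using r(1) unfolding lexless_def \<mu>_def by blast
qed

lemma prod_monom_1:
  fixes k :: nat
  shows "(\<Prod>i<k. monom (1::'k::field) (e i)) = monom 1 (\<Sum>i<k. e i)"
  by (induction k) (simp_all add: mult_monom add.commute)

lemma wedges_frob_kron:
  assumes sg: "\<And>ws J. finite J \<Longrightarrow> wedges ws J = (\<Sum>ls | length ls = length ws \<and> distinct ls \<and> set ls = J.
         sg ls * (\<Prod>i<length ws. (ws ! i) (ls ! i)))"
    and J: "J \<subseteq> {..<n}"
  shows "frob_wedge p js (kron B) (ext_basis {}) J = (\<Sum>ls | length ls = length js \<and> distinct ls \<and> set ls = J.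
     sg ls * monom (1::'k::field) (enc B n (\<lambda>r. \<Sum>i<length js. if ls ! i = r then p ^ (js ! i) else 0)))"
proof -
  have "finite J" using J finite_subset by blast
  have "(\<Prod>i<length (map (\<lambda>j i. kron B i ^ (p ^ j)) js). (map (\<lambda>j i. kron B i ^ (p ^ j)) js ! i) (ls ! i))
     = monom (1::'k) (enc B n (\<lambda>r. \<Sum>i<length js. if ls ! i = r then p ^ (js ! i) else 0))"
    if ls: "length ls = length js" "set ls = J" for ls
  proof -
    have "(\<Prod>i<length (map (\<lambda>j i. kron B i ^ (p ^ j)) js). (map (\<lambda>j i. kron B i ^ (p ^ j)) js ! i) (ls ! i))
        = (\<Prod>i<length js. monom (1::'k) (B ^ (ls ! i) * p ^ (js ! i)))"
      by (intro prod.cong) (simp_all add: kron_def monom_power mult.commute)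
    also have "\<dots> = monom 1 (\<Sum>i<length js. B ^ (ls ! i) * p ^ (js ! i))"
      by (rule prod_monom_1)
    also have "(\<Sum>i<length js. B ^ (ls ! i) * p ^ (js ! i)) = enc B n (\<lambda>r. \<Sum>i<length js. if ls ! i = r then p ^ (js ! i) else 0)"
    proof -
      have "enc B n (\<lambda>r. \<Sum>i<length js. if ls ! i = r then p ^ (js ! i) else 0)
          = (\<Sum>i<length js. \<Sum>r<n. if ls ! i = r then p ^ (js ! i) * B ^ r else 0)"
        unfolding enc_def sum_distrib_right by (subst sum.swap) (intro sum.cong refl, simp)
      also have "\<dots> = (\<Sum>i<length js. B ^ (ls ! i) * p ^ (js ! i))"
      proof (rule sum.cong[OF refl])
        fix i assume "i \<in> {..<length js}"
        then have "i < length ls" using ls by simp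
        then have "ls ! i \<in> set ls" by (rule nth_mem)
        then have "ls ! i < n" using ls J by auto
        then show "(\<Sum>r<n. if ls ! i = r then p ^ (js ! i) * B ^ r else 0) = B ^ (ls ! i) * p ^ (js ! i)"
          by simp
      qed
      finally show ?thesis ..
    qed
    finally show ?thesis .
  qed
  then show ?thesis unfolding sg[OF \<open>finite J\<close>] length_map by (intro sum.cong refl) simp
qed

text \<open>The value is a sum of signed monomials indexed by a monomial of the form together with a
  Leibniz term. By \<open>key_lexless\<close> the diagonal term of the leading monomial is the
  unique largest, so it cannot cancel.\<close>

theorem lead_form:
  fixes \<phi> :: "nat set \<Rightarrow> nat list \<Rightarrow> 'k::field"
  assumes p: "p \<ge> 2" and js: "distinct js" "set js = J" "J \<subseteq> {..<n}"
    and t: "t \<in> expos n d" "\<phi> J t \<noteq> 0"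
    and max: "\<And>I s. I \<subseteq> {..<n} \<Longrightarrow> s \<in> expos n d \<Longrightarrow> \<phi> I s \<noteq> 0 \<Longrightarrow>
       (I, s) = (J, t) \<or> lexless n (mon_key p I s) (mon_key p J t)"
  shows "lead n (\<lambda>X. form n d \<phi> X (frob_wedge p js X (ext_basis {}))) (\<lambda>r. t ! r + (if r \<in> J then p ^ r else 0))"
proof -
  obtain sg :: "nat list \<Rightarrow> 'k poly" where sg1: "\<And>ls. sg ls = 1 \<or> sg ls = -1"
    and sg: "\<And>ws J. finite J \<Longrightarrow> wedges ws J = (\<Sum>ls | length ls = length ws \<and> distinct ls \<and> set ls = J.
         sg ls * (\<Prod>i<length ws. (ws ! i) (ls ! i)))"
    using wedges_leibniz[where 'r="'k poly"] by blast
  let ?k = "length js"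
  let ?\<mu> = "\<lambda>ls r. \<Sum>i<?k. if ls ! i = r then p ^ (js ! i) else 0"
  let ?L = "\<lambda>I. {ls. length ls = ?k \<and> distinct ls \<and> set ls = I}"
  have finL: "finite (?L I)" if "I \<subseteq> {..<n}" for I
    by (rule finite_subset[of _ "{ls. set ls \<subseteq> {..<n} \<and> length ls = ?k}"]) (use that in \<open>auto simp: finite_lists_length_eq\<close>)
  let ?A = "Sigma (Pow {..<n}) (\<lambda>I. expos n d \<times> ?L I)"
  let ?g = "\<lambda>B (I, s, ls). [:\<phi> I s:] * sg ls * monom 1 (enc B n (\<lambda>r. s ! r + ?\<mu> ls r))"
  have finA: "finite ?A" using finL by (intro finite_SigmaI finite_cartesian_product) auto
  have mu_js: "?\<mu> js r = (if r \<in> J then p ^ r else 0)" for r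
  proof (cases "r \<in> J")
    case True
    then obtain i where i: "i < ?k" "js ! i = r" using js by (metis in_set_conv_nth)
    have "?\<mu> js r = (\<Sum>i'<?k. if i' = i then p ^ (js ! i') else 0)"
      using js i by (intro sum.cong refl) (auto simp: nth_eq_iff_index_eq)
    then show ?thesis using True i by simp
  next
    case False
    have "?\<mu> js r = 0"
    proof (intro sum.neutral ballI)
      fix i assume "i \<in> {..<?k}"
      then have "js ! i \<in> J" using js by auto
      then show "(if js ! i = r then p ^ (js ! i) else 0) = 0" using False by auto
    qed
    then show ?thesis using False by simp
  qed
  have g: "?g B (I, s, ls) \<noteq> 0 \<and> degree (?g B (I, s, ls)) = enc B n (\<lambda>r. s ! r + ?\<mu> ls r)" if "\<phi> I s \<noteq> 0" for B I s ls
  proof -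
    let ?e = "enc B n (\<lambda>r. s ! r + ?\<mu> ls r)"
    define M where "M = monom (\<phi> I s) ?e"
    have M: "M \<noteq> 0" "degree M = ?e" using that by (simp_all add: M_def degree_monom_eq)
    have "?g B (I, s, ls) = M \<or> ?g B (I, s, ls) = - M"
      using sg1[of ls] by (auto simp: M_def smult_monom)
    then show ?thesis
      by (rule disjE) (simp_all only: M degree_minus neg_equal_0_iff_equal simp_thms not_False_eq_True)
  qed
  show ?thesis unfolding lead_def
  \<comment> \<open>No exponent in any term exceeds \<open>d\<close> plus the sum of all
    twists.\<close>
  proof (intro exI[of _ "Suc (d + (\<Sum>i<?k. p ^ (js ! i)))"] allI impI)
    fix B assume B: "Suc (d + (\<Sum>i<?k. p ^ (js ! i))) \<le> B"
    have "form n d \<phi> (kron B) (frob_wedge p js (kron B) (ext_basis {}))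
       = (\<Sum>I\<in>Pow {..<n}. \<Sum>s\<in>expos n d. \<Sum>ls\<in>?L I. ?g B (I, s, ls))"
      unfolding form_alt
    proof (intro sum.cong refl)
      fix I s assume I: "I \<in> Pow {..<n}"
      then have "I \<subseteq> {..<n}" by simp
      then have w: "frob_wedge p js (kron B) (ext_basis {}) I = (\<Sum>ls\<in>?L I. sg ls * monom (1::'k) (enc B n (?\<mu> ls)))"
        by (intro wedges_frob_kron sg)
      show "frob_wedge p js (kron B) (ext_basis {}) I * mono_val n (kron B) s * [:\<phi> I s:] = (\<Sum>ls\<in>?L I. ?g B (I, s, ls))"
        unfolding w mono_val_kron sum_distrib_right
      proof (intro sum.cong refl)
        fix ls
        have "enc B n (\<lambda>r. s ! r + ?\<mu> ls r) = enc B n (?\<mu> ls) + enc B n ((!) s)"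
          by (simp add: enc_def distrib_right sum.distrib)
        then have "monom (1::'k) (enc B n (\<lambda>r. s ! r + ?\<mu> ls r)) = monom 1 (enc B n (?\<mu> ls)) * monom 1 (enc B n ((!) s))"
          by (simp add: mult_monom)
        then show "sg ls * monom 1 (enc B n (?\<mu> ls)) * monom 1 (enc B n ((!) s)) * [:\<phi> I s:] = ?g B (I, s, ls)"
          by (simp only: prod.case mult_ac)
      qed
    qed
    also have "\<dots> = (\<Sum>I\<in>Pow {..<n}. \<Sum>(s, ls)\<in>expos n d \<times> ?L I. [:\<phi> I s:] * sg ls * monom 1 (enc B n (\<lambda>r. s ! r + ?\<mu> ls r)))"
      unfolding sum.cartesian_product prod.case ..
    also have "\<dots> = (\<Sum>x\<in>?A. ?g B x)"
      by (rule sum.Sigma) (simp, intro ballI finite_cartesian_product finite_expos finL, simp)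
    finally have form: "form n d \<phi> (kron B) (frob_wedge p js (kron B) (ext_basis {})) = (\<Sum>x\<in>?A. ?g B x)" .
    have "(\<Sum>x\<in>?A. ?g B x) \<noteq> 0 \<and> degree (\<Sum>x\<in>?A. ?g B x) = degree (?g B (J, t, js))"
    proof (rule degree_sum_unique_max[OF finA])
      show "(J, t, js) \<in> ?A" using js t by simp
      show "?g B (J, t, js) \<noteq> 0" using g[OF t(2)] by blast
      fix x assume x: "x \<in> ?A" "x \<noteq> (J, t, js)"
      obtain I s ls where xe: "x = (I, s, ls)" by (cases x) auto
      have x': "I \<subseteq> {..<n}" "s \<in> expos n d" "length ls = ?k" "distinct ls" "set ls = I" using x unfolding xe by simp_all
      show "?g B x = 0 \<or> degree (?g B x) < degree (?g B (J, t, js))"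
      proof (cases "\<phi> I s = 0")
        case False
        have "length s = n" "length t = n" using x'(2) t(1) by (simp_all add: expos_def)
        moreover have "(I, s, ls) \<noteq> (J, t, js)" using x(2) xe by simp
        ultimately have "lexless n (\<lambda>r. s ! r + ?\<mu> ls r) (\<lambda>r. t ! r + (if r \<in> J then p ^ r else 0))"
          by (intro key_lexless[OF p js x'(4,5,1,3)] max[OF x'(1,2) False])
        moreover have "s ! r + ?\<mu> ls r < B" if "r < n" for r
        proof -
          have "s ! r \<le> d" using expos_nth_le[OF x'(2) that] .
          moreover have "?\<mu> ls r \<le> (\<Sum>i<?k. p ^ (js ! i))" by (rule sum_mono) simp
          ultimately show ?thesis using B by linarith
        qed
        ultimately have "enc B n (\<lambda>r. s ! r + ?\<mu> ls r) < enc B n (\<lambda>r. t ! r + ?\<mu> js r)"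
          unfolding mu_js by (rule enc_lexless)
        then show ?thesis unfolding xe conjunct2[OF g[OF False]] conjunct2[OF g[OF t(2)]] by (rule disjI2)
      qed (simp add: xe)
    qed
    then show "form n d \<phi> (kron B) (frob_wedge p js (kron B) (ext_basis {})) \<noteq> 0 \<and>
        degree (form n d \<phi> (kron B) (frob_wedge p js (kron B) (ext_basis {}))) = enc B n (\<lambda>r. t ! r + (if r \<in> J then p ^ r else 0))"
      unfolding form conjunct2[OF g[OF t(2)]] mu_js .
  qed
qed

section \<open>The leading monomial of an invariant functional\<close>

lemma wedges_cong_vec:
  assumes "finite J" "list_all2 (\<lambda>v w. \<forall>j\<in>J. v j = w j) vs ws" "\<And>I. I \<subseteq> J \<Longrightarrow> D I = E I"
  shows "foldr wedge vs D J = foldr wedge ws E J"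
  using assms
proof (induction vs arbitrary: ws J)
  case Nil then show ?case by simp
next
  case (Cons v vs)
  obtain w ws' where ws: "ws = w # ws'" and vw: "\<And>j. j \<in> J \<Longrightarrow> v j = w j"
    and l: "list_all2 (\<lambda>v w. \<forall>j\<in>J. v j = w j) vs ws'"
    using Cons.prems(2) by (auto simp: list_all2_Cons1)
  have "foldr wedge vs D (J - {j}) = foldr wedge ws' E (J - {j})" for j
  proof (rule Cons.IH)
    show "finite (J - {j})" using Cons.prems(1) by simp
    show "list_all2 (\<lambda>v w. \<forall>k\<in>J - {j}. v k = w k) vs ws'" using l by (rule list_all2_mono) blast
    fix I assume "I \<subseteq> J - {j}"
    then show "D I = E I" by (intro Cons.prems(3)) blast
  qed
  then show ?case unfolding ws wedges_Cons using vw by (intro sum.cong refl) simp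
qed

lemma frob_wedge_cong:
  assumes "finite J" "\<And>i. i \<in> J \<Longrightarrow> X i = Y i" "\<And>I. I \<subseteq> J \<Longrightarrow> D I = E I"
  shows "frob_wedge p js X D J = frob_wedge p js Y E J"
  by (rule wedges_cong_vec[OF assms(1) _ assms(3)]) (simp_all add: list_all2_map1 list_all2_map2 list_all2_same assms(2))

section \<open>Equivariance of the Frobenius twists\<close>

lemma power_card_pow: "(a :: 'p::prime_card mod_ring) ^ (CARD('p) ^ e) = a"
proof -
  have p2: "CARD('p) \<ge> 2" using prime_card[where 'a='p] prime_ge_2_nat by blast
  have fermat: "b ^ CARD('p) = b" for b :: "'p mod_ring"
  proof (cases "b = 0")
    case False
    have "b * b ^ (CARD('p) - 2) = 1"
      using right_inverse[OF False] False p2 by (simp add: inverse_mod_ring_def nat_diff_distrib)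
    moreover have "CARD('p) = Suc (Suc (CARD('p) - 2))" using p2 by simp
    ultimately show ?thesis by (metis mult.assoc mult_1_right power_Suc power_Suc2)
  qed (use p2 in \<open>simp add: power_0_left\<close>)
  show ?thesis
  proof (induction e)
    case (Suc e)
    have "a ^ CARD('p) ^ Suc e = (a ^ CARD('p) ^ e) ^ CARD('p)" by (simp only: power_Suc2 power_mult)
    then show ?case by (simp only: Suc fermat)
  qed simp
qed

text \<open>Taking powers of the characteristic is additive and fixes the entries of
  \<open>G\<close>, which lie in the prime field.\<close>

lemma frobenius_mat_app:
  fixes G :: "nat \<Rightarrow> nat \<Rightarrow> 'p::prime_card mod_ring"
  shows "mat_app (lift_mat G) n X j ^ (CARD('p) ^ e) = mat_app (lift_mat G) n (\<lambda>i. X i ^ (CARD('p) ^ e)) j"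
proof -
  have char: "CHAR('p mod_ring poly) = CARD('p)" by simp
  have "(\<Sum>s<n. lift_mat G j s * X s) ^ (CARD('p) ^ e) = (\<Sum>s<n. (lift_mat G j s * X s) ^ (CARD('p) ^ e))"
    by (rule freshmans_dream_sum') (simp_all add: char prime_card)
  also have "\<dots> = (\<Sum>s<n. lift_mat G j s * X s ^ (CARD('p) ^ e))"
  proof (rule sum.cong[OF refl])
    fix s
    have "lift_mat G j s ^ (CARD('p) ^ e) = lift_mat G j s"
      unfolding lift_mat_def coeff_lift_hom.hom_power[symmetric] power_card_pow ..
    then show "(lift_mat G j s * X s) ^ (CARD('p) ^ e) = lift_mat G j s * X s ^ (CARD('p) ^ e)"
      by (simp only: power_mult_distrib)
  qed
  finally show ?thesis unfolding mat_app_def .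
qed

lemma ext_map_frob_wedge:
  fixes G :: "nat \<Rightarrow> nat \<Rightarrow> 'p::prime_card mod_ring"
  assumes "finite I"
  shows "ext_map (lift_mat G) n (frob_wedge CARD('p) js X D) I
       = frob_wedge CARD('p) js (mat_app (lift_mat G) n X) (ext_map (lift_mat G) n D) I"
proof -
  have "map (mat_app (lift_mat G) n) (map (\<lambda>j i. X i ^ (CARD('p) ^ j)) js)
      = map (\<lambda>j i. mat_app (lift_mat G) n X i ^ (CARD('p) ^ j)) js"
    unfolding map_map by (intro map_cong refl) (simp add: fun_eq_iff frobenius_mat_app)
  then show ?thesis unfolding ext_map_wedges[OF assms] by (simp only:)
qed

lemma ext_map_frob_wedge_empty:
  fixes G :: "nat \<Rightarrow> nat \<Rightarrow> 'p::prime_card mod_ring"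
  assumes "finite I"
  shows "ext_map (lift_mat G) n (frob_wedge CARD('p) js X (ext_basis {})) I
       = frob_wedge CARD('p) js (mat_app (lift_mat G) n X) (ext_basis {}) I"
  unfolding ext_map_frob_wedge[OF assms]
proof (rule frob_wedge_cong[OF assms refl])
  fix K assume "K \<subseteq> I"
  then have "finite K" using assms finite_subset by blast
  then show "ext_map (lift_mat G) n (ext_basis {}) K = ext_basis {} K" by (rule ext_map_empty)
qed

definition frob_form :: "nat \<Rightarrow> nat \<Rightarrow> (nat set \<Rightarrow> nat list \<Rightarrow> 'p::prime_card mod_ring) \<Rightarrow> nat list \<Rightarrow> (nat \<Rightarrow> 'p mod_ring poly) \<Rightarrow> 'p mod_ring poly" where
  "frob_form n d \<phi> js X = form n d \<phi> X (frob_wedge CARD('p) js X (ext_basis {}))"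

lemma frob_form_invariant:
  assumes "act_inv n d \<phi> G"
  shows "frob_form n d \<phi> js (mat_app (lift_mat G) n X) = frob_form n d \<phi> js X"
proof -
  let ?F = "\<lambda>X. frob_wedge CARD('a) js X (ext_basis {})"
  have "form n d \<phi> (mat_app (lift_mat G) n X) (?F (mat_app (lift_mat G) n X))
      = form n d \<phi> (mat_app (lift_mat G) n X) (ext_map (lift_mat G) n (?F X))"
  proof (rule form_cong)
    fix J :: "nat set" assume "J \<subseteq> {..<n}"
    then have "finite J" using finite_subset by blast
    then show "?F (mat_app (lift_mat G) n X) J = ext_map (lift_mat G) n (?F X) J"
      by (rule ext_map_frob_wedge_empty[symmetric])
  qed
  then show ?thesis unfolding frob_form_def form_invariant[OF assms] .
qed

lemma form_cong_point: "(\<And>i. i < n \<Longrightarrow> X i = Y i) \<Longrightarrow> form n d \<phi> X D = form n d \<phi> Y D"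
  unfolding form_def using hev_cong[of n X Y] by (intro sum.cong refl) simp

lemma frob_form_cong:
  assumes "\<And>i. i < n \<Longrightarrow> X i = Y i"
  shows "frob_form n d \<phi> js X = frob_form n d \<phi> js Y"
proof -
  have "frob_form n d \<phi> js X = form n d \<phi> Y (frob_wedge CARD('a) js X (ext_basis {}))"
    unfolding frob_form_def by (rule form_cong_point) fact
  also have "\<dots> = frob_form n d \<phi> js Y"
    unfolding frob_form_def
  proof (rule form_cong)
    fix J :: "nat set" assume J: "J \<subseteq> {..<n}"
    then have "finite J" using finite_subset by blast
    then show "frob_wedge CARD('a) js X (ext_basis {}) J = frob_wedge CARD('a) js Y (ext_basis {}) J"
      by (rule frob_wedge_cong) (use J assms in auto)
  qed
  finally show ?thesis .
qed

lemma hpoly_frob_wedge: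
  assumes "J \<subseteq> {..<n}" "\<And>I. I \<subseteq> J \<Longrightarrow> hpoly n e (\<lambda>X. D X I)"
  shows "hpoly n (sum_list (map ((^) p) js) + e) (\<lambda>X. frob_wedge p js X (D X) J)"
  using assms
proof (induction js arbitrary: J)
  case (Cons c js)
  have fin: "finite J" using Cons.prems(1) finite_subset by blast
  have "hpoly n (sum_list (map ((^) p) (c # js)) + e)
     (\<lambda>X. \<Sum>j\<in>J. X j ^ (p ^ c) * (-1) ^ card {l\<in>J. l < j} * frob_wedge p js X (D X) (J - {j}))"
  proof (rule hpoly_sum[OF fin])
    fix j assume j: "j \<in> J"
    have 1: "hpoly n (sum_list (map ((^) p) js) + e) (\<lambda>X. frob_wedge p js X (D X) (J - {j}))"
      by (rule Cons.IH) (use Cons.prems in auto)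
    have 2: "hpoly n (p ^ c * 1) (\<lambda>X. X j ^ (p ^ c))"
      by (rule hpoly_power[OF hpoly_var]) (use j Cons.prems in auto)
    have "hpoly n (p ^ c * 1 + (sum_list (map ((^) p) js) + e))
       (\<lambda>X. X j ^ (p ^ c) * ((-1) ^ card {l\<in>J. l < j} * frob_wedge p js X (D X) (J - {j})))"
      by (rule hpoly_mult[OF 2 hpoly_sign[OF 1]])
    then show "hpoly n (sum_list (map ((^) p) (c # js)) + e)
       (\<lambda>X. X j ^ (p ^ c) * (-1) ^ card {l\<in>J. l < j} * frob_wedge p js X (D X) (J - {j}))"
      by (simp add: mult.assoc add.assoc)
  qed
  then show ?case unfolding list.map wedges_Cons .
qed simp

lemma hpoly_frob_form: "hpoly n (d + sum_list (map ((^) CARD('p)) js)) (frob_form n d (\<phi> :: nat set \<Rightarrow> nat list \<Rightarrow> 'p::prime_card mod_ring) js)"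
proof -
  have "hpoly n (d + sum_list (map ((^) CARD('p)) js)) (\<lambda>X. \<Sum>J\<in>Pow {..<n}. hev n d (\<phi> J) X * frob_wedge CARD('p) js X (ext_basis {}) J)"
  proof (rule hpoly_sum)
    fix J assume J: "J \<in> Pow {..<n}"
    have "hpoly n 0 (\<lambda>X :: nat \<Rightarrow> 'p mod_ring poly. ext_basis {} I :: 'p mod_ring poly)" for I
      using hpoly_const[of n "of_bool (I = {}) :: 'p mod_ring"] by (cases "I = {}") (simp_all add: ext_basis_def one_pCons[symmetric])
    then have "hpoly n (sum_list (map ((^) CARD('p)) js) + 0) (\<lambda>X :: nat \<Rightarrow> 'p mod_ring poly. frob_wedge CARD('p) js X (ext_basis {}) J)"
      using J by (intro hpoly_frob_wedge) auto
    then show "hpoly n (d + sum_list (map ((^) CARD('p)) js)) (\<lambda>X. hev n d (\<phi> J) X * frob_wedge CARD('p) js X (ext_basis {}) J)"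
      using hpoly_mult[OF hpoly_hev] by simp
  qed simp
  then show ?thesis unfolding frob_form_def form_def .
qed

section \<open>Transvections and scalings in the general linear group\<close>

lemma transvection_GL:
  assumes "r < n" "i < n" "i \<noteq> r"
  shows "addrow_mat n a r i \<in> GL n"
proof -
  have "invertible_mat (addrow_mat n a r i)"
    unfolding invertible_mat_def
  proof
    show "square_mat (addrow_mat n a r i)" by simp
    have "inverts_mat (addrow_mat n a r i) (addrow_mat n (- a) r i)" "inverts_mat (addrow_mat n (- a) r i) (addrow_mat n a r i)"
      using addrow_mat_inv[of r n i a] addrow_mat_inv[of r n i "- a"] assms by (simp_all add: inverts_mat_def)
    then show "\<exists>B. inverts_mat (addrow_mat n a r i) B \<and> inverts_mat B (addrow_mat n a r i)" by blast
  qed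
  then show ?thesis by (simp add: GL_def)
qed

lemma transvection_app:
  assumes "r < n" "i < n" "i \<noteq> r" "j < n"
  shows "mat_app (lift_mat (mat_fun (addrow_mat n a r i))) n X j = (X(r := X r + [:a:] * X i)) j"
proof -
  have "mat_app (lift_mat (mat_fun (addrow_mat n a r i))) n X j
      = (\<Sum>s<n. (if s = j then X j else 0) + (if s = i then (if j = r then [:a:] * X i else 0) else 0))"
    unfolding mat_app_def
    by (rule sum.cong) (use assms in \<open>auto simp: lift_mat_def mat_fun_def one_pCons[symmetric]\<close>)
  also have "\<dots> = X j + (if j = r then [:a:] * X i else 0)"
    using assms by (simp add: sum.distrib)
  finally show ?thesis by simp
qed

lemma scaling_GL:
  assumes "r < n" "a \<noteq> (0 :: 'k::field)"
  shows "multrow_mat n r a \<in> GL n"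
proof -
  have "invertible_mat (multrow_mat n r a)"
    unfolding invertible_mat_def
  proof
    show "square_mat (multrow_mat n r a)" by simp
    have "inverts_mat (multrow_mat n r a) (multrow_mat n r (inverse a))" "inverts_mat (multrow_mat n r (inverse a)) (multrow_mat n r a)"
      using multrow_mat_inv[of r n a] multrow_mat_inv[of r n "inverse a"] assms by (simp_all add: inverts_mat_def)
    then show "\<exists>B. inverts_mat (multrow_mat n r a) B \<and> inverts_mat B (multrow_mat n r a)" by blast
  qed
  then show ?thesis by (simp add: GL_def)
qed

lemma scaling_app:
  assumes "r < n" "j < n"
  shows "mat_app (lift_mat (mat_fun (multrow_mat n r a))) n X j = (X(r := [:a:] * X r)) j"
proof -
  have "mat_app (lift_mat (mat_fun (multrow_mat n r a))) n X j
      = (\<Sum>s<n. if s = j then (if j = r then [:a:] else 1) * X j else 0)"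
    unfolding mat_app_def
    by (rule sum.cong) (use assms in \<open>auto simp: lift_mat_def mat_fun_def one_pCons[symmetric]\<close>)
  then show ?thesis using assms by simp
qed

lemma wedge_add_vec: "wedge (\<lambda>i. u i + v i) D J = wedge u D J + wedge v D J"
  by (simp add: wedge_def distrib_right sum.distrib)

lemma wedge_unit_sum:
  assumes "J \<subseteq> {..<n}"
  shows "wedge w D J = (\<Sum>j<n. w j * wedge (\<lambda>i. of_bool (i = j)) D J)"
proof -
  have fin: "finite J" using assms finite_subset by blast
  have "wedge (\<lambda>i. of_bool (i = j)) D J = (if j \<in> J then (-1) ^ card {l\<in>J. l < j} * D (J - {j}) else 0)" for j
  proof -
    have "wedge (\<lambda>i. of_bool (i = j)) D J = (\<Sum>i\<in>J. if i = j then (-1) ^ card {l\<in>J. l < j} * D (J - {j}) else 0)"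
      unfolding wedge_def by (rule sum.cong) auto
    then show ?thesis using fin by simp
  qed
  then have "(\<Sum>j<n. w j * wedge (\<lambda>i. of_bool (i = j)) D J) = (\<Sum>j<n. if j \<in> J then w j * ((-1) ^ card {l\<in>J. l < j} * D (J - {j})) else 0)"
    by (intro sum.cong refl) simp
  also have "\<dots> = (\<Sum>j\<in>J. w j * ((-1) ^ card {l\<in>J. l < j} * D (J - {j})))"
    by (rule sum.mono_neutral_cong_right) (use assms in auto)
  finally show ?thesis by (simp add: wedge_def mult.assoc)
qed

text \<open>On the hyperplane \<open>X\<^sub>0 = 0\<close> the transvections adding the first coordinate fix the point.\<close>

lemma frob_form_vanishes:
  fixes \<phi> :: "nat set \<Rightarrow> nat list \<Rightarrow> 'p::prime_card mod_ring"
  assumes inv: "\<And>g. g \<in> GL n \<Longrightarrow> act_inv n d \<phi> (mat_fun g)" and Y0: "Y 0 = 0"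
  shows "frob_form n d \<phi> (j1 # js) Y = 0"
proof -
  let ?D = "frob_wedge CARD('p) js Y (ext_basis {})"
  let ?u = "\<lambda>j i. of_bool (i = j) :: 'p mod_ring poly"
  have van: "form n d \<phi> Y (wedge (?u j) ?D) = 0" if j: "j < n" "j \<noteq> 0" for j
  proof -
    let ?g = "addrow_mat n (1 :: 'p mod_ring) j 0"
    let ?G = "lift_mat (mat_fun ?g)"
    have g: "?g \<in> GL n" using j by (intro transvection_GL) auto
    have app: "mat_app ?G n X i = (X(j := X j + X 0)) i" if "i < n" for X i
      using transvection_app[of j n 0 i 1 X] that j by (simp add: one_pCons[symmetric])
    have Y: "mat_app ?G n Y i = Y i" if "i < n" for i using app[OF that, of Y] Y0 by simp
    have u: "mat_app ?G n (?u 0) i = ?u 0 i + ?u j i" if "i < n" for i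
      using app[OF that, of "?u 0"] j by auto
    \<comment> \<open>The transvection fixes \<open>Y\<close> and hence its twists, and it sends
      \<open>?u 0\<close> to \<open>?u 0 + ?u j\<close>; invariance therefore forces the
      contribution of \<open>?u j\<close> to be zero.\<close>
    have "form n d \<phi> Y (wedge (?u 0) ?D) = form n d \<phi> (mat_app ?G n Y) (ext_map ?G n (wedge (?u 0) ?D))"
      by (rule form_invariant[symmetric]) (rule inv[OF g])
    also have "\<dots> = form n d \<phi> Y (ext_map ?G n (wedge (?u 0) ?D))"
      by (rule form_cong_point) (rule Y)
    also have "\<dots> = form n d \<phi> Y (\<lambda>J. wedge (?u 0) ?D J + wedge (?u j) ?D J)"
    proof (rule form_cong)
      fix J :: "nat set" assume J: "J \<subseteq> {..<n}"
      then have fin: "finite J" using finite_subset by blast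
      have "ext_map ?G n (wedge (?u 0) ?D) J = wedge (mat_app ?G n (?u 0)) (ext_map ?G n ?D) J"
        by (rule ext_map_wedge[OF fin])
      also have "\<dots> = wedge (\<lambda>i. ?u 0 i + ?u j i) ?D J"
      proof (rule wedge_cong)
        fix i assume i: "i \<in> J"
        then show "mat_app ?G n (?u 0) i = ?u 0 i + ?u j i" using J by (intro u) auto
        have "ext_map ?G n ?D (J - {i}) = frob_wedge CARD('p) js (mat_app ?G n Y) (ext_basis {}) (J - {i})"
          using fin by (intro ext_map_frob_wedge_empty) simp
        also have "\<dots> = ?D (J - {i})"
          by (rule frob_wedge_cong) (use fin J Y in auto)
        finally show "ext_map ?G n ?D (J - {i}) = ?D (J - {i})" .
      qed
      finally show "ext_map ?G n (wedge (?u 0) ?D) J = wedge (?u 0) ?D J + wedge (?u j) ?D J"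
        unfolding wedge_add_vec .
    qed
    finally show ?thesis unfolding form_add by simp
  qed
  \<comment> \<open>The twist \<open>j1\<close> of \<open>Y\<close> has no component along
    \<open>?u 0\<close>, so it is a combination of unit vectors on which the form was just shown to
    vanish.\<close>
  have "frob_form n d \<phi> (j1 # js) Y = form n d \<phi> Y (\<lambda>J. \<Sum>j<n. Y j ^ (CARD('p) ^ j1) * wedge (?u j) ?D J)"
    unfolding frob_form_def
  proof (rule form_cong)
    fix J :: "nat set" assume J: "J \<subseteq> {..<n}"
    have "frob_wedge CARD('p) (j1 # js) Y (ext_basis {}) J = wedge (\<lambda>i. Y i ^ (CARD('p) ^ j1)) ?D J"
      by (simp only: list.map foldr.simps comp_def)
    also have "\<dots> = (\<Sum>j<n. Y j ^ (CARD('p) ^ j1) * wedge (?u j) ?D J)" by (rule wedge_unit_sum[OF J])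
    finally show "frob_wedge CARD('p) (j1 # js) Y (ext_basis {}) J = (\<Sum>j<n. Y j ^ (CARD('p) ^ j1) * wedge (?u j) ?D J)" .
  qed
  also have "\<dots> = (\<Sum>j<n. Y j ^ (CARD('p) ^ j1) * form n d \<phi> Y (wedge (?u j) ?D))"
    by (rule form_sum)
  also have "\<dots> = 0"
  proof (intro sum.neutral ballI)
    fix j assume "j \<in> {..<n}"
    then show "Y j ^ (CARD('p) ^ j1) * form n d \<phi> Y (wedge (?u j) ?D) = 0"
      using van[of j] Y0 by (cases "j = 0") (simp_all add: power_0_left)
  qed
  finally show ?thesis .
qed

text \<open>Otherwise, with the remainder \<open>m mod ?q\<close> positive and below
  \<open>?q\<close>, all \<open>?q\<close> nonzero elements would be roots of a nonzero polynomial
  of smaller degree.\<close>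

lemma power_one_dvd:
  fixes m :: nat
  assumes "\<And>a :: 'p::prime_card mod_ring. a \<noteq> 0 \<Longrightarrow> a ^ m = 1"
  shows "(CARD('p) - 1) dvd m"
proof (rule ccontr)
  let ?q = "CARD('p) - 1"
  assume "\<not> ?q dvd m"
  then have k: "m mod ?q > 0" by (simp add: dvd_eq_mod_eq_0)
  have "CARD('p) \<ge> 2" using prime_card[where 'a='p] prime_ge_2_nat by blast
  then have q: "?q > 0" by simp
  then have kq: "m mod ?q < ?q" by simp
  let ?P = "monom (1 :: 'p mod_ring) (m mod ?q) - 1"
  have cP: "coeff ?P (m mod ?q) = 1" using k by (simp add: coeff_1 )
  then have P0: "?P \<noteq> 0" by (metis coeff_0 zero_neq_one)
  have "a ^ (m mod ?q) = 1" if "a \<noteq> 0" for a :: "'p mod_ring"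
  proof -
    have "a * a ^ ?q = a * 1" using power_card_pow[of a 1] power_Suc[of a ?q] \<open>CARD('p) \<ge> 2\<close> by simp
    then have 1: "a ^ ?q = 1" using that mult_left_cancel[OF that] by blast
    have "a ^ m = (a ^ ?q) ^ (m div ?q) * a ^ (m mod ?q)"
      by (simp only: power_mult[symmetric] power_add[symmetric] mult_div_mod_eq)
    then show ?thesis using assms[OF that] 1 by simp
  qed
  then have "UNIV - {0} \<subseteq> {a :: 'p mod_ring. poly ?P a = 0}" by (auto simp: poly_monom)
  then have "card (UNIV - {0 :: 'p mod_ring}) \<le> card {a :: 'p mod_ring. poly ?P a = 0}"
    by (rule card_mono[rotated]) simp
  also have "\<dots> \<le> degree ?P" by (rule card_poly_roots_bound[OF P0])
  also have "\<dots> \<le> m mod ?q" by (rule degree_diff_le) (simp_all add: degree_monom_le)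
  finally have "CARD('p) - 1 \<le> m mod ?q" by (simp add: card_Diff_singleton)
  then show False using kq by simp
qed

theorem invariant_leading:
  fixes \<phi> :: "nat set \<Rightarrow> nat list \<Rightarrow> 'p::prime_card mod_ring"
  assumes inv: "\<And>g. g \<in> GL n \<Longrightarrow> act_inv n d \<phi> (mat_fun g)"
    and J: "J \<subseteq> {..<n}" and t: "t \<in> expos n d" "\<phi> J t \<noteq> 0"
    and max: "\<And>I s. I \<subseteq> {..<n} \<Longrightarrow> s \<in> expos n d \<Longrightarrow> \<phi> I s \<noteq> 0 \<Longrightarrow>
       (I, s) = (J, t) \<or> lexless n (mon_key CARD('p) I s) (mon_key CARD('p) J t)"
  defines "T \<equiv> \<lambda>r. t ! r + (if r \<in> J then CARD('p) ^ r else 0)"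
  shows "\<And>r. r < n \<Longrightarrow> CARD('p) ^ r * (CARD('p) - 1) dvd T r"
    and "\<And>r. Suc r < n \<Longrightarrow> CARD('p) * T r \<le> T (Suc r)"
    and "J \<noteq> {} \<Longrightarrow> T 0 > 0"
proof -
  have p2: "CARD('p) \<ge> 2" using prime_card[where 'a='p] prime_ge_2_nat by blast
  have fJ: "finite J" using J finite_subset by blast
  define js where "js = sorted_list_of_set J"
  have js: "distinct js" "set js = J" using fJ by (simp_all add: js_def)
  let ?N = "frob_form n d \<phi> js"
  obtain c where c: "\<And>X. ?N X = hev n (d + sum_list (map ((^) CARD('p)) js)) c X"
    using hpoly_frob_form[of n d js \<phi>] unfolding hpoly_def by blast
  define e where "e = d + sum_list (map ((^) CARD('p)) js)"
  have c: "?N X = hev n e c X" for X unfolding e_def by (rule c)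
  have "lead n ?N T"
    unfolding T_def frob_form_def
  proof (rule lead_form)
    fix I s assume "I \<subseteq> {..<n}" "s \<in> expos n d" "\<phi> I s \<noteq> 0"
    then show "(I, s) = (J, t) \<or> lexless n (mon_key CARD('p) I s) (mon_key CARD('p) J t)" by (rule max)
  qed (fact p2 js J t)+
  then have "lead n (hev n e c) T" unfolding lead_def c .
  then obtain t0 where t0: "t0 \<in> expos n e" "c t0 \<noteq> 0" "\<And>i. i < n \<Longrightarrow> t0 ! i = T i"
    and less: "\<And>t. t \<in> expos n e \<Longrightarrow> c t \<noteq> 0 \<Longrightarrow> t \<noteq> t0 \<Longrightarrow> lexless n ((!) t) ((!) t0)"
    using lead_coeffs by blast
  have lead: "leading n e c t0" unfolding leading_def using t0(1,2) less by blast
  have Ninv: "?N (mat_app (lift_mat (mat_fun g)) n X) = ?N X" if "g \<in> GL n" for g X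
    by (rule frob_form_invariant[OF inv[OF that]])
  have tr: "transv_inv n (hev n e c)"
    unfolding transv_inv_def
  proof (intro allI impI)
    fix i r a X assume ir: "i < n" "r < n" "i \<noteq> r"
    have "?N (X(r := X r + [:a:] * X i)) = ?N (mat_app (lift_mat (mat_fun (addrow_mat n a r i))) n X)"
      by (rule frob_form_cong) (simp only: transvection_app[OF ir(2,1,3)])
    also have "\<dots> = ?N X" by (rule Ninv[OF transvection_GL[OF ir(2,1,3)]])
    finally show "hev n e c (X(r := X r + [:a:] * X i)) = hev n e c X" unfolding c .
  qed
  from leading_exponents[OF tr lead]
  have exps: "\<And>r. r < n \<Longrightarrow> CARD('p) ^ r dvd T r" "\<And>r. Suc r < n \<Longrightarrow> CARD('p) * T r \<le> T (Suc r)"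
    using t0(3) by auto
  show "CARD('p) * T r \<le> T (Suc r)" if "Suc r < n" for r using exps(2)[OF that] .
  show "CARD('p) ^ r * (CARD('p) - 1) dvd T r" if r: "r < n" for r
  proof -
    \<comment> \<open>Scaling coordinate \<open>r\<close> by \<open>a\<close> multiplies the leading
      coefficient by this power.\<close>
    have "a ^ (t0 ! r) = 1" if a: "a \<noteq> 0" for a :: "'p mod_ring"
    proof -
      have "hev n e (\<lambda>t. a ^ (t ! r) * c t) X = hev n e c X" for X
      proof -
        have mv: "mono_val n (X(r := [:a:] * X r)) t = [:a ^ (t ! r):] * mono_val n X t" for t
        proof -
          have "mono_val n (X(r := [:a:] * X r)) t = (\<Prod>i<n. (if i = r then [:a ^ (t ! r):] else 1) * X i ^ (t ! i))"
            unfolding mono_val_def 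
          proof (rule prod.cong[OF refl])
            fix i
            show "(X(r := [:a:] * X r)) i ^ (t ! i) = (if i = r then [:a ^ (t ! r):] else 1) * X i ^ (t ! i)"
              by (cases "i = r") (simp_all only: fun_upd_same fun_upd_other power_mult_distrib coeff_lift_hom.hom_power mult_1_left simp_thms if_True if_False)
          qed
          then show ?thesis using r unfolding mono_val_def prod.distrib by simp
        qed
        have "hev n e (\<lambda>t. a ^ (t ! r) * c t) X = hev n e c (X(r := [:a:] * X r))"
          unfolding hev_def mv const_poly_mult by (intro sum.cong refl) (simp only: mult_ac)
        also have "\<dots> = ?N (mat_app (lift_mat (mat_fun (multrow_mat n r a))) n X)"
          unfolding c[symmetric] by (rule frob_form_cong) (simp only: scaling_app[OF r])
        also have "\<dots> = hev n e c X" unfolding Ninv[OF scaling_GL[OF r a]] by (rule c)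
        finally show ?thesis .
      qed
      from hev_unique[OF this t0(1)] show ?thesis using t0(2) by simp
    qed
    then have "(CARD('p) - 1) dvd T r" using power_one_dvd t0(3)[OF r] by metis
    moreover have "coprime (CARD('p)) (CARD('p) - 1)" using p2 by (intro coprime_diff_one_right_nat) simp
    then have "coprime (CARD('p) ^ r) (CARD('p) - 1)" unfolding coprime_power_left_iff by blast
    ultimately show ?thesis using exps(1)[OF r] by (intro divides_mult)
  qed
  show "T 0 > 0" if Jne: "J \<noteq> {}"
  proof (rule ccontr)
    assume "\<not> T 0 > 0"
    moreover have "n > 0" using J Jne by auto
    ultimately have t00: "t0 ! 0 = 0" using t0(3)[of 0] by simp
    have "js \<noteq> []" using js(2) Jne by auto
    then obtain j1 js' where jse: "js = j1 # js'" by (cases js) simp_all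
    \<comment> \<open>Restriction to \<open>X 0 = 0\<close> keeps exactly the monomials without the
      first variable, the leading one among them; by \<open>frob_form_vanishes\<close> the
      restriction is zero.\<close>
    have "hev n e (\<lambda>t. if t ! 0 = 0 then c t else 0) X = hev n e (\<lambda>t. 0) X" for X
    proof -
      have mv: "mono_val n (X(0 := 0)) t = (if t ! 0 = 0 then mono_val n X t else 0)" for t
      proof (cases "t ! 0 = 0")
        case True
        then show ?thesis unfolding mono_val_def by (auto intro: prod.cong)
      next
        case False
        then have "(\<Prod>i<n. (X(0 := 0)) i ^ (t ! i)) = 0"
          using \<open>n > 0\<close> by (intro prod_zero bexI[of _ 0]) (simp_all add: power_0_left)
        then show ?thesis using False by (simp add: mono_val_def)
      qed
      have "hev n e (\<lambda>t. if t ! 0 = 0 then c t else 0) X = hev n e c (X(0 := 0))"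
        unfolding hev_def mv by (rule sum.cong) auto
      also have "\<dots> = ?N (X(0 := 0))" by (rule c[symmetric])
      also have "\<dots> = 0" unfolding jse by (rule frob_form_vanishes[OF inv]) simp_all
      finally show ?thesis by (simp add: hev_def)
    qed
    from hev_unique[OF this t0(1)] show False using t0(2) t00 by simp
  qed
qed

text \<open>The quotients \<open>k r\<close> are the partial sums i_0 + ... + i_r + b(I), so the
  entries of \<open>I\<close> are their differences. Then \<open>mono\<close> makes all entries
  after the first nonnegative, and \<open>pos\<close> gives the condition with m(I).\<close>

lemma basis_monomial_exists:
  assumes p: "p \<ge> 2" and n: "n \<ge> 1" and J: "J \<subseteq> {..<n}" and len: "length t = n"
  defines "T \<equiv> \<lambda>r. t ! r + (if r \<in> J then p ^ r else 0)"
  assumes dvd: "\<And>r. r < n \<Longrightarrow> p ^ r * (p - 1) dvd T r"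
    and mono: "\<And>r. Suc r < n \<Longrightarrow> p * T r \<le> T (Suc r)" and pos: "J \<noteq> {} \<Longrightarrow> T 0 > 0"
  shows "\<exists>I\<in>admissible n. basis_monomial p I = hmon_of n J t"
proof -
  define k where "k r = T r div (p ^ r * (p - 1))" for r
  have T: "T r = p ^ r * (p - 1) * k r" if "r < n" for r
    using dvd[OF that] by (simp add: k_def)
  have k_mono: "k r \<le> k (Suc r)" if "Suc r < n" for r
  proof -
    have "p * (p ^ r * (p - 1) * k r) \<le> p ^ Suc r * (p - 1) * k (Suc r)"
      using mono[OF that] T[of r] T[of "Suc r"] that by simp
    then have "(p ^ Suc r * (p - 1)) * k r \<le> (p ^ Suc r * (p - 1)) * k (Suc r)" by (simp add: mult_ac)
    moreover have "p ^ Suc r * (p - 1) > 0" using p by simp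
    ultimately show ?thesis using mult_le_cancel1 by blast
  qed
  \<comment> \<open>The number b(I), which is \<open>card J\<close>, is contained in every partial
    sum; it is taken off the first entry.\<close>
  define I :: ind_seq where "I = map (\<lambda>s. (s \<in> J, if s = 0 then int (k 0) - int (card J) else int (k s) - int (k (s - 1)))) [0..<n]"
  have lenI: "length I = n" by (simp add: I_def)
  have nth: "I ! s = (s \<in> J, if s = 0 then int (k 0) - int (card J) else int (k s) - int (k (s - 1)))" if "s < n" for s
    using that by (simp add: I_def)
  have eps: "eps I s = of_bool (s \<in> J)" if "s < n" for s using nth[OF that] by (simp add: eps_def)
  have b: "b_ind I = int (card J)"
  proof -
    have "b_ind I = (\<Sum>s<n. of_bool (s \<in> J))" unfolding b_ind_def lenI by (rule sum.cong) (simp_all add: eps)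
    also have "\<dots> = int (card ({..<n} \<inter> J))" by simp
    also have "{..<n} \<inter> J = J" using J by auto
    finally show ?thesis .
  qed
  have psum: "(\<Sum>r\<le>s. snd (I ! r)) = int (k s) - int (card J)" if "s < n" for s
    using that
  proof (induction s)
    case 0 then show ?case using nth[of 0] by simp
  next
    case (Suc s) then show ?case using nth[of "Suc s"] by simp
  qed
  have "m_ind I \<le> int (k 0)"
    unfolding m_ind_def lenI
  proof (rule Max.boundedI)
    fix x assume "x \<in> eps I ` {..<n}"
    then obtain s where s: "s < n" "x = eps I s" by auto
    show "x \<le> int (k 0)"
    proof (cases "s \<in> J")
      case True
      then have "T 0 > 0" using pos by blast
      then have "k 0 > 0" using T[of 0] n by (cases "k 0 = 0") simp_all
      then show ?thesis using s eps[OF s(1)] True by simp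
    qed (use s eps[OF s(1)] in simp)
  qed (use n in \<open>auto simp: lessThan_empty_iff\<close>)
  moreover have "snd (I ! 0) + b_ind I = int (k 0)" using nth[of 0] n b by simp
  moreover have "0 \<le> snd (I ! s)" if s: "1 \<le> s" "s < n" for s
  proof -
    obtain r where "s = Suc r" using s(1) by (cases s) simp_all
    then show ?thesis using k_mono[of r] nth[OF s(2)] s(2) by simp
  qed
  ultimately have "I \<in> admissible n" unfolding admissible_def using lenI by simp
  moreover have "basis_monomial p I = hmon_of n J t"
  proof (rule nth_equalityI)
    fix s assume "s < length (basis_monomial p I)"
    then have s: "s < n" by (simp add: basis_monomial_def lenI)
    have "int (T s) = int p ^ s * (int p - 1) * int (k s)"
      unfolding T[OF s] using p by (simp add: of_nat_diff)
    then have "v_exponent p I s = int (T s) - int p ^ s * of_bool (s \<in> J)"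
      unfolding v_exponent_def psum[OF s] b eps[OF s] by simp
    also have "\<dots> = int (t ! s)" by (simp add: T_def)
    finally show "basis_monomial p I ! s = hmon_of n J t ! s"
      using s nth[OF s] by (simp add: basis_monomial_def lenI)
  qed (simp add: basis_monomial_def lenI)
  ultimately show ?thesis by blast
qed

section \<open>Dickson and Mui invariants\<close>

definition vecs :: "nat \<Rightarrow> (nat \<Rightarrow> 'k) set" where
  "vecs n = (\<Pi>\<^sub>E i\<in>{..<n}. UNIV)"

definition lin_form :: "nat \<Rightarrow> (nat \<Rightarrow> 'k::field) \<Rightarrow> (nat \<Rightarrow> 'k poly) \<Rightarrow> 'k poly" where
  "lin_form n c X = (\<Sum>i<n. [:c i:] * X i)"

text \<open>
  The Dickson invariant of degree \<open>q^n - q^s\<close>, as an elementary symmetric polynomial in all the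
  linear forms.
\<close>

definition dickson :: "nat \<Rightarrow> nat \<Rightarrow> (nat \<Rightarrow> 'k::{field,finite} poly) \<Rightarrow> 'k poly" where
  "dickson n s X = (\<Sum>A | A \<subseteq> vecs n \<and> card A = CARD('k) ^ n - CARD('k) ^ s. \<Prod>c\<in>A. lin_form n c X)"

lemma finite_vecs [simp]: "finite (vecs n :: (nat \<Rightarrow> 'k::finite) set)"
  unfolding vecs_def by (intro finite_PiE) auto

lemma hpoly_dickson: "hpoly n (CARD('k) ^ n - CARD('k) ^ s) (dickson n s :: (nat \<Rightarrow> 'k::{field,finite} poly) \<Rightarrow> 'k poly)"
proof -
  have lin: "hpoly n 1 (lin_form n c)" for c :: "nat \<Rightarrow> 'k"
    unfolding lin_form_def by (intro hpoly_sum hpoly_scale hpoly_var) auto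
  have "hpoly n (CARD('k) ^ n - CARD('k) ^ s) (\<lambda>X. \<Sum>A | A \<subseteq> (vecs n :: (nat \<Rightarrow> 'k) set) \<and> card A = CARD('k) ^ n - CARD('k) ^ s. \<Prod>c\<in>A. lin_form n c X)"
  proof (rule hpoly_sum)
    fix A :: "(nat \<Rightarrow> 'k) set" assume "A \<in> {A. A \<subseteq> vecs n \<and> card A = CARD('k) ^ n - CARD('k) ^ s}"
    then have sub: "A \<subseteq> vecs n" and cA: "card A = CARD('k) ^ n - CARD('k) ^ s" by simp_all
    note A = finite_subset[OF sub finite_vecs] cA
    have "hpoly n (\<Sum>c\<in>A. 1) (\<lambda>X. \<Prod>c\<in>A. lin_form n c X)"
      by (rule hpoly_prod[OF A(1)]) (rule lin)
    then show "hpoly n (CARD('k) ^ n - CARD('k) ^ s) (\<lambda>X. \<Prod>c\<in>A. lin_form n c X)" using A(2) by simp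
  qed simp
  then show ?thesis unfolding dickson_def[abs_def] .
qed

section \<open>Invariance of the Dickson invariants\<close>

lemma GL_inverse:
  assumes "g \<in> GL n"
  obtains h where "h \<in> carrier_mat n n" "g * h = 1\<^sub>m n" "h * g = 1\<^sub>m n"
proof -
  have g: "g \<in> carrier_mat n n" "invertible_mat g" using assms by (simp_all add: GL_def)
  then obtain h where h: "g * h = 1\<^sub>m n" "h * g = 1\<^sub>m (dim_row h)"
    unfolding invertible_mat_def inverts_mat_def by auto
  have "dim_col h = dim_col (g * h)" by simp
  then have "dim_col h = n" using h(1) by simp
  moreover have "dim_row h = dim_col (h * g)" using h(2) by simp
  then have "dim_row h = n" using g(1) by simp
  ultimately show ?thesis using that[of h] h by auto
qed

lemma mat_mult_index:
  assumes "g \<in> carrier_mat n n" "h \<in> carrier_mat n n" "g * h = 1\<^sub>m n" "i < n" "k < n"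
  shows "(\<Sum>j<n. mat_fun g i j * mat_fun h j k) = of_bool (i = k)"
proof -
  have "(g * h) $$ (i, k) = (\<Sum>j<n. mat_fun g i j * mat_fun h j k)"
    using assms(1,2,4,5) by (simp add: scalar_prod_def mat_fun_def atLeast0LessThan)
  then have "(\<Sum>j<n. mat_fun g i j * mat_fun h j k) = (g * h) $$ (i, k)" by (rule sym)
  also have "\<dots> = of_bool (i = k)" unfolding assms(3) using assms(4,5) by simp
  finally show ?thesis .
qed

definition row_app :: "nat \<Rightarrow> 'k::field mat \<Rightarrow> (nat \<Rightarrow> 'k) \<Rightarrow> nat \<Rightarrow> 'k" where
  "row_app n g c = (\<lambda>s\<in>{..<n}. \<Sum>j<n. c j * mat_fun g j s)"

lemma row_app_vecs: "row_app n g c \<in> vecs n"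
  by (simp add: row_app_def vecs_def)

lemma row_app_inverse:
  assumes "g \<in> carrier_mat n n" "h \<in> carrier_mat n n" "g * h = 1\<^sub>m n" "c \<in> vecs n"
  shows "row_app n h (row_app n g c) = c"
proof (rule PiE_ext)
  show "row_app n h (row_app n g c) \<in> (\<Pi>\<^sub>E i\<in>{..<n}. UNIV)" "c \<in> (\<Pi>\<^sub>E i\<in>{..<n}. UNIV)"
    using row_app_vecs assms(4) unfolding vecs_def by blast+
  fix k assume "k \<in> {..<n}"
  then have k: "k < n" by simp
  have "row_app n h (row_app n g c) k = (\<Sum>s<n. (\<Sum>j<n. c j * mat_fun g j s) * mat_fun h s k)"
    using k by (simp add: row_app_def)
  also have "\<dots> = (\<Sum>j<n. c j * (\<Sum>s<n. mat_fun g j s * mat_fun h s k))"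
    unfolding sum_distrib_right sum_distrib_left by (subst sum.swap) (simp only: mult.assoc)
  also have "\<dots> = (\<Sum>j<n. if j = k then c j else 0)"
    by (intro sum.cong refl) (simp add: mat_mult_index[OF assms(1-3) _ k])
  finally show "row_app n h (row_app n g c) k = c k" using k by simp
qed

lemma lin_form_mat_app:
  "lin_form n c (mat_app (lift_mat (mat_fun g)) n X) = lin_form n (row_app n g c) X"
proof -
  have "lin_form n c (mat_app (lift_mat (mat_fun g)) n X) = (\<Sum>s<n. (\<Sum>j<n. [:c j:] * [:mat_fun g j s:]) * X s)"
    unfolding lin_form_def mat_app_def lift_mat_def sum_distrib_left sum_distrib_right
    by (subst sum.swap) (simp only: mult.assoc)
  also have "\<dots> = lin_form n (row_app n g c) X"
    unfolding lin_form_def const_poly_mult[symmetric] coeff_lift_hom.hom_sum[symmetric]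
    by (intro sum.cong refl) (simp add: row_app_def)
  finally show ?thesis .
qed

text \<open>An invertible matrix permutes the linear forms and hence their subsets of a given
  size.\<close>

lemma dickson_invariant:
  assumes "g \<in> GL n"
  shows "dickson n s (mat_app (lift_mat (mat_fun g)) n X) = dickson n s X"
proof -
  obtain h where h: "h \<in> carrier_mat n n" "g * h = 1\<^sub>m n" "h * g = 1\<^sub>m n" by (rule GL_inverse[OF assms])
  have g: "g \<in> carrier_mat n n" using assms by (simp add: GL_def)
  note gh = row_app_inverse[OF g h(1,2)] and hg = row_app_inverse[OF h(1) g h(3)]
  have inj_g: "inj_on (row_app n g) (vecs n)" by (rule inj_on_inverseI) (rule gh)
  have inj_h: "inj_on (row_app n h) (vecs n)" by (rule inj_on_inverseI) (rule hg)
  have img: "row_app n h ` row_app n g ` A = A" if "A \<subseteq> vecs n" for A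
  proof -
    have "row_app n h ` row_app n g ` A = (\<lambda>c. c) ` A"
      unfolding image_image by (rule image_cong[OF refl]) (use that gh in blast)
    then show ?thesis by simp
  qed
  have img': "row_app n g ` row_app n h ` A = A" if "A \<subseteq> vecs n" for A
  proof -
    have "row_app n g ` row_app n h ` A = (\<lambda>c. c) ` A"
      unfolding image_image by (rule image_cong[OF refl]) (use that hg in blast)
    then show ?thesis by simp
  qed
  have sub: "row_app n k ` A \<subseteq> vecs n" for k and A :: "(nat \<Rightarrow> 'a) set" using row_app_vecs by blast
  have card_g: "card (row_app n g ` A) = card A" if "A \<subseteq> vecs n" for A
    by (rule card_image) (rule inj_on_subset[OF inj_g that])
  have card_h: "card (row_app n h ` A) = card A" if "A \<subseteq> vecs n" for A
    by (rule card_image) (rule inj_on_subset[OF inj_h that])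
  show ?thesis unfolding dickson_def
  proof (rule sum.reindex_bij_witness[of _ "\<lambda>A. row_app n h ` A" "\<lambda>A. row_app n g ` A"], goal_cases)
    case (1 A) then show ?case using img[of A] by simp
  next
    case (2 A) then show ?case using sub card_g[of A] by simp
  next
    case (3 A) then show ?case using img'[of A] by simp
  next
    case (4 A) then show ?case using sub card_h[of A] by simp
  next
    case (5 A)
    then have "inj_on (row_app n g) A" by (intro inj_on_subset[OF inj_g]) simp
    then show ?case unfolding lin_form_mat_app by (simp add: prod.reindex)
  qed
qed

subsection \<open>The leading exponents of the Dickson invariants\<close>

text \<open>Coefficient vectors of the linear forms in the first \<open>s\<close> variables, padded
  with zeros so as to stay inside \<open>vecs n\<close>.\<close>

definition low_vecs :: "nat \<Rightarrow> nat \<Rightarrow> (nat \<Rightarrow> 'k::zero) set" where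
  "low_vecs n s = (\<Pi>\<^sub>E i\<in>{..<n}. if i < s then UNIV else {0})"

lemma low_vecs_iff: "c \<in> low_vecs n s \<longleftrightarrow> c \<in> vecs n \<and> (\<forall>i. s \<le> i \<and> i < n \<longrightarrow> c i = 0)"
proof -
  have "c \<in> low_vecs n s \<longleftrightarrow> c \<in> extensional {..<n} \<and> (\<forall>i<n. i < s \<or> c i = 0)"
    by (auto simp: low_vecs_def PiE_iff split: if_splits)
  moreover have "c \<in> vecs n \<longleftrightarrow> c \<in> extensional {..<n}" by (auto simp: vecs_def PiE_iff)
  ultimately show ?thesis using not_le by blast
qed

lemma card_low_vecs:
  assumes "s \<le> n"
  shows "card (low_vecs n s :: (nat \<Rightarrow> 'k::{zero,finite}) set) = CARD('k) ^ s"
proof -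
  have "card (low_vecs n s :: (nat \<Rightarrow> 'k) set) = (\<Prod>i<n. if i < s then CARD('k) else 1)"
    unfolding low_vecs_def by (subst card_PiE) (auto intro: prod.cong)
  also have "\<dots> = (\<Prod>i<s. CARD('k))"
    using assms by (intro prod.mono_neutral_cong_right) auto
  finally show ?thesis by simp
qed

lemma low_vecs_mono: "s \<le> r \<Longrightarrow> low_vecs n s \<subseteq> low_vecs n r"
  unfolding subset_iff low_vecs_iff by (meson order_trans)

lemma low_vecs_n: "low_vecs n n = vecs n"
  by (rule Set.set_eqI) (auto simp: low_vecs_iff)

lemma low_vecs_subset: "low_vecs n s \<subseteq> vecs n"
  unfolding subset_iff low_vecs_iff by blast

lemma lin_form_kron:
  fixes c :: "nat \<Rightarrow> 'k::field"
  assumes "B \<ge> 2" "c \<in> low_vecs n (Suc r)" "c \<notin> low_vecs n r" "r < n"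
  shows "lin_form n c (kron B) \<noteq> 0 \<and> degree (lin_form n c (kron B)) = B ^ r"
proof -
  let ?g = "\<lambda>i. [:c i:] * kron B i :: 'k poly"
  have above: "c i = 0" if "r < i" "i < n" for i using assms(2) that by (simp add: low_vecs_iff)
  have "c r \<noteq> 0"
  proof
    assume r: "c r = 0"
    have "c i = 0" if "r \<le> i" "i < n" for i using above[OF _ that(2)] r that(1) by (cases "i = r") simp_all
    then show False using assms(2,3) by (simp add: low_vecs_iff)
  qed
  have deg: "?g i \<noteq> 0 \<and> degree (?g i) = B ^ i" if "c i \<noteq> 0" for i
    using that by (simp add: kron_def smult_monom degree_monom_eq)
  have "(\<Sum>i\<in>{..<n}. ?g i) \<noteq> 0 \<and> degree (\<Sum>i\<in>{..<n}. ?g i) = degree (?g r)"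
  proof (rule degree_sum_unique_max)
    show "?g r \<noteq> 0" using deg[OF \<open>c r \<noteq> 0\<close>] by blast
    fix i assume i: "i \<in> {..<n}" "i \<noteq> r"
    show "?g i = 0 \<or> degree (?g i) < degree (?g r)"
    proof (cases "c i = 0")
      case False
      then have "i < r" using above[of i] i by (metis lessThan_iff linorder_neqE_nat)
      then have "B ^ i < B ^ r" using assms(1) by (simp add: power_strict_increasing)
      then show ?thesis unfolding conjunct2[OF deg[OF False]] conjunct2[OF deg[OF \<open>c r \<noteq> 0\<close>]] by (rule disjI2)
    qed simp
  qed (use assms in simp_all)
  then show ?thesis unfolding lin_form_def conjunct2[OF deg[OF \<open>c r \<noteq> 0\<close>]] .
qed

lemma vecs_level:
  assumes "c \<in> vecs n" "c \<notin> low_vecs n s"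
  obtains r where "s \<le> r" "r < n" "c \<in> low_vecs n (Suc r)" "c \<notin> low_vecs n r"
proof -
  obtain i where i: "s \<le> i" "i < n" "c i \<noteq> 0" using assms by (auto simp: low_vecs_iff)
  obtain r where r: "r < n" "c r \<noteq> 0" and above: "\<And>j. r < j \<Longrightarrow> j < n \<Longrightarrow> \<not> c j \<noteq> 0"
  proof (rule last_difference[where P = "\<lambda>r. c r \<noteq> 0", OF i(2,3)])
    fix r assume a: "r < n" "c r \<noteq> 0" "\<And>j. r < j \<Longrightarrow> j < n \<Longrightarrow> \<not> c j \<noteq> 0"
    show thesis by (rule that[OF a])
  qed
  have "s \<le> r" using above[of i] i by (metis le_trans not_le)
  moreover have "c \<in> low_vecs n (Suc r)" using assms(1) above by (simp add: low_vecs_iff Suc_le_eq)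
  moreover have "c \<notin> low_vecs n r" using r by (auto simp: low_vecs_iff)
  ultimately show ?thesis using that r(1) by blast
qed

text \<open>There are \<open>CARD('k) ^ r * (CARD('k) - 1)\<close> linear forms whose last variable
  is the \<open>r\<close>th, each of degree \<open>B ^ r\<close> at \<open>kron B\<close>.\<close>

lemma sum_degree_high_vecs:
  assumes "B \<ge> 2" "s \<le> n"
  shows "(\<Sum>c\<in>vecs n - low_vecs n s. degree (lin_form n c (kron B) :: 'k::{field,finite} poly))
    = (\<Sum>r<n. (if s \<le> r then CARD('k) ^ r * (CARD('k) - 1) else 0) * B ^ r)"
  using assms(2)
proof (induction s rule: inc_induct)
  case base
  show ?case by (simp add: low_vecs_n)
next
  case (step s)
  let ?d = "\<lambda>c. degree (lin_form n c (kron B) :: 'k poly)"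
  let ?N = "low_vecs n (Suc s) - low_vecs n s :: (nat \<Rightarrow> 'k) set"
  have fin: "finite (low_vecs n r :: (nat \<Rightarrow> 'k) set)" for r by (rule finite_subset[OF low_vecs_subset finite_vecs])
  have sub: "low_vecs n s \<subseteq> (low_vecs n (Suc s) :: (nat \<Rightarrow> 'k) set)" by (rule low_vecs_mono) simp
  have "vecs n - low_vecs n s = (vecs n - low_vecs n (Suc s)) \<union> ?N"
    using sub low_vecs_subset[of n "Suc s", where 'a='k] by blast
  then have "(\<Sum>c\<in>vecs n - low_vecs n s. ?d c) = (\<Sum>c\<in>vecs n - low_vecs n (Suc s). ?d c) + (\<Sum>c\<in>?N. ?d c)"
    by (simp only:) (rule sum.union_disjoint, use fin in auto)
  also have "(\<Sum>c\<in>?N. ?d c) = (\<Sum>c\<in>?N. B ^ s)"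
    by (rule sum.cong[OF refl]) (use lin_form_kron[OF assms(1)] step.hyps in blast)
  also have "\<dots> = CARD('k) ^ s * (CARD('k) - 1) * B ^ s"
  proof -
    have "card ?N = CARD('k) ^ Suc s - CARD('k) ^ s"
      using step.hyps by (simp only: card_Diff_subset[OF fin sub] card_low_vecs Suc_leI less_imp_le)
    then show ?thesis by (simp add: right_diff_distrib' mult.commute)
  qed
  also have "(\<Sum>c\<in>vecs n - low_vecs n (Suc s). ?d c) = (\<Sum>r<n. (if Suc s \<le> r then CARD('k) ^ r * (CARD('k) - 1) else 0) * B ^ r)"
    by (rule step.IH)
  also have "(\<Sum>r<n. (if Suc s \<le> r then CARD('k) ^ r * (CARD('k) - 1) else 0) * B ^ r) + CARD('k) ^ s * (CARD('k) - 1) * B ^ s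
     = (\<Sum>r<n. (if Suc s \<le> r then CARD('k) ^ r * (CARD('k) - 1) else 0) * B ^ r + (if r = s then CARD('k) ^ s * (CARD('k) - 1) * B ^ s else 0))"
    using step.hyps by (simp add: sum.distrib)
  also have "\<dots> = (\<Sum>r<n. (if s \<le> r then CARD('k) ^ r * (CARD('k) - 1) else 0) * B ^ r)"
    by (rule sum.cong[OF refl]) (auto simp: Suc_le_eq le_less)
  finally show ?case .
qed

text \<open>The largest product is that of the forms involving some variable of index at least
  \<open>s\<close>: their number is exactly the number of factors, each has degree at least
  \<open>B ^ s\<close>, and all other forms have smaller degree.\<close>

lemma lead_dickson:
  assumes "s \<le> n"
  shows "lead n (dickson n s :: (nat \<Rightarrow> 'k::{field,finite} poly) \<Rightarrow> 'k poly)
    (\<lambda>r. if s \<le> r then CARD('k) ^ r * (CARD('k) - 1) else 0)"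
  unfolding lead_def
proof (intro exI[of _ 2] allI impI)
  fix B :: nat assume B: "2 \<le> B"
  let ?m = "CARD('k) ^ n - CARD('k) ^ s"
  let ?V = "vecs n :: (nat \<Rightarrow> 'k) set" and ?A = "vecs n - low_vecs n s :: (nat \<Rightarrow> 'k) set"
  let ?l = "\<lambda>c. lin_form n c (kron B) :: 'k poly" and ?d = "\<lambda>c. degree (lin_form n c (kron B) :: 'k poly)"
  have fin: "finite (low_vecs n s :: (nat \<Rightarrow> 'k) set)" by (rule finite_subset[OF low_vecs_subset finite_vecs])
  have cardA: "card ?A = ?m"
    using card_Diff_subset[OF fin low_vecs_subset] card_low_vecs[OF assms, where 'k='k] card_low_vecs[of n n, where 'k='k]
    by (simp add: low_vecs_n)
  have high: "?l c \<noteq> 0 \<and> B ^ s \<le> ?d c" if c: "c \<in> ?A" for c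
  proof -
    have "c \<in> vecs n" "c \<notin> low_vecs n s" using c by simp_all
    then obtain r where r: "s \<le> r" "r < n" "c \<in> low_vecs n (Suc r)" "c \<notin> low_vecs n r" by (rule vecs_level)
    moreover have "B ^ s \<le> B ^ r" using r(1) B by (simp add: power_increasing)
    ultimately show ?thesis using lin_form_kron[OF B r(3,4,2)] by simp
  qed
  have low: "?d c < B ^ s" if c: "c \<in> ?V" "c \<in> low_vecs n s" for c
  proof (cases "c \<in> low_vecs n 0")
    case True
    then have "?l c = 0" by (simp add: low_vecs_iff lin_form_def)
    then show ?thesis using B by simp
  next
    case False
    with c(1) obtain r where r: "0 \<le> r" "r < n" "c \<in> low_vecs n (Suc r)" "c \<notin> low_vecs n r" by (rule vecs_level)
    then have "r < s" using low_vecs_mono[of s r n, where 'a='k] c(2) by (meson not_le subsetD)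
    then have "B ^ r < B ^ s" using B by (simp add: power_strict_increasing)
    then show ?thesis using lin_form_kron[OF B r(3,4,2)] by simp
  qed
  let ?S = "{A. A \<subseteq> ?V \<and> card A = ?m}" and ?g = "\<lambda>A. \<Prod>c\<in>A. ?l c"
  have gA: "?g ?A \<noteq> 0" "degree (?g ?A) = (\<Sum>c\<in>?A. ?d c)"
    using high by (auto simp: degree_prod_eq_sum_degree)
  have "(\<Sum>A\<in>?S. ?g A) \<noteq> 0 \<and> degree (\<Sum>A\<in>?S. ?g A) = degree (?g ?A)"
  proof (rule degree_sum_unique_max)
    show "?A \<in> ?S" using cardA by auto
    fix A assume "A \<in> ?S" "A \<noteq> ?A"
    then have "A \<subseteq> ?V" "card A = ?m" "A \<noteq> ?A" by simp_all
    note A = this finite_subset[OF this(1) finite_vecs]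
    show "?g A = 0 \<or> degree (?g A) < degree (?g ?A)"
    proof (cases "\<exists>c\<in>A. ?l c = 0")
      case True
      then show ?thesis using A(4) by simp
    next
      case False
      then have "degree (?g A) = (\<Sum>c\<in>A. ?d c)" by (intro degree_prod_eq_sum_degree) blast
      also have "\<dots> = (\<Sum>c\<in>A \<inter> ?A. ?d c) + (\<Sum>c\<in>A - ?A. ?d c)"
        using A(4) by (rule sum.Int_Diff)
      \<comment> \<open>Any other set of this size trades some of these forms for equally many forms
        of degree below \<open>B ^ s\<close>.\<close>
      also have "\<dots> < (\<Sum>c\<in>?A \<inter> A. ?d c) + (\<Sum>c\<in>?A - A. ?d c)"
      proof -
        have finA: "finite ?A" by simp
        have c1: "card (A - ?A) = card A - card (A \<inter> ?A)" by (rule card_Diff_subset_Int) (use A(4) in simp)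
        have c2: "card (?A - A) = card ?A - card (?A \<inter> A)" by (rule card_Diff_subset_Int) (use finA in simp)
        have eq: "card (A - ?A) = card (?A - A)" unfolding c1 c2 A(2) cardA Int_commute[of A ?A] ..
        have "\<not> ?A \<subseteq> A" using card_subset_eq[OF A(4), of ?A] A(2,3) cardA by auto
        then have pos: "card (?A - A) > 0" using finA by (simp add: card_gt_0_iff)
        have "(\<Sum>c\<in>A - ?A. ?d c) < (\<Sum>c\<in>A - ?A. B ^ s)"
        proof (rule sum_strict_mono)
          show "A - ?A \<noteq> {}" using pos eq by (metis card.empty less_numeral_extra(3))
          fix c assume "c \<in> A - ?A"
          then show "?d c < B ^ s" using A(1) by (intro low) blast+
        qed (use A(4) in simp)
        also have "\<dots> = (\<Sum>c\<in>?A - A. B ^ s)" using eq by simp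
        also have "\<dots> \<le> (\<Sum>c\<in>?A - A. ?d c)"
          by (rule sum_mono) (use high in blast)
        finally show ?thesis by (simp only: Int_commute[of A ?A] add_strict_left_mono)
      qed
      also have "\<dots> = (\<Sum>c\<in>?A. ?d c)" by (rule sum.Int_Diff[symmetric]) simp
      finally show ?thesis unfolding gA(2) by (rule disjI2)
    qed
  qed (use gA in simp_all)
  then show "dickson n s (kron B :: nat \<Rightarrow> 'k poly) \<noteq> 0 \<and>
      degree (dickson n s (kron B :: nat \<Rightarrow> 'k poly)) = enc B n (\<lambda>r. if s \<le> r then CARD('k) ^ r * (CARD('k) - 1) else 0)"
    unfolding dickson_def gA(2) enc_def sum_degree_high_vecs[OF B assms] .
qed

section \<open>Leading monomials and the Vandermonde determinant\<close>

lemma leading_monomial_exists: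
  fixes \<phi> :: "nat set \<Rightarrow> nat list \<Rightarrow> 'k::zero"
  assumes p: "p \<ge> 2" and ex: "I0 \<subseteq> {..<n}" "s0 \<in> expos n d" "\<phi> I0 s0 \<noteq> 0"
  obtains J t where "J \<subseteq> {..<n}" "t \<in> expos n d" "\<phi> J t \<noteq> 0"
    "\<And>I s. I \<subseteq> {..<n} \<Longrightarrow> s \<in> expos n d \<Longrightarrow> \<phi> I s \<noteq> 0 \<Longrightarrow>
       (I, s) = (J, t) \<or> lexless n (mon_key p I s) (mon_key p J t)"
proof -
  let ?A = "{x \<in> Pow {..<n} \<times> expos n d. \<phi> (fst x) (snd x) \<noteq> 0}"
  \<comment> \<open>Exceeds every key: at most \<open>2 * d\<close> comes from the exponent and less
    than \<open>2 * p ^ n + 1\<close> from the exterior generator.\<close>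
  let ?B = "2 * d + 2 * p ^ n + 1"
  let ?e = "\<lambda>x. enc ?B n (mon_key p (fst x) (snd x))"
  have fin: "finite ?A" by simp
  have "?A \<noteq> {}" using ex by auto
  then have "Max (?e ` ?A) \<in> ?e ` ?A" using fin by (intro Max_in) simp_all
  then obtain x0 where x0: "Max (?e ` ?A) = ?e x0" "x0 \<in> ?A" by (rule imageE)
  obtain J t where Jt: "x0 = (J, t)" by fastforce
  have J: "J \<subseteq> {..<n}" "t \<in> expos n d" "\<phi> J t \<noteq> 0" using x0(2) unfolding Jt by simp_all
  have key_less: "mon_key p I s i < ?B" if "s \<in> expos n d" "i < n" for I s i
  proof -
    have "s ! i \<le> d" by (rule expos_nth_le[OF that])
    moreover have "p ^ i \<le> p ^ n" using that p by (simp add: power_increasing)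
    moreover have "mon_key p I s i \<le> 2 * (s ! i) + 2 * p ^ i" by (simp add: mon_key_def)
    ultimately show ?thesis by linarith
  qed
  have "(I, s) = (J, t) \<or> lexless n (mon_key p I s) (mon_key p J t)"
    if I: "I \<subseteq> {..<n}" "s \<in> expos n d" "\<phi> I s \<noteq> 0" for I s
  proof (rule lexless_cases[of n "mon_key p I s" "mon_key p J t"])
    assume eq: "\<And>i. i < n \<Longrightarrow> mon_key p I s i = mon_key p J t i"
    have "I = J \<and> s = t"
      by (rule mon_key_inj[OF J(1) I(1) _ _ _ eq]) (use I J p in \<open>simp_all add: expos_def\<close>)
    then show ?thesis by simp
  next
    assume "lexless n (mon_key p J t) (mon_key p I s)"
    then have "enc ?B n (mon_key p J t) < enc ?B n (mon_key p I s)"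
      by (rule enc_lexless) (rule key_less[OF J(2)])
    moreover have "(I, s) \<in> ?A" using I by simp
    then have "?e (I, s) \<le> Max (?e ` ?A)" using fin by (intro Max_ge) blast+
    ultimately show ?thesis unfolding x0(1) Jt by simp
  qed simp
  then show ?thesis using that[OF J] by blast
qed

text \<open>The determinant is the value of the constant top form, so \<open>lead_form\<close> with
  \<open>d = 0\<close> applies.\<close>

lemma lead_vandermonde:
  assumes "distinct js" "set js = {..<n}"
  shows "lead n (\<lambda>X :: nat \<Rightarrow> 'p::prime_card mod_ring poly. frob_wedge CARD('p) js X (ext_basis {}) {..<n}) (\<lambda>r. CARD('p) ^ r)"
proof -
  have p2: "CARD('p) \<ge> 2" using prime_card[where 'a='p] prime_ge_2_nat by blast
  define \<phi> :: "nat set \<Rightarrow> nat list \<Rightarrow> 'p mod_ring" where "\<phi> J t = of_bool (J = {..<n})" for J t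
  let ?t = "replicate n (0::nat)"
  have hev: "hev n 0 (\<phi> J) X = of_bool (J = {..<n})" for J X
    by (simp add: hev_def expos_n_0 \<phi>_def mono_val_def one_pCons[symmetric])
  have form: "form n 0 \<phi> X D = D {..<n}" for X D
  proof -
    have "form n 0 \<phi> X D = (\<Sum>J\<in>Pow {..<n}. if J = {..<n} then D J else 0)"
      unfolding form_def hev by (rule sum.cong) auto
    then show ?thesis by simp
  qed
  have "lead n (\<lambda>X :: nat \<Rightarrow> 'p mod_ring poly. form n 0 \<phi> X (frob_wedge CARD('p) js X (ext_basis {})))
      (\<lambda>r. ?t ! r + (if r \<in> {..<n} then CARD('p) ^ r else 0))"
  proof (rule lead_form[OF p2 assms subset_refl])
    show "?t \<in> expos n 0" by (simp add: expos_n_0)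
    show "\<phi> {..<n} ?t \<noteq> 0" by (simp add: \<phi>_def)
    fix I s assume "s \<in> expos n 0" "\<phi> I s \<noteq> 0"
    then show "(I, s) = ({..<n}, ?t) \<or> lexless n (mon_key CARD('p) I s) (mon_key CARD('p) {..<n} ?t)"
      by (simp add: expos_n_0 \<phi>_def)
  qed
  then have "lead n (\<lambda>X :: nat \<Rightarrow> 'p mod_ring poly. frob_wedge CARD('p) js X (ext_basis {}) {..<n})
      (\<lambda>r. ?t ! r + (if r \<in> {..<n} then CARD('p) ^ r else 0))" unfolding form .
  then show ?thesis by (rule lead_cong) simp
qed

section \<open>Determinants and Mui forms\<close>

lemma ext_map_top: "ext_map G n D {..<n} = D {..<n} * ext_cols G n {..<n} {..<n}"
proof -
  have "ext_map G n D {..<n} = (\<Sum>J\<in>{{..<n}}. D J * ext_cols G n J {..<n})"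
    unfolding ext_map_def
  proof (rule sum.mono_neutral_right)
    show "\<forall>J\<in>Pow {..<n} - {{..<n}}. D J * ext_cols G n J {..<n} = 0"
    proof
      fix J :: "nat set" assume J: "J \<in> Pow {..<n} - {{..<n}}"
      then have "card J < card {..<n}" by (intro psubset_card_mono) auto
      then have "ext_cols G n J {..<n} = 0" using J by (intro ext_cols_card) auto
      then show "D J * ext_cols G n J {..<n} = 0" by simp
    qed
  qed auto
  then show ?thesis by simp
qed

lemma ext_map_bot: "ext_map G n D {} = D {}"
proof -
  have "ext_map G n D {} = (\<Sum>J\<in>{{}}. D J * ext_cols G n J {})"
    unfolding ext_map_def
  proof (rule sum.mono_neutral_right)
    show "\<forall>J\<in>Pow {..<n} - {{}}. D J * ext_cols G n J {} = 0"
    proof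
      fix J :: "nat set" assume J: "J \<in> Pow {..<n} - {{}}"
      then have "finite J" using finite_subset[of J "{..<n}"] by simp
      then have "card J \<noteq> 0" using J by simp
      then have "ext_cols G n J {} = 0" using J by (intro ext_cols_card) auto
      then show "D J * ext_cols G n J {} = 0" by simp
    qed
  qed auto
  moreover have "ext_cols G n {} {} = 1"
    by (simp add: ext_cols_def sel_wedges_eq_wedges ext_basis_def)
  ultimately show ?thesis by simp
qed

text \<open>The Mui form of \<open>S\<close>, with values in the polynomials; for \<open>S = {}\<close> it is the Vandermonde
  determinant of the Frobenius powers.\<close>

definition mui :: "nat \<Rightarrow> nat set \<Rightarrow> (nat \<Rightarrow> 'p::prime_card mod_ring poly) \<Rightarrow> (nat set \<Rightarrow> 'p mod_ring poly) \<Rightarrow> 'p mod_ring poly" where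
  "mui n S X D = frob_wedge CARD('p) (filter (\<lambda>s. s \<notin> S) [0..<n]) X D {..<n}"

abbreviation vandermonde :: "nat \<Rightarrow> (nat \<Rightarrow> 'p::prime_card mod_ring poly) \<Rightarrow> 'p mod_ring poly" where
  "vandermonde n X \<equiv> mui n {} X (ext_basis {})"

lemma mui_mat_app:
  "mui n S (mat_app (lift_mat G) n X) (ext_map (lift_mat G) n D)
     = mui n S X D * [:ext_cols G n {..<n} {..<n}:]"
  unfolding mui_def ext_map_frob_wedge[OF finite_lessThan, symmetric] ext_map_top const_ext_cols ..

lemma mui_expand: "mui n S X D = (\<Sum>J\<in>Pow {..<n}. D J * mui n S X (ext_basis J))"
  unfolding mui_def by (rule wedges_expand) simp_all

lemma mui_cong: "(\<And>J. J \<subseteq> {..<n} \<Longrightarrow> D J = E J) \<Longrightarrow> mui n S X D = mui n S X E"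
  unfolding mui_def by (rule wedges_cong) simp_all

lemma mui_cong_point: "(\<And>i. i < n \<Longrightarrow> X i = Y i) \<Longrightarrow> mui n S X D = mui n S Y D"
  unfolding mui_def by (rule frob_wedge_cong) simp_all

lemma vandermonde_mat_app:
  "vandermonde n (mat_app (lift_mat G) n X) = vandermonde n X * [:ext_cols G n {..<n} {..<n}:]"
proof -
  have "vandermonde n (mat_app (lift_mat G) n X) = mui n {} (mat_app (lift_mat G) n X) (ext_map (lift_mat G) n (ext_basis {}))"
  proof (rule mui_cong)
    fix J :: "nat set" assume "J \<subseteq> {..<n}"
    then have "finite J" using finite_subset by blast
    then show "ext_basis {} J = ext_map (lift_mat G) n (ext_basis {}) J" by (rule ext_map_empty[symmetric])
  qed
  then show ?thesis unfolding mui_mat_app .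
qed

lemma lead_vandermonde_power:
  "lead n (vandermonde n :: (nat \<Rightarrow> 'p::prime_card mod_ring poly) \<Rightarrow> 'p mod_ring poly) (\<lambda>r. CARD('p) ^ r)"

proof -
  have "lead n (\<lambda>X :: nat \<Rightarrow> 'p mod_ring poly. frob_wedge CARD('p) [0..<n] X (ext_basis {}) {..<n}) (\<lambda>r. CARD('p) ^ r)"
    by (rule lead_vandermonde) auto
  moreover have "filter (\<lambda>s. s \<notin> {}) [0..<n] = [0..<n]" by simp
  ultimately show ?thesis unfolding mui_def[abs_def] by simp
qed

text \<open>If the determinant were 0, \<open>vandermonde_mat_app\<close> would make the Vandermonde
  determinant vanish at every point g (h X) = X, against its leading exponents.\<close>

lemma GL_det_nonzero:
  fixes g :: "'p::prime_card mod_ring mat"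
  assumes "g \<in> GL n"
  shows "ext_cols (mat_fun g) n {..<n} {..<n} \<noteq> 0"
proof
  let ?det = "ext_cols (mat_fun g) n {..<n} {..<n}"
  assume det: "?det = 0"
  obtain h where h: "h \<in> carrier_mat n n" "g * h = 1\<^sub>m n" "h * g = 1\<^sub>m n" by (rule GL_inverse[OF assms])
  have g: "g \<in> carrier_mat n n" using assms by (simp add: GL_def)
  let ?G = "lift_mat (mat_fun g)" and ?H = "lift_mat (mat_fun h)"
  have "mat_app ?G n (mat_app ?H n X) i = X i" if i: "i < n" for X i
  proof -
    have "mat_app ?G n (mat_app ?H n X) i = (\<Sum>k<n. (\<Sum>j<n. [:mat_fun g i j:] * [:mat_fun h j k:]) * X k)"
      unfolding mat_app_def lift_mat_def sum_distrib_left sum_distrib_right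
      by (subst sum.swap) (simp only: mult.assoc)
    also have "\<dots> = (\<Sum>k<n. [:of_bool (i = k):] * X k)"
      unfolding const_poly_mult[symmetric] coeff_lift_hom.hom_sum[symmetric]
      by (intro sum.cong refl) (simp only: mat_mult_index[OF g h(1,2) i] lessThan_iff)
    also have "\<dots> = (\<Sum>k<n. if k = i then X k else 0)"
      by (rule sum.cong) (auto simp: one_pCons[symmetric])
    finally show ?thesis using i by simp
  qed
  then have "vandermonde n X = vandermonde n (mat_app ?G n (mat_app ?H n X))" for X
    by (intro mui_cong_point) simp
  then have "vandermonde n X = 0" for X :: "nat \<Rightarrow> 'p mod_ring poly" unfolding vandermonde_mat_app det by simp
  moreover obtain B where "vandermonde n (kron B :: nat \<Rightarrow> 'p mod_ring poly) \<noteq> 0"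
    using lead_vandermonde_power[of n, where 'p='p] unfolding lead_def by blast
  ultimately show False by blast
qed

text \<open>The Mui form already contains all twists outside \<open>S\<close>. A repeated twist
  gives 0, and so does a wrong number of factors; hence only the twists in \<open>S\<close> complete
  it.\<close>

lemma mui_frob_wedge:
  fixes X :: "nat \<Rightarrow> 'p::prime_card mod_ring poly"
  assumes "distinct js" "set js \<subseteq> {..<n}" "mui n S X (frob_wedge CARD('p) js X (ext_basis {})) \<noteq> 0" "S \<subseteq> {..<n}"
  shows "set js = S"
proof -
  let ?cs = "filter (\<lambda>s. s \<notin> S) [0..<n]"
  have eq: "mui n S X (frob_wedge CARD('p) js X (ext_basis {})) = frob_wedge CARD('p) (?cs @ js) X (ext_basis {}) {..<n}"
    unfolding mui_def by simp
  have "distinct (map (\<lambda>j i. X i ^ (CARD('p) ^ j)) (?cs @ js))"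
    using wedges_not_distinct[of "{..<n}" "map (\<lambda>j i. X i ^ (CARD('p) ^ j)) (?cs @ js)" "ext_basis {}"] assms(3) unfolding eq by blast
  then have dis: "distinct (?cs @ js)" by (simp only: distinct_map)
  have "card {..<n} = length (map (\<lambda>j i. X i ^ (CARD('p) ^ j)) (?cs @ js)) + card {}"
  proof (rule ccontr)
    assume "\<not> ?thesis"
    then have "frob_wedge CARD('p) (?cs @ js) X (ext_basis {}) {..<n} = 0"
      by (intro wedges_card) simp_all
    then show False using assms(3) unfolding eq by contradiction
  qed
  then have "length (?cs @ js) = n" by simp
  then have "card (set (?cs @ js)) = n" using distinct_card[OF dis] by simp
  moreover have "set (?cs @ js) \<subseteq> {..<n}" using assms(2) by auto
  ultimately have "set (?cs @ js) = {..<n}" by (intro card_subset_eq) simp_all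
  moreover have "set ?cs = {..<n} - S" by auto
  moreover have "set ?cs \<inter> set js = {}" using dis by (simp only: distinct_append)
  ultimately show ?thesis using assms(2,4) by auto
qed

lemma lead_mui:
  assumes "distinct js" "set js = S" "S \<subseteq> {..<n}"
  shows "lead n (\<lambda>X :: nat \<Rightarrow> 'p::prime_card mod_ring poly. mui n S X (frob_wedge CARD('p) js X (ext_basis {}))) (\<lambda>r. CARD('p) ^ r)"
proof -
  have "lead n (\<lambda>X :: nat \<Rightarrow> 'p mod_ring poly. frob_wedge CARD('p) (filter (\<lambda>s. s \<notin> S) [0..<n] @ js) X (ext_basis {}) {..<n}) (\<lambda>r. CARD('p) ^ r)"
    by (rule lead_vandermonde) (use assms in auto)
  then show ?thesis unfolding mui_def by simp
qed

lemma hpoly_mui: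
  assumes "J \<subseteq> {..<n}"
  shows "hpoly n (sum_list (map ((^) CARD('p)) (filter (\<lambda>s. s \<notin> S) [0..<n])))
    (\<lambda>X :: nat \<Rightarrow> 'p::prime_card mod_ring poly. mui n S X (ext_basis J))"
proof -
  have "hpoly n 0 (\<lambda>X :: nat \<Rightarrow> 'p mod_ring poly. ext_basis J I :: 'p mod_ring poly)" for I
    using hpoly_const[of n "of_bool (I = J) :: 'p mod_ring"] by (cases "I = J") (simp_all add: ext_basis_def one_pCons[symmetric])
  then have "hpoly n (sum_list (map ((^) CARD('p)) (filter (\<lambda>s. s \<notin> S) [0..<n])) + 0)
    (\<lambda>X :: nat \<Rightarrow> 'p mod_ring poly. frob_wedge CARD('p) (filter (\<lambda>s. s \<notin> S) [0..<n]) X (ext_basis J) {..<n})"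
    by (intro hpoly_frob_wedge) simp_all
  then show ?thesis unfolding mui_def by simp
qed

text \<open>
  The invariant form with leading monomial \<open>u\<^sub>S v^[\<dots>]\<close>: a product of Dickson invariants, times
  the Mui form of \<open>S\<close> and a power of the Vandermonde determinant which makes the product invariant.
\<close>

definition inv_form :: "nat \<Rightarrow> nat set \<Rightarrow> (nat \<Rightarrow> nat) \<Rightarrow> (nat \<Rightarrow> 'p::prime_card mod_ring poly) \<Rightarrow> (nat set \<Rightarrow> 'p mod_ring poly) \<Rightarrow> 'p mod_ring poly" where
  "inv_form n S e X D = (if S = {} then D {} else mui n S X D * vandermonde n X ^ (CARD('p) - 2)) *
     (\<Prod>s<n. dickson n s X ^ e s)"

text \<open>The Mui form contributes one determinant and the Vandermonde power
  \<open>CARD('p) - 2\<close> more; the resulting power \<open>CARD('p) - 1\<close> of a nonzero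
  element of the prime field is 1.\<close>

lemma inv_form_invariant:
  fixes g :: "'p::prime_card mod_ring mat"
  assumes "g \<in> GL n"
  shows "inv_form n S e (mat_app (lift_mat (mat_fun g)) n X) (ext_map (lift_mat (mat_fun g)) n D) = inv_form n S e X D"
proof -
  let ?det = "ext_cols (mat_fun g) n {..<n} {..<n}"
  have p2: "CARD('p) \<ge> 2" using prime_card[where 'a='p] prime_ge_2_nat by blast
  have "?det * ?det ^ (CARD('p) - 1) = ?det * 1"
    using power_card_pow[of ?det 1] power_Suc[of ?det "CARD('p) - 1"] p2 by simp
  then have "?det ^ (CARD('p) - 1) = 1" using GL_det_nonzero[OF assms] mult_left_cancel by blast
  moreover have "CARD('p) - 1 = Suc (CARD('p) - 2)" using p2 by simp
  ultimately have "?det * ?det ^ (CARD('p) - 2) = 1" by (simp only: power_Suc)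
  then have d: "[:?det:] * [:?det:] ^ (CARD('p) - 2) = 1"
    by (simp only: coeff_lift_hom.hom_power[symmetric] const_poly_mult[symmetric] one_pCons)
  have "mui n S (mat_app (lift_mat (mat_fun g)) n X) (ext_map (lift_mat (mat_fun g)) n D) * vandermonde n (mat_app (lift_mat (mat_fun g)) n X) ^ (CARD('p) - 2)
    = mui n S X D * vandermonde n X ^ (CARD('p) - 2) * ([:?det:] * [:?det:] ^ (CARD('p) - 2))"
    unfolding mui_mat_app vandermonde_mat_app power_mult_distrib by (simp only: mult_ac)
  then show ?thesis unfolding inv_form_def ext_map_bot dickson_invariant[OF assms] d by (simp only: mult_1_right)
qed

lemma inv_form_expand: "inv_form n S e X D = (\<Sum>J\<in>Pow {..<n}. D J * inv_form n S e X (ext_basis J))"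
proof (cases "S = {}")
  case True
  have "(\<Sum>J\<in>Pow {..<n}. D J * inv_form n S e X (ext_basis J)) = (\<Sum>J\<in>Pow {..<n}. if J = {} then D {} * (\<Prod>s<n. dickson n s X ^ e s) else 0)"
    using True by (intro sum.cong refl) (auto simp: inv_form_def ext_basis_def)
  also have "\<dots> = inv_form n S e X D" using True by (simp add: inv_form_def)
  finally show ?thesis ..
next
  case False
  then show ?thesis
    unfolding inv_form_def if_not_P[OF False] mui_expand[of n S X D] sum_distrib_right by (intro sum.cong refl) (simp only: mult_ac)
qed

text \<open>All coefficients of the form share one degree, so a functional in a single degree
  describes it.\<close>

lemma hpoly_inv_form:
  "\<exists>d. \<forall>J. J \<subseteq> {..<n} \<longrightarrow> hpoly n d (\<lambda>X :: nat \<Rightarrow> 'p::prime_card mod_ring poly. inv_form n S e X (ext_basis J))"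
proof -
  have R: "hpoly n (\<Sum>s<n. e s * (CARD('p mod_ring) ^ n - CARD('p mod_ring) ^ s)) (\<lambda>X :: nat \<Rightarrow> 'p mod_ring poly. \<Prod>s<n. dickson n s X ^ e s)"
    by (rule hpoly_prod) (simp_all only: finite_lessThan hpoly_power[OF hpoly_dickson])
  show ?thesis
  proof (cases "S = {}")
    case True
    have "hpoly n 0 (\<lambda>X :: nat \<Rightarrow> 'p mod_ring poly. ext_basis J {} :: 'p mod_ring poly)" for J
      using hpoly_const[of n "of_bool ({} = J) :: 'p mod_ring"] by (cases "{} = J") (simp_all add: ext_basis_def one_pCons[symmetric])
    from hpoly_mult[OF this R] show ?thesis unfolding inv_form_def if_P[OF True] by blast
  next
    case False
    have "hpoly n (sum_list (map ((^) CARD('p)) (filter (\<lambda>s. s \<notin> S) [0..<n])) + (CARD('p) - 2) * sum_list (map ((^) CARD('p)) (filter (\<lambda>s. s \<notin> {}) [0..<n])))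
       (\<lambda>X :: nat \<Rightarrow> 'p mod_ring poly. mui n S X (ext_basis J) * vandermonde n X ^ (CARD('p) - 2))" if "J \<subseteq> {..<n}" for J
      by (rule hpoly_mult[OF hpoly_mui[OF that] hpoly_power[OF hpoly_mui]]) simp
    from hpoly_mult[OF this R] show ?thesis unfolding inv_form_def if_not_P[OF False] by blast
  qed
qed

text \<open>The leading monomial of the invariant form is identified indirectly. Some leading
  monomial exists; the value at its twists is nonzero, which forces its exterior part to be
  \<open>S\<close>, and uniqueness of the leading exponents of that value determines
  \<open>t\<close>.\<close>

theorem dual_functional:
  assumes I: "I \<in> admissible n" and n: "n \<ge> 1"
  obtains d J t and \<phi> :: "nat set \<Rightarrow> nat list \<Rightarrow> 'p::prime_card mod_ring"
  where "\<And>g. g \<in> GL n \<Longrightarrow> act_inv n d \<phi> (mat_fun g)"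
    "J \<subseteq> {..<n}" "t \<in> expos n d" "basis_monomial CARD('p) I = hmon_of n J t" "\<phi> J t \<noteq> 0"
    "\<And>J' t'. J' \<subseteq> {..<n} \<Longrightarrow> t' \<in> expos n d \<Longrightarrow> \<phi> J' t' \<noteq> 0 \<Longrightarrow>
       (J', t') = (J, t) \<or> lexless n (mon_key CARD('p) J' t') (mon_key CARD('p) J t)"
proof -
  have p2: "CARD('p) \<ge> 2" using prime_card[where 'a='p] prime_ge_2_nat by blast
  have lenI: "length I = n" and pos: "\<And>s. 1 \<le> s \<Longrightarrow> s < n \<Longrightarrow> 0 \<le> snd (I ! s)"
    and i0: "0 \<le> snd (I ! 0) + b_ind I - m_ind I" using I by (auto simp: admissible_def)
  define S where "S = {s. s < n \<and> fst (I ! s)}"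
  have S: "S \<subseteq> {..<n}" by (auto simp: S_def)
  have eps: "eps I s = of_bool (s \<in> S)" if "s < n" for s using that by (simp add: eps_def S_def)
  have m: "m_ind I = of_bool (S \<noteq> {})"
  proof -
    have "eps I ` {..<n} \<subseteq> {0, 1}" using eps by auto
    show ?thesis
    proof (cases "S = {}")
      case True
      then have "eps I ` {..<n} = (\<lambda>_. 0) ` {..<n}" using eps by (intro image_cong refl) simp
      then have "eps I ` {..<n} = {0}" using n by (simp add: image_constant_conv lessThan_empty_iff)
      then show ?thesis using True by (simp add: m_ind_def lenI)
    next
      case False
      then obtain s where s: "s \<in> S" "s < n" using S by auto
      have "Max (eps I ` {..<n}) = 1"
      proof (rule Max_eqI)
        show "1 \<in> eps I ` {..<n}" using s eps[OF s(2)] by (intro image_eqI[of _ _ s]) simp_all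
        fix y assume "y \<in> eps I ` {..<n}"
        then show "y \<le> 1" using eps by auto
      qed simp
      then show ?thesis using False by (simp add: m_ind_def lenI)
    qed
  qed
  \<comment> \<open>The Mui form and the Vandermonde power together add
    \<open>p ^ r + (p - 2) * p ^ r = p ^ r * (p - 1)\<close> to each exponent, one unit in every
    partial sum. This unit is m(I), so it is subtracted from the exponent of
    \<open>dickson n 0\<close>.\<close>
  define e where "e s = nat (if s = 0 then snd (I ! 0) + b_ind I - m_ind I else snd (I ! s))" for s
  have e0: "int (e 0) = snd (I ! 0) + b_ind I - m_ind I" using i0 by (simp add: e_def)
  have es: "int (e s) = snd (I ! s)" if "1 \<le> s" "s < n" for s using pos[OF that] that by (simp add: e_def)
  have psum: "(\<Sum>q\<le>r. snd (I ! q)) + b_ind I = m_ind I + (\<Sum>s\<le>r. int (e s))" if "r < n" for r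
    using that
  proof (induction r)
    case 0 then show ?case using e0 by simp
  next
    case (Suc r) then show ?case using es[of "Suc r"] by simp
  qed
  obtain d where d: "\<And>J. J \<subseteq> {..<n} \<Longrightarrow> hpoly n d (\<lambda>X :: nat \<Rightarrow> 'p mod_ring poly. inv_form n S e X (ext_basis J))"
    using hpoly_inv_form[of n S e, where 'p='p] by blast
  define \<phi> :: "nat set \<Rightarrow> nat list \<Rightarrow> 'p mod_ring" where
    "\<phi> J = (SOME c. \<forall>X. inv_form n S e X (ext_basis J) = hev n d c X)" for J
  have phi: "hev n d (\<phi> J) X = inv_form n S e X (ext_basis J)" if "J \<subseteq> {..<n}" for J X
  proof -
    have "\<exists>c. \<forall>X :: nat \<Rightarrow> 'p mod_ring poly. inv_form n S e X (ext_basis J) = hev n d c X"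
      using d[OF that] unfolding hpoly_def .
    then have "\<forall>X :: nat \<Rightarrow> 'p mod_ring poly. inv_form n S e X (ext_basis J) = hev n d (\<phi> J) X"
      unfolding \<phi>_def by (rule someI_ex)
    then have "inv_form n S e X (ext_basis J) = hev n d (\<phi> J) X" by (rule spec)
    then show ?thesis by (rule sym)
  qed
  have form: "form n d \<phi> X D = inv_form n S e X D" for X D
    unfolding form_def inv_form_expand[of n S e X D] by (intro sum.cong refl) (simp add: phi mult.commute)
  have inv: "act_inv n d \<phi> (mat_fun g)" if "g \<in> GL n" for g
    by (rule act_invI) (simp only: form inv_form_invariant[OF that])
  have leadR: "lead n (\<lambda>X :: nat \<Rightarrow> 'p mod_ring poly. \<Prod>s<n. dickson n s X ^ e s)
      (\<lambda>r. \<Sum>s<n. e s * (if s \<le> r then CARD('p mod_ring) ^ r * (CARD('p mod_ring) - 1) else 0))"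
    by (rule lead_prod) (simp_all only: finite_lessThan lead_power[OF lead_dickson] lessThan_iff less_imp_le)
  have sumR: "(\<Sum>s<n. e s * (if s \<le> r then CARD('p mod_ring) ^ r * (CARD('p mod_ring) - 1) else 0))
      = CARD('p) ^ r * (CARD('p) - 1) * (\<Sum>s\<le>r. e s)" if "r < n" for r
  proof -
    have "(\<Sum>s<n. e s * (if s \<le> r then CARD('p mod_ring) ^ r * (CARD('p mod_ring) - 1) else 0))
        = (\<Sum>s\<le>r. e s * (CARD('p) ^ r * (CARD('p) - 1)))"
      by (rule sum.mono_neutral_cong_right) (use that in auto)
    then show ?thesis by (simp add: sum_distrib_right[symmetric] mult.commute)
  qed
  define m where "m = (if S = {} then 0 else 1 :: nat)"
  define T where "T r = CARD('p) ^ r * (CARD('p) - 1) * (m + (\<Sum>s\<le>r. e s))" for r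
  have lead: "lead n (\<lambda>X :: nat \<Rightarrow> 'p mod_ring poly. inv_form n S e X (frob_wedge CARD('p) js X (ext_basis {}))) T"
    if js: "distinct js" "set js = S" for js
  proof (cases "S = {}")
    case True
    then have "js = []" using js by simp
    then have "inv_form n S e X (frob_wedge CARD('p) js X (ext_basis {})) = (\<Prod>s<n. dickson n s X ^ e s)" for X :: "nat \<Rightarrow> 'p mod_ring poly"
      using True by (simp add: inv_form_def ext_basis_def)
    then have "lead n (\<lambda>X :: nat \<Rightarrow> 'p mod_ring poly. inv_form n S e X (frob_wedge CARD('p) js X (ext_basis {})))
       (\<lambda>r. \<Sum>s<n. e s * (if s \<le> r then CARD('p mod_ring) ^ r * (CARD('p mod_ring) - 1) else 0))" using leadR by simp
    then show ?thesis by (rule lead_cong) (simp only: sumR T_def m_def if_P[OF True] add_0)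
  next
    case False
    have "lead n (\<lambda>X :: nat \<Rightarrow> 'p mod_ring poly. inv_form n S e X (frob_wedge CARD('p) js X (ext_basis {})))
       (\<lambda>r. CARD('p) ^ r + (CARD('p) - 2) * CARD('p) ^ r + (\<Sum>s<n. e s * (if s \<le> r then CARD('p mod_ring) ^ r * (CARD('p mod_ring) - 1) else 0)))"
      unfolding inv_form_def if_not_P[OF False]
      by (rule lead_mult[OF lead_mult[OF lead_mui[OF js S] lead_power[OF lead_vandermonde_power]] leadR])
    then show ?thesis
    proof (rule lead_cong)
      fix r assume "r < n"
      have "CARD('p) ^ r + (CARD('p) - 2) * CARD('p) ^ r = CARD('p) ^ r * (CARD('p) - 1)"
        using p2 by (simp add: algebra_simps)
      then show "CARD('p) ^ r + (CARD('p) - 2) * CARD('p) ^ r + (\<Sum>s<n. e s * (if s \<le> r then CARD('p mod_ring) ^ r * (CARD('p mod_ring) - 1) else 0)) = T r"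
        unfolding sumR[OF \<open>r < n\<close>] T_def m_def if_not_P[OF False] by (simp only: distrib_left mult_1_right)
    qed
  qed
  have "\<exists>I0 s0. I0 \<subseteq> {..<n} \<and> s0 \<in> expos n d \<and> \<phi> I0 s0 \<noteq> 0"
  proof (rule ccontr)
    assume no: "\<not> ?thesis"
    then have "\<phi> I s = 0" if "I \<in> Pow {..<n}" "s \<in> expos n d" for I s using that by blast
    then have "form n d \<phi> X D = 0" for X D
      unfolding form_alt by (intro sum.neutral ballI) simp
    moreover have "finite S" using S finite_subset by blast
    then have "lead n (\<lambda>X :: nat \<Rightarrow> 'p mod_ring poly. inv_form n S e X (frob_wedge CARD('p) (sorted_list_of_set S) X (ext_basis {}))) T"
      by (intro lead) simp_all
    then obtain B where "inv_form n S e (kron B :: nat \<Rightarrow> 'p mod_ring poly) (frob_wedge CARD('p) (sorted_list_of_set S) (kron B) (ext_basis {})) \<noteq> 0"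
      unfolding lead_def by blast
    ultimately show False unfolding form by blast
  qed
  then obtain I0 s0 where I0: "I0 \<subseteq> {..<n}" "s0 \<in> expos n d" "\<phi> I0 s0 \<noteq> 0" by blast
  obtain J t where J: "J \<subseteq> {..<n}" and t: "t \<in> expos n d" "\<phi> J t \<noteq> 0"
    and max: "\<And>I s. I \<subseteq> {..<n} \<Longrightarrow> s \<in> expos n d \<Longrightarrow> \<phi> I s \<noteq> 0 \<Longrightarrow>
       (I, s) = (J, t) \<or> lexless n (mon_key CARD('p) I s) (mon_key CARD('p) J t)"
  proof (rule leading_monomial_exists[OF p2, of I0 n s0 d \<phi>, OF I0])
    fix J t assume a: "J \<subseteq> {..<n}" "t \<in> expos n d" "\<phi> J t \<noteq> 0"
      "\<And>I s. I \<subseteq> {..<n} \<Longrightarrow> s \<in> expos n d \<Longrightarrow> \<phi> I s \<noteq> 0 \<Longrightarrow>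
         (I, s) = (J, t) \<or> lexless n (mon_key CARD('p) I s) (mon_key CARD('p) J t)"
    show thesis by (rule that[OF a])
  qed
  have fJ: "finite J" using J finite_subset by blast
  define js where "js = sorted_list_of_set J"
  have js: "distinct js" "set js = J" using fJ by (simp_all add: js_def)
  have lead2: "lead n (\<lambda>X :: nat \<Rightarrow> 'p mod_ring poly. inv_form n S e X (frob_wedge CARD('p) js X (ext_basis {}))) (\<lambda>r. t ! r + (if r \<in> J then CARD('p) ^ r else 0))"
    unfolding form[symmetric]
  proof (rule lead_form)
    fix J' s assume "J' \<subseteq> {..<n}" "s \<in> expos n d" "\<phi> J' s \<noteq> 0"
    then show "(J', s) = (J, t) \<or> lexless n (mon_key CARD('p) J' s) (mon_key CARD('p) J t)" by (rule max)
  qed (fact p2 js J t)+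
  then obtain B where B: "inv_form n S e (kron B :: nat \<Rightarrow> 'p mod_ring poly) (frob_wedge CARD('p) js (kron B) (ext_basis {})) \<noteq> 0"
    unfolding lead_def by blast
  \<comment> \<open>For \<open>S = {}\<close> the form reads only the coordinate at
    \<open>{}\<close>, where every product with at least one vector factor vanishes.\<close>
  have JS: "J = S"
  proof (cases "S = {}")
    case True
    have "frob_wedge CARD('p) js (kron B :: nat \<Rightarrow> 'p mod_ring poly) (ext_basis {}) {} \<noteq> 0"
    proof
      assume z: "frob_wedge CARD('p) js (kron B :: nat \<Rightarrow> 'p mod_ring poly) (ext_basis {}) {} = 0"
      show False using B unfolding inv_form_def if_P[OF True] z by (simp only: mult_zero_left simp_thms)
    qed
    moreover have "frob_wedge CARD('p) (a # l) (kron B :: nat \<Rightarrow> 'p mod_ring poly) (ext_basis {}) {} = 0" for a l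
      by (simp only: list.map wedges_Cons sum.empty)
    ultimately have "js = []" by (cases js) blast+
    then show ?thesis using True js by simp
  next
    case False
    have "mui n S (kron B) (frob_wedge CARD('p) js (kron B :: nat \<Rightarrow> 'p mod_ring poly) (ext_basis {})) \<noteq> 0"
    proof
      assume z: "mui n S (kron B) (frob_wedge CARD('p) js (kron B :: nat \<Rightarrow> 'p mod_ring poly) (ext_basis {})) = 0"
      show False using B unfolding inv_form_def if_not_P[OF False] z by (simp only: mult_zero_left simp_thms)
    qed
    from mui_frob_wedge[OF js(1) _ this S] show ?thesis using js(2) J by simp
  qed
  have lenT: "length t = n" using t(1) by (simp add: expos_def)
  have T: "t ! r + (if r \<in> S then CARD('p) ^ r else 0) = T r" if "r < n" for r
    using lead_unique[OF lead2 lead[OF js(1)] that] js JS by simp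
  have bm: "basis_monomial CARD('p) I = hmon_of n J t"
  proof (rule nth_equalityI)
    fix r assume "r < length (basis_monomial CARD('p) I)"
    then have r: "r < n" by (simp add: basis_monomial_def lenI)
    have "int (T r) = int CARD('p) ^ r * (int CARD('p) - 1) * (m_ind I + (\<Sum>s\<le>r. int (e s)))"
      unfolding T_def \<open>m_ind I = of_bool (S \<noteq> {})\<close> m_def using p2 by (simp add: of_nat_diff)
    then have "v_exponent CARD('p) I r = int (T r) - int CARD('p) ^ r * of_bool (r \<in> S)"
      unfolding v_exponent_def psum[OF r] eps[OF r] by simp
    also have "\<dots> = int (t ! r)" unfolding T[OF r, symmetric] by simp
    finally show "basis_monomial CARD('p) I ! r = hmon_of n J t ! r"
      using r by (simp add: basis_monomial_def lenI JS S_def)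
  qed (simp add: basis_monomial_def lenI)
  show ?thesis by (rule that[where d = d and J = J and t = t and \<phi> = \<phi>]) (rule inv J t bm max; assumption)+
qed

section \<open>Linear functionals on homology\<close>

definition lin_fun :: "(hmon \<Rightarrow> 'k::field) \<Rightarrow> 'k hom_elt \<Rightarrow> 'k" where
  "lin_fun w f = (\<Sum>x\<in>Poly_Mapping.keys f. Poly_Mapping.lookup f x * w x)"

lemma lin_fun_superset:
  assumes "finite A" "Poly_Mapping.keys f \<subseteq> A"
  shows "lin_fun w f = (\<Sum>x\<in>A. Poly_Mapping.lookup f x * w x)"
  unfolding lin_fun_def by (rule sum.mono_neutral_left) (use assms in \<open>auto simp: in_keys_iff\<close>)

lemma lin_fun_add: "lin_fun w (f + g) = lin_fun w f + lin_fun w g"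
proof -
  let ?A = "Poly_Mapping.keys f \<union> Poly_Mapping.keys g"
  have "finite ?A" by simp
  note S = lin_fun_superset[OF this, of _ w]
  have "lin_fun w (f + g) = (\<Sum>x\<in>?A. Poly_Mapping.lookup (f + g) x * w x)"
    by (rule S) (rule Poly_Mapping.keys_add)
  also have "\<dots> = (\<Sum>x\<in>?A. Poly_Mapping.lookup f x * w x) + (\<Sum>x\<in>?A. Poly_Mapping.lookup g x * w x)"
    by (simp add: lookup_add distrib_right sum.distrib)
  also have "\<dots> = lin_fun w f + lin_fun w g" using S[of f] S[of g] by simp
  finally show ?thesis .
qed

lemma keys_hom_smult: "Poly_Mapping.keys (hom_smult c f) \<subseteq> Poly_Mapping.keys f"
  by (auto simp: in_keys_iff lookup_hom_smult)

lemma lin_fun_smult: "lin_fun w (hom_smult c f) = c * lin_fun w f"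
proof -
  have "lin_fun w (hom_smult c f) = (\<Sum>x\<in>Poly_Mapping.keys f. Poly_Mapping.lookup (hom_smult c f) x * w x)"
    by (rule lin_fun_superset[OF finite_keys keys_hom_smult])
  then show ?thesis by (simp add: lin_fun_def lookup_hom_smult sum_distrib_left mult.assoc)
qed

lemma lin_fun_0: "lin_fun w 0 = 0"
  by (simp add: lin_fun_def)

lemma lin_fun_sum: "lin_fun w (\<Sum>i\<in>A. f i) = (\<Sum>i\<in>A. lin_fun w (f i))"
  by (induction A rule: infinite_finite_induct) (simp_all add: lin_fun_0 lin_fun_add)

lemma hom_smult_minus_one: "hom_smult (-1) f = - f"
  by (rule poly_mapping_eqI) (simp add: lookup_hom_smult)

lemma lin_fun_diff: "lin_fun w (f - g) = lin_fun w f - lin_fun w g"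
  using lin_fun_add[of w f "- g"] lin_fun_smult[of w "-1" g] by (simp add: hom_smult_minus_one)

lemma lin_fun_single: "lin_fun w (Poly_Mapping.single x c) = c * w x"
proof -
  have "lin_fun w (Poly_Mapping.single x c) = (\<Sum>y\<in>{x}. Poly_Mapping.lookup (Poly_Mapping.single x c) y * w y)"
    by (rule lin_fun_superset) simp_all
  then show ?thesis by simp
qed

lemma lin_fun_GL_act: "lin_fun w (GL_act n g z) = (\<Sum>x\<in>Poly_Mapping.keys z. Poly_Mapping.lookup z x * lin_fun w (GL_act_mon n g x))"
  by (simp add: GL_act_def lin_fun_sum lin_fun_smult)

lemma lin_fun_GL_act_mon:
  fixes g :: "'k::field mat"
  assumes "I \<subseteq> {..<n}" "s \<in> expos n d"
  shows "lin_fun w (GL_act_mon n g (hmon_of n I s)) =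
    (\<Sum>J\<in>Pow {..<n}. \<Sum>t\<in>expos n d. ext_cols (mat_fun g) n I J * div_coeff n (mat_cols (mat_fun g) n) s t * w (hmon_of n J t))"
proof -
  have s: "length s = n" "sum_list s = d" using assms(2) by (simp_all add: expos_def)
  let ?f = "GL_act_mon n g (hmon_of n I s)" and ?h = "\<lambda>(J, t). hmon_of n J t"
  let ?P = "Pow {..<n} \<times> expos n d"
  have sub: "Poly_Mapping.keys ?f \<subseteq> ?h ` ?P"
  proof
    fix y assume y: "y \<in> Poly_Mapping.keys ?f"
    then have len: "length y = n" using GL_act_mon_closed[of n g "hmon_of n I s"] by (simp add: in_homology)
    have yh: "y = hmon_of n (u_set y) (map snd y)" using hmon_of_eta[OF len] by simp
    have "Poly_Mapping.lookup ?f (hmon_of n (u_set y) (map snd y)) \<noteq> 0" using y yh by (simp add: in_keys_iff)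
    then have "div_coeff n (mat_cols (mat_fun g) n) s (map snd y) \<noteq> 0"
      using lookup_GL_act_mon[OF assms(1) s(1) u_set_subset[OF len], of "map snd y" g] len by simp
    then have "sum_list s = sum_list (map snd y)" by (intro div_coeff_degree) (simp_all add: s len)
    then have "(u_set y, map snd y) \<in> ?P" using u_set_subset[OF len] len s by (simp add: expos_def)
    then show "y \<in> ?h ` ?P" by (rule rev_image_eqI) (simp add: yh[symmetric])
  qed
  have inj: "inj_on ?h ?P"
  proof (rule inj_onI, clarify)
    fix J t J' t' assume *: "J \<subseteq> {..<n}" "t \<in> expos n d" "J' \<subseteq> {..<n}" "t' \<in> expos n d" "hmon_of n J t = hmon_of n J' t'"
    then show "J = J' \<and> t = t'" by (subst (asm) hmon_of_eq_iff) (simp_all add: expos_def)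
  qed
  have "lin_fun w ?f = (\<Sum>y\<in>?h ` ?P. Poly_Mapping.lookup ?f y * w y)"
    by (rule lin_fun_superset[OF _ sub]) simp
  also have "\<dots> = (\<Sum>(J, t)\<in>?P. Poly_Mapping.lookup ?f (hmon_of n J t) * w (hmon_of n J t))"
    by (subst sum.reindex[OF inj]) (simp add: case_prod_unfold comp_def)
  also have "\<dots> = (\<Sum>(J, t)\<in>?P. ext_cols (mat_fun g) n I J * div_coeff n (mat_cols (mat_fun g) n) s t * w (hmon_of n J t))"
  proof (rule sum.cong[OF refl], clarify)
    fix J t assume "J \<subseteq> {..<n}" "t \<in> expos n d"
    then show "Poly_Mapping.lookup ?f (hmon_of n J t) * w (hmon_of n J t) =
        ext_cols (mat_fun g) n I J * div_coeff n (mat_cols (mat_fun g) n) s t * w (hmon_of n J t)"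
      by (subst lookup_GL_act_mon) (simp_all add: assms s expos_def)
  qed
  finally show ?thesis by (simp add: sum.cartesian_product)
qed

section \<open>The module of relations\<close>

lemma homology_simps:
  "add (homology n) = (+)" "zero (homology n) = 0" "smult (homology n) = hom_smult"
  by (simp_all add: homology_def)

lemma coinv_relations_add: "u \<in> coinv_relations n \<Longrightarrow> v \<in> coinv_relations n \<Longrightarrow> u + v \<in> coinv_relations n"
  using submodule.m_closed[OF submodule_coinv] by (simp add: homology_simps)

lemma coinv_relations_0: "0 \<in> coinv_relations n"
  using submodule.zero_closed[OF submodule_coinv] by (simp add: homology_simps)

lemma coinv_relations_smult: "u \<in> coinv_relations n \<Longrightarrow> hom_smult c u \<in> coinv_relations n"
  using submodule.smult_closed[OF submodule_coinv, of c u] by (simp add: homology_simps)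

lemma coinv_relations_diff: "u \<in> coinv_relations n \<Longrightarrow> v \<in> coinv_relations n \<Longrightarrow> u - v \<in> coinv_relations n"
  using coinv_relations_add[of u n "- v"] coinv_relations_smult[of v n "-1"] by (simp add: hom_smult_minus_one)

lemma coinv_relation_generator:
  fixes z :: "'k::field hom_elt"
  assumes "g \<in> GL n" "z \<in> carrier (homology n)"
  shows "GL_act n g z - z \<in> coinv_relations n"
proof -
  interpret vectorspace class_ring "homology n :: ('k, 'k hom_elt) module" by (rule vs_homology)
  let ?S = "{GL_act n g z - z | g z. g \<in> GL n \<and> z \<in> carrier (homology n)} :: 'k hom_elt set"
  have "?S \<subseteq> carrier (homology n)" by (auto intro: hom_minus_closed GL_act_closed)
  then have "?S \<subseteq> coinv_relations n" unfolding coinv_relations_def by (rule in_own_span)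
  then show ?thesis using assms by blast
qed

text \<open>The kernel of the functional is a submodule containing the generators of the
  relations.\<close>

lemma lin_fun_coinv_relations:
  fixes w :: "hmon \<Rightarrow> 'k::field"
  assumes inv: "\<And>g z. g \<in> GL n \<Longrightarrow> z \<in> carrier (homology n) \<Longrightarrow> lin_fun w (GL_act n g z) = lin_fun w z"
    and z: "z \<in> coinv_relations n"
  shows "lin_fun w z = 0"
proof -
  interpret vectorspace class_ring "homology n :: ('k, 'k hom_elt) module" by (rule vs_homology)
  let ?N = "{z \<in> carrier (homology n). lin_fun w z = 0}"
  have "coinv_relations n \<subseteq> ?N"
    unfolding coinv_relations_def
  proof (rule span_is_subset)
    show "{GL_act n g z - z | g z. g \<in> GL n \<and> z \<in> carrier (homology n)} \<subseteq> ?N"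
      by (auto simp: lin_fun_diff inv intro: hom_minus_closed GL_act_closed)
    show "submodule class_ring ?N (homology n)"
      unfolding submodule_def
      by (auto simp: homology_simps lin_fun_add lin_fun_0 lin_fun_smult hom_zero_closed hom_add_closed hom_smult_closed module_axioms)
  qed
  then show ?thesis using z by blast
qed

section \<open>Arithmetic of classes in the quotient\<close>

lemma coinv_class_eq: "coinv_class n z = (\<lambda>u. u + z) ` coinv_relations n"
  by (auto simp: coinv_class_def a_r_coset_def' homology_simps)

lemma coinv_class_eq_iff:
  fixes y z :: "'k::field hom_elt"
  shows "coinv_class n y = coinv_class n z \<longleftrightarrow> y - z \<in> coinv_relations n"
proof
  assume "coinv_class n y = coinv_class n z"
  moreover have "y \<in> coinv_class n y"
    unfolding coinv_class_eq by (rule rev_image_eqI[OF coinv_relations_0]) simp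
  ultimately obtain u where "u \<in> coinv_relations n" "y = u + z" unfolding coinv_class_eq by blast
  then show "y - z \<in> coinv_relations n" by simp
next
  assume yz: "y - z \<in> coinv_relations n"
  show "coinv_class n y = coinv_class n z"
    unfolding coinv_class_eq
  proof (intro equalityI image_subsetI)
    fix u :: "'k hom_elt" assume u: "u \<in> coinv_relations n"
    show "u + y \<in> (\<lambda>u. u + z) ` coinv_relations n"
      by (rule rev_image_eqI[OF coinv_relations_add[OF u yz]]) simp
    show "u + z \<in> (\<lambda>u. u + y) ` coinv_relations n"
      by (rule rev_image_eqI[OF coinv_relations_diff[OF u yz]]) simp
  qed
qed

lemma coinvariants_simps:
  "zero (coinvariants n) = coinv_class n 0"
  "carrier (coinvariants n) = coinv_class n ` carrier (homology n)"
proof -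
  show "zero (coinvariants n) = coinv_class n 0"
    by (simp add: coinvariants_def quotient_module_def coinv_class_eq)
  show "carrier (coinvariants n) = coinv_class n ` carrier (homology n)"
    by (auto simp: coinvariants_def quotient_module_def A_RCOSETS_def' coinv_class_def)
qed

lemma coinvariants_add: "add (coinvariants n) (coinv_class n y) (coinv_class n z) = coinv_class n (y + z)"
proof -
  have "add (coinvariants n) (coinv_class n y) (coinv_class n z) = (\<Union>u\<in>coinv_class n y. \<Union>v\<in>coinv_class n z. {u + v})"
    by (simp add: coinvariants_def quotient_module_def set_add_def set_mult_def homology_simps)
  also have "\<dots> = coinv_class n (y + z)"
  proof (intro equalityI subsetI)
    fix x assume "x \<in> (\<Union>u\<in>coinv_class n y. \<Union>v\<in>coinv_class n z. {u + v})"
    then obtain u v where uv: "u \<in> coinv_relations n" "v \<in> coinv_relations n" "x = (u + y) + (v + z)"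
      unfolding coinv_class_eq by blast
    show "x \<in> coinv_class n (y + z)"
      unfolding coinv_class_eq by (rule rev_image_eqI[OF coinv_relations_add[OF uv(1,2)]]) (simp add: uv(3) add_ac)
  next
    fix x assume "x \<in> coinv_class n (y + z)"
    then obtain u where u: "u \<in> coinv_relations n" "x = u + (y + z)" unfolding coinv_class_eq by blast
    have "u + y \<in> coinv_class n y" "0 + z \<in> coinv_class n z"
      unfolding coinv_class_eq using u(1) coinv_relations_0 by blast+
    moreover have "x = (u + y) + (0 + z)" using u(2) by (simp add: add_ac)
    ultimately show "x \<in> (\<Union>u\<in>coinv_class n y. \<Union>v\<in>coinv_class n z. {u + v})" by blast
  qed
  finally show ?thesis .
qed

lemma hom_smult_add: "hom_smult c (f + g) = hom_smult c f + hom_smult c g"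
  by (rule poly_mapping_eqI) (simp add: lookup_hom_smult lookup_add distrib_left)

lemma coinvariants_smult: "smult (coinvariants n) c (coinv_class n z) = coinv_class n (hom_smult c z)"
proof -
  have "smult (coinvariants n) c (coinv_class n z) = (\<Union>x\<in>coinv_class n z. coinv_class n (hom_smult c x))"
    by (simp add: coinvariants_def quotient_module_def coinv_class_def homology_simps)
  also have "\<dots> = (\<Union>x\<in>coinv_class n z. coinv_class n (hom_smult c z))"
  proof (rule SUP_cong[OF refl])
    fix x assume "x \<in> coinv_class n z"
    then obtain u where u: "u \<in> coinv_relations n" "x = u + z" unfolding coinv_class_eq by blast
    have "hom_smult c x - hom_smult c z = hom_smult c u" unfolding u(2) hom_smult_add by simp
    then show "coinv_class n (hom_smult c x) = coinv_class n (hom_smult c z)"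
      unfolding coinv_class_eq_iff using coinv_relations_smult[OF u(1)] by simp
  qed
  also have "coinv_class n z \<noteq> {}" unfolding coinv_class_eq using coinv_relations_0 by blast
  then have "(\<Union>x\<in>coinv_class n z. coinv_class n (hom_smult c z)) = coinv_class n (hom_smult c z)" by simp
  finally show ?thesis .
qed

lemma finsum_coinvariants:
  fixes z :: "'i \<Rightarrow> 'k::field hom_elt"
  assumes "finite T" "\<And>i. i \<in> T \<Longrightarrow> z i \<in> carrier (homology n)"
  shows "finsum (coinvariants n) (\<lambda>i. smult (coinvariants n) (c i) (coinv_class n (z i))) T
     = coinv_class n (\<Sum>i\<in>T. hom_smult (c i) (z i))"
proof -
  interpret vectorspace class_ring "coinvariants n :: ('k, 'k hom_elt set) module" by (rule vs_coinvariants)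
  show ?thesis using assms
  proof (induction T rule: finite_induct)
    case empty
    show ?case by (simp add: coinvariants_simps)
  next
    case (insert i T)
    have cl: "smult (coinvariants n) (c j) (coinv_class n (z j)) \<in> carrier (coinvariants n)" if "j \<in> insert i T" for j
      unfolding coinvariants_smult coinvariants_simps using insert.prems[OF that] by (intro imageI hom_smult_closed)
    have "finsum (coinvariants n) (\<lambda>i. smult (coinvariants n) (c i) (coinv_class n (z i))) (insert i T)
       = add (coinvariants n) (smult (coinvariants n) (c i) (coinv_class n (z i)))
          (finsum (coinvariants n) (\<lambda>i. smult (coinvariants n) (c i) (coinv_class n (z i))) T)"
      by (rule finsum_insert[OF insert.hyps]) (use cl in auto)
    also have "\<dots> = coinv_class n (hom_smult (c i) (z i) + (\<Sum>i\<in>T. hom_smult (c i) (z i)))"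
    proof -
      have IH: "finsum (coinvariants n) (\<lambda>i. smult (coinvariants n) (c i) (coinv_class n (z i))) T
          = coinv_class n (\<Sum>i\<in>T. hom_smult (c i) (z i))"
        by (rule insert.IH) (use insert.prems in blast)
      show ?thesis unfolding IH unfolding coinvariants_smult coinvariants_add ..
    qed
    finally show ?case using insert.hyps by simp
  qed
qed

section \<open>Linear independence of the basis classes\<close>

text \<open>The flags determine b(I). Since the exponents are nonnegative, \<open>nat\<close> loses
  nothing, so the partial sums and then the entries can be read off.\<close>

lemma basis_monomial_inj:
  assumes p: "p \<ge> 2" and I: "I \<in> admissible n" and I': "I' \<in> admissible n"
    and eq: "basis_monomial p I = basis_monomial p I'"
  shows "I = I'"
proof -
  have len: "length I = n" "length I' = n" using I I' by (simp_all add: admissible_def)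
  have nth: "fst (I ! s) = fst (I' ! s)" "nat (v_exponent p I s) = nat (v_exponent p I' s)" if "s < n" for s
  proof -
    have "basis_monomial p I ! s = basis_monomial p I' ! s" using eq by simp
    then show "fst (I ! s) = fst (I' ! s)" "nat (v_exponent p I s) = nat (v_exponent p I' s)"
      using that by (simp_all add: basis_monomial_def len)
  qed
  have eps: "eps I s = eps I' s" if "s < n" for s using nth(1)[OF that] by (simp add: eps_def)
  then have b: "b_ind I = b_ind I'" by (simp add: b_ind_def len)
  have sum: "(\<Sum>r\<le>s. snd (I ! r)) = (\<Sum>r\<le>s. snd (I' ! r))" if s: "s < n" for s
  proof -
    have "v_exponent p I s = v_exponent p I' s"
      using nth(2)[OF s] v_exponent_nonneg[OF p I s] v_exponent_nonneg[OF p I' s] by simp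
    then have "int p ^ s * (int p - 1) * ((\<Sum>r\<le>s. snd (I ! r)) + b_ind I') = int p ^ s * (int p - 1) * ((\<Sum>r\<le>s. snd (I' ! r)) + b_ind I')"
      by (simp only: v_exponent_def eps[OF s] b diff_right_commute diff_cancel)
    then show ?thesis using p by simp
  qed
  show ?thesis
  proof (rule nth_equalityI)
    fix s assume "s < length I"
    then have s: "s < n" using len by simp
    have "snd (I ! s) = snd (I' ! s)"
    proof (cases s)
      case 0 then show ?thesis using sum[OF s] by simp
    next
      case (Suc r) then show ?thesis using sum[OF s] sum[of r] s by simp
    qed
    then show "I ! s = I' ! s" using nth(1)[OF s] by (simp add: prod_eq_iff)
  qed (simp add: len)
qed

lemma basis_monomial_length: "I \<in> admissible n \<Longrightarrow> length (basis_monomial p I) = n"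
  by (simp add: basis_monomial_def admissible_def)

text \<open>The functional is extended by zero to the other degrees; it stays invariant because the
  action preserves the degree.\<close>

lemma lin_fun_invariant:
  fixes \<phi> :: "nat set \<Rightarrow> nat list \<Rightarrow> 'k::field"
  assumes inv: "act_inv n d \<phi> (mat_fun g)" and z: "z \<in> carrier (homology n)"
  defines "w \<equiv> \<lambda>x. if sum_list (map snd x) = d then \<phi> (u_set x) (map snd x) else 0"
  shows "lin_fun w (GL_act n g z) = lin_fun w z"
proof -
  have w: "w (hmon_of n J t) = (if e = d then \<phi> J t else 0)" if "J \<subseteq> {..<n}" "t \<in> expos n e" for J t e
    using that by (simp add: w_def expos_def)
  have "lin_fun w (GL_act_mon n g x) = w x" if x: "x \<in> Poly_Mapping.keys z" for x
  proof -
    have len: "length x = n" using x z by (simp add: in_homology)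
    define I where "I = u_set x"
    define s where "s = map snd x"
    have I: "I \<subseteq> {..<n}" unfolding I_def by (rule u_set_subset[OF len])
    have s: "s \<in> expos n (sum_list s)" by (simp add: expos_def s_def len)
    have xh: "x = hmon_of n I s" unfolding I_def s_def by (rule hmon_of_eta[OF len, symmetric])
    have "lin_fun w (GL_act_mon n g (hmon_of n I s)) =
      (\<Sum>J\<in>Pow {..<n}. \<Sum>t\<in>expos n (sum_list s). ext_cols (mat_fun g) n I J * div_coeff n (mat_cols (mat_fun g) n) s t * (if sum_list s = d then \<phi> J t else 0))"
      unfolding lin_fun_GL_act_mon[OF I s] by (intro sum.cong refl) (simp add: w)
    also have "\<dots> = (if sum_list s = d then \<phi> I s else 0)"
    proof (cases "sum_list s = d")
      case True
      then have "s \<in> expos n d" using s by simp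
      then show ?thesis using inv I True unfolding act_inv_def by simp
    qed simp
    finally show ?thesis unfolding xh using w[OF I s] by simp
  qed
  then show ?thesis unfolding lin_fun_GL_act by (simp add: lin_fun_def)
qed

text \<open>Among the indices with nonzero coefficient, \<open>K\<close> has the smallest key. Its
  dual functional vanishes on all monomials of the relation other than that of \<open>K\<close>, so
  applying it leaves the \<open>K\<close>th term alone.\<close>

lemma independent_mod_relations:
  fixes c :: "ind_seq \<Rightarrow> 'p::prime_card mod_ring"
  assumes n: "n \<ge> 1" and T: "finite T" "T \<subseteq> admissible n"
    and rel: "(\<Sum>I\<in>T. hom_smult (c I) (hmonomial (basis_monomial CARD('p) I))) \<in> coinv_relations n"
    and "I \<in> T"
  shows "c I = 0"
proof (rule ccontr)
  assume "c I \<noteq> 0"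
  have p2: "CARD('p) \<ge> 2" using prime_card[where 'a='p] prime_ge_2_nat by blast
  let ?bm = "basis_monomial CARD('p)"
  let ?key = "\<lambda>I. mon_key CARD('p) (u_set (?bm I)) (map snd (?bm I))"
  \<comment> \<open>The sum of all digits of the finitely many keys, plus one, exceeds each
    digit.\<close>
  define B where "B = (\<Sum>I\<in>T. \<Sum>i<n. ?key I i) + 1"
  have key_less: "?key I i < B" if "I \<in> T" "i < n" for I i
  proof -
    have "?key I i \<le> (\<Sum>i<n. ?key I i)" by (rule member_le_sum) (use that in simp_all)
    also have "\<dots> \<le> (\<Sum>I\<in>T. \<Sum>i<n. ?key I i)" by (rule member_le_sum) (use that T in simp_all)
    finally show ?thesis by (simp add: B_def)
  qed
  let ?T = "{I\<in>T. c I \<noteq> 0}" and ?e = "\<lambda>I. enc B n (?key I)"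
  have fin: "finite ?T" "?T \<noteq> {}" using T(1) \<open>I \<in> T\<close> \<open>c I \<noteq> 0\<close> by auto
  then have "Min (?e ` ?T) \<in> ?e ` ?T" by (intro Min_in) simp_all
  then obtain K where K: "Min (?e ` ?T) = ?e K" "K \<in> ?T" by (rule imageE)
  have min: "?e K \<le> ?e I" if "I \<in> ?T" for I
    unfolding K(1)[symmetric] using fin(1) that by (intro Min_le) blast+
  have KT: "K \<in> T" "c K \<noteq> 0" "K \<in> admissible n" using K(2) T(2) by auto
  obtain d J t and \<phi> :: "nat set \<Rightarrow> nat list \<Rightarrow> 'p mod_ring"
    where inv: "\<And>g. g \<in> GL n \<Longrightarrow> act_inv n d \<phi> (mat_fun g)"
      and J: "J \<subseteq> {..<n}" and t: "t \<in> expos n d" and bm: "?bm K = hmon_of n J t" and nz: "\<phi> J t \<noteq> 0"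
      and max: "\<And>J' t'. J' \<subseteq> {..<n} \<Longrightarrow> t' \<in> expos n d \<Longrightarrow> \<phi> J' t' \<noteq> 0 \<Longrightarrow>
       (J', t') = (J, t) \<or> lexless n (mon_key CARD('p) J' t') (mon_key CARD('p) J t)"
  proof (rule dual_functional[OF KT(3) n])
    fix d J t and \<phi> :: "nat set \<Rightarrow> nat list \<Rightarrow> 'p mod_ring"
    assume a: "\<And>g. g \<in> GL n \<Longrightarrow> act_inv n d \<phi> (mat_fun g)"
      "J \<subseteq> {..<n}" "t \<in> expos n d" "?bm K = hmon_of n J t" "\<phi> J t \<noteq> 0"
      "\<And>J' t'. J' \<subseteq> {..<n} \<Longrightarrow> t' \<in> expos n d \<Longrightarrow> \<phi> J' t' \<noteq> 0 \<Longrightarrow>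
         (J', t') = (J, t) \<or> lexless n (mon_key CARD('p) J' t') (mon_key CARD('p) J t)"
    show thesis by (rule that[OF a])
  qed
  have lent: "length t = n" using t by (simp add: expos_def)
  have keyK: "?key K = mon_key CARD('p) J t" using J lent by (simp add: bm)
  define w where "w x = (if sum_list (map snd x) = d then \<phi> (u_set x) (map snd x) else 0)" for x
  have "lin_fun w (\<Sum>I\<in>T. hom_smult (c I) (hmonomial (?bm I))) = 0"
    by (rule lin_fun_coinv_relations[OF _ rel]) (unfold w_def, rule lin_fun_invariant[OF inv])
  then have "(\<Sum>I\<in>T. c I * w (?bm I)) = 0" by (simp add: lin_fun_sum lin_fun_smult lin_fun_single)
  also have "(\<Sum>I\<in>T. c I * w (?bm I)) = (\<Sum>I\<in>{K}. c I * w (?bm I))"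
  proof (rule sum.mono_neutral_right[OF T(1)])
    show "\<forall>I\<in>T - {K}. c I * w (?bm I) = 0"
    proof
      fix I assume I: "I \<in> T - {K}"
      show "c I * w (?bm I) = 0"
      proof (rule ccontr)
        assume "c I * w (?bm I) \<noteq> 0"
        then have cI: "c I \<noteq> 0" and wI: "w (?bm I) \<noteq> 0" by simp_all
        have I_adm: "I \<in> admissible n" using I T(2) by blast
        then have len: "length (?bm I) = n" by (rule basis_monomial_length)
        have s: "map snd (?bm I) \<in> expos n d" and ph: "\<phi> (u_set (?bm I)) (map snd (?bm I)) \<noteq> 0"
          using wI len by (auto simp: w_def expos_def split: if_splits)
        from max[OF u_set_subset[OF len] s ph] show False
        proof
          assume "(u_set (?bm I), map snd (?bm I)) = (J, t)"
          then have "?bm I = ?bm K" using hmon_of_eta[OF len] bm by simp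
          then have "I = K" by (rule basis_monomial_inj[OF p2 I_adm KT(3)])
          then show False using I by simp
        next
          assume "lexless n (?key I) (mon_key CARD('p) J t)"
          then have "lexless n (?key I) (?key K)" unfolding keyK .
          then have "?e I < ?e K" by (rule enc_lexless) (use key_less I in blast)
          moreover have "?e K \<le> ?e I" using I cI by (intro min) simp
          ultimately show False by simp
        qed
      qed
    qed
  qed (use KT in simp)
  finally have "c K * w (?bm K) = 0" by simp
  moreover have "w (?bm K) = \<phi> J t" using J t by (simp add: w_def bm expos_def)
  ultimately show False using KT(2) nz by simp
qed

section \<open>The basis classes span\<close>

lemma invariant_functional_zero:
  fixes w :: "hmon \<Rightarrow> 'p::prime_card mod_ring"
  assumes n: "n \<ge> 1"
    and rel: "\<And>g z. g \<in> GL n \<Longrightarrow> z \<in> carrier (homology n) \<Longrightarrow> lin_fun w (GL_act n g z - z) = 0"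
    and bas: "\<And>I. I \<in> admissible n \<Longrightarrow> w (basis_monomial CARD('p) I) = 0"
    and len: "length x = n"
  shows "w x = 0"
proof (rule ccontr)
  assume "w x \<noteq> 0"
  have p2: "CARD('p) \<ge> 2" using prime_card[where 'a='p] prime_ge_2_nat by blast
  define \<phi> where "\<phi> J t = w (hmon_of n J t)" for J t
  \<comment> \<open>Restricting to the degree of \<open>x\<close> leaves finitely many monomials, so
    that a leading one exists.\<close>
  define d where "d = sum_list (map snd x)"
  have inv: "act_inv n d \<phi> (mat_fun g)" if g: "g \<in> GL n" for g
    unfolding act_inv_def
  proof (intro ballI)
    fix I s assume I: "I \<in> Pow {..<n}" and s: "s \<in> expos n d"
    let ?x = "hmon_of n I s"
    have "lin_fun w (GL_act n g (hmonomial ?x) - hmonomial ?x) = 0"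
      by (rule rel[OF g]) (rule hom_single_closed, simp)
    then have "lin_fun w (GL_act_mon n g ?x) = w ?x"
      by (simp add: lin_fun_diff lin_fun_GL_act lin_fun_single)
    then show "(\<Sum>J\<in>Pow {..<n}. \<Sum>t\<in>expos n d. ext_cols (mat_fun g) n I J * div_coeff n (mat_cols (mat_fun g) n) s t * \<phi> J t) = \<phi> I s"
      unfolding \<phi>_def using lin_fun_GL_act_mon[of I n s d w g] I s by simp
  qed
  have nz: "\<phi> (u_set x) (map snd x) \<noteq> 0" using \<open>w x \<noteq> 0\<close> hmon_of_eta[OF len] by (simp add: \<phi>_def)
  have sx: "map snd x \<in> expos n d" by (simp add: expos_def d_def len)
  obtain J t where J: "J \<subseteq> {..<n}" and t: "t \<in> expos n d" "\<phi> J t \<noteq> 0"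
    and max: "\<And>I s. I \<subseteq> {..<n} \<Longrightarrow> s \<in> expos n d \<Longrightarrow> \<phi> I s \<noteq> 0 \<Longrightarrow>
       (I, s) = (J, t) \<or> lexless n (mon_key CARD('p) I s) (mon_key CARD('p) J t)"
  proof (rule leading_monomial_exists[OF p2 u_set_subset[OF len] sx, of \<phi>, OF nz])
    fix J t assume a: "J \<subseteq> {..<n}" "t \<in> expos n d" "\<phi> J t \<noteq> 0"
      "\<And>I s. I \<subseteq> {..<n} \<Longrightarrow> s \<in> expos n d \<Longrightarrow> \<phi> I s \<noteq> 0 \<Longrightarrow>
         (I, s) = (J, t) \<or> lexless n (mon_key CARD('p) I s) (mon_key CARD('p) J t)"
    show thesis by (rule that[OF a])
  qed
  note lead = invariant_leading[OF inv J t max]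
  have "\<exists>I\<in>admissible n. basis_monomial CARD('p) I = hmon_of n J t"
    by (rule basis_monomial_exists[OF p2 n J _ lead]) (use t in \<open>simp_all add: expos_def\<close>)
  then obtain I where I: "I \<in> admissible n" and eq: "basis_monomial CARD('p) I = hmon_of n J t" by (rule bexE)
  have "w (hmon_of n J t) = 0" using bas[OF I] unfolding eq .
  then show False using t(2) unfolding \<phi>_def by (rule notE[rotated])
qed

lemma hom_elt_expand: "f = (\<Sum>x\<in>Poly_Mapping.keys f. hom_smult (Poly_Mapping.lookup f x) (hmonomial x))"
proof (rule poly_mapping_eqI)
  fix y
  have "Poly_Mapping.lookup (\<Sum>x\<in>Poly_Mapping.keys f. hom_smult (Poly_Mapping.lookup f x) (hmonomial x)) y
    = (\<Sum>x\<in>Poly_Mapping.keys f. if x = y then Poly_Mapping.lookup f x else 0)"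
    unfolding lookup_sum by (rule sum.cong) (simp_all add: lookup_hom_smult lookup_single when_def)
  then show "Poly_Mapping.lookup f y = Poly_Mapping.lookup (\<Sum>x\<in>Poly_Mapping.keys f. hom_smult (Poly_Mapping.lookup f x) (hmonomial x)) y"
    by (simp add: in_keys_iff)
qed

lemma vector_space_hom_smult: "vector_space (hom_smult :: 'k::field \<Rightarrow> _)"
  by unfold_locales (auto intro!: poly_mapping_eqI simp: lookup_hom_smult lookup_add algebra_simps)

text \<open>A vector outside the sum of the relations and the span would be separated from both by a
  linear functional, which \<open>invariant_functional_zero\<close> shows to be zero on
  homology.\<close>

lemma span_mod_relations:
  fixes z :: "'p::prime_card mod_ring hom_elt"
  assumes n: "n \<ge> 1" and z: "z \<in> carrier (homology n)"
  shows "\<exists>T c. finite T \<and> T \<subseteq> admissible n \<and>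
     z - (\<Sum>I\<in>T. hom_smult (c I) (hmonomial (basis_monomial CARD('p) I))) \<in> coinv_relations n"
proof -
  interpret vs: vector_space "hom_smult :: 'p mod_ring \<Rightarrow> 'p mod_ring hom_elt \<Rightarrow> 'p mod_ring hom_elt"
    by (rule vector_space_hom_smult)
  interpret vs1: vector_space "(*) :: 'p mod_ring \<Rightarrow> 'p mod_ring \<Rightarrow> 'p mod_ring"
    by unfold_locales (simp_all add: algebra_simps)
  interpret vp: vector_space_pair "hom_smult :: 'p mod_ring \<Rightarrow> 'p mod_ring hom_elt \<Rightarrow> 'p mod_ring hom_elt" "(*) :: 'p mod_ring \<Rightarrow> 'p mod_ring \<Rightarrow> 'p mod_ring"
    ..
  let ?m = "\<lambda>I. hmonomial (basis_monomial CARD('p) I) :: 'p mod_ring hom_elt"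
  define U where "U = {z :: 'p mod_ring hom_elt. \<exists>u\<in>coinv_relations n. \<exists>v\<in>vs.span (?m ` admissible n). z = u + v}"
  have UI: "u + v \<in> U" if "u \<in> coinv_relations n" "v \<in> vs.span (?m ` admissible n)" for u v
    unfolding U_def mem_Collect_eq by (intro bexI[OF _ that(1)] bexI[OF _ that(2)] refl)
  have relU: "u \<in> U" if "u \<in> coinv_relations n" for u using UI[OF that vs.span_zero] by simp
  have spanU: "v \<in> U" if "v \<in> vs.span (?m ` admissible n)" for v using UI[OF coinv_relations_0 that] by simp
  have subU: "vs.subspace U"
  proof (rule vs.subspaceI)
    show "0 \<in> U" by (rule spanU[OF vs.span_zero])
    show "x + y \<in> U" if xy: "x \<in> U" "y \<in> U" for x y
    proof -
      obtain u v u' v' where "u \<in> coinv_relations n" "v \<in> vs.span (?m ` admissible n)" "x = u + v"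
        "u' \<in> coinv_relations n" "v' \<in> vs.span (?m ` admissible n)" "y = u' + v'"
        using xy unfolding U_def by blast
      then have "x + y = (u + u') + (v + v')" and "u + u' \<in> coinv_relations n" "v + v' \<in> vs.span (?m ` admissible n)"
        by (simp_all add: coinv_relations_add vs.span_add)
      then show ?thesis by (simp only: UI)
    qed
    show "hom_smult c x \<in> U" if x: "x \<in> U" for c x
    proof -
      obtain u v where "u \<in> coinv_relations n" "v \<in> vs.span (?m ` admissible n)" "x = u + v"
        using x unfolding U_def by blast
      then have "hom_smult c x = hom_smult c u + hom_smult c v" "hom_smult c u \<in> coinv_relations n" "hom_smult c v \<in> vs.span (?m ` admissible n)"
        by (simp_all add: hom_smult_add coinv_relations_smult vs.span_scale)
      then show ?thesis by (simp only: UI)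
    qed
  qed
  have "z \<in> U"
  proof (rule ccontr)
    assume zU: "z \<notin> U"
    obtain B where B: "B \<subseteq> U" "vs.independent B" "U \<subseteq> vs.span B"
      using vs.maximal_independent_subset by blast
    have "vs.span B \<subseteq> U" using B(1) subU by (rule vs.span_minimal)
    then have zB: "z \<notin> vs.span B" using zU by blast
    then have "vs.independent (insert z B)" using B(2) by (rule vs.independent_insertI)
    \<comment> \<open>A basis of \<open>U\<close> remains independent after adding \<open>z\<close>,
      so the value 1 at \<open>z\<close> can be prescribed together with 0 on
      \<open>U\<close>.\<close>
    then obtain F where F: "Vector_Spaces.linear hom_smult (*) F" "\<And>x. x \<in> insert z B \<Longrightarrow> F x = (if x = z then 1 else 0)"
      using vp.linear_independent_extend[of "insert z B" "\<lambda>x. if x = z then 1 else 0"] by metis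
    interpret F: Vector_Spaces.linear hom_smult "(*)" F by (rule F(1))
    have FB: "F x = 0" if "x \<in> B" for x
      using F(2)[of x] that zB vs.span_base by (metis insert_iff)
    have FU: "F x = 0" if "x \<in> U" for x
      using vp.linear_eq_0_on_span[OF F(1) FB] that B(3) by blast
    define w where "w x = F (hmonomial x)" for x
    have Fw: "F f = lin_fun w f" for f
      by (subst hom_elt_expand[of f]) (simp add: F.sum F.scale lin_fun_def w_def)
    have "w x = 0" if "length x = n" for x
    proof (rule invariant_functional_zero[OF n _ _ that])
      fix g :: "'p mod_ring mat" and z' :: "'p mod_ring hom_elt" assume "g \<in> GL n" "z' \<in> carrier (homology n)"
      then have "GL_act n g z' - z' \<in> coinv_relations n" by (rule coinv_relation_generator)
      then have "GL_act n g z' - z' \<in> U" by (rule relU)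
      then show "lin_fun w (GL_act n g z' - z') = 0" unfolding Fw[symmetric] by (rule FU)
    next
      fix I assume "I \<in> admissible n"
      then have "?m I \<in> vs.span (?m ` admissible n)" by (intro vs.span_base imageI)
      then have "?m I \<in> U" by (rule spanU)
      then show "w (basis_monomial CARD('p) I) = 0" unfolding w_def by (rule FU)
    qed
    then have "F z = 0" unfolding Fw lin_fun_def using z by (intro sum.neutral) (simp add: in_homology)
    then show False using F(2)[of z] by simp
  qed
  then obtain u v where u: "u \<in> coinv_relations n" and v: "v \<in> vs.span (?m ` admissible n)" and zuv: "z = u + v"
    unfolding U_def by blast
  obtain T r where T: "finite T" "T \<subseteq> ?m ` admissible n" and vT: "v = (\<Sum>a\<in>T. hom_smult (r a) a)"
    using v unfolding vs.span_explicit by blast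
  obtain S where S: "finite S" "S \<subseteq> admissible n" "T = ?m ` S" "inj_on ?m S"
  proof -
    obtain S where S: "S \<subseteq> admissible n" "inj_on ?m S" "T = ?m ` S"
      using T(2) unfolding subset_image_inj by blast
    moreover have "finite S" using T(1) S(2,3) by (simp add: finite_image_iff)
    ultimately show ?thesis using that by blast
  qed
  have "v = (\<Sum>I\<in>S. hom_smult (r (?m I)) (?m I))" unfolding vT S(3) by (simp add: sum.reindex[OF S(4)])
  then have "z - (\<Sum>I\<in>S. hom_smult (r (?m I)) (?m I)) = u" unfolding zuv by simp
  then show ?thesis using S(1,2) u by (intro exI[of _ S] exI[of _ "\<lambda>I. r (?m I)"]) simp
qed

theorem proposition3p7:
  fixes n :: nat
  assumes "odd CARD('p::prime_card)" and "n \<ge> 1"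
  shows "inj_on (basis_class n :: ind_seq \<Rightarrow> 'p mod_ring hom_elt set) (admissible n) \<and>
         vectorspace.basis class_ring (coinvariants n)
           ((basis_class n :: ind_seq \<Rightarrow> 'p mod_ring hom_elt set) ` admissible n)"
proof -
  let ?Q = "coinvariants n :: ('p mod_ring, 'p mod_ring hom_elt set) module"
  let ?b = "basis_class n :: ind_seq \<Rightarrow> 'p mod_ring hom_elt set"
  let ?m = "\<lambda>I. hmonomial (basis_monomial CARD('p) I) :: 'p mod_ring hom_elt"
  interpret Q: vectorspace class_ring ?Q by (rule vs_coinvariants)
  have m: "?m I \<in> carrier (homology n)" if "I \<in> admissible n" for I
    by (rule hom_single_closed) (rule basis_monomial_length[OF that])
  have b: "?b I = coinv_class n (?m I)" for I by (simp add: basis_class_def)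
  have bC: "?b ` admissible n \<subseteq> carrier ?Q" unfolding coinvariants_simps b using m by blast
  have inj: "inj_on ?b (admissible n)"
  proof (rule inj_onI, rule ccontr)
    fix I I' assume I: "I \<in> admissible n" "I' \<in> admissible n" and eq: "?b I = ?b I'" and ne: "I \<noteq> I'"
    \<comment> \<open>Equal classes for distinct indices amount to a relation with coefficients 1
      and -1.\<close>
    let ?c = "\<lambda>K. if K = I then 1 else -1 :: 'p mod_ring"
    have "?m I - ?m I' \<in> coinv_relations n" using eq unfolding b coinv_class_eq_iff .
    moreover have "(\<Sum>K\<in>{I, I'}. hom_smult (?c K) (?m K)) = hom_smult 1 (?m I) + hom_smult (-1) (?m I')"
      using ne by simp
    moreover have "hom_smult 1 (?m I) = ?m I" by (rule poly_mapping_eqI) (simp add: lookup_hom_smult)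
    ultimately have "(\<Sum>K\<in>{I, I'}. hom_smult (?c K) (?m K)) \<in> coinv_relations n"
      by (simp only: hom_smult_minus_one diff_conv_add_uminus)
    then have "?c I = 0" by (rule independent_mod_relations[OF assms(2), rotated 2]) (use I in simp_all)
    then show False by simp
  qed
  have lincomb: "Q.lincomb a (?b ` T) = coinv_class n (\<Sum>I\<in>T. hom_smult (a (?b I)) (?m I))"
    if T: "finite T" "T \<subseteq> admissible n" for a T
  proof -
    have injT: "inj_on ?b T" by (rule inj_on_subset[OF inj T(2)])
    have "Q.lincomb a (?b ` T) = finsum ?Q (\<lambda>I. smult ?Q (a (?b I)) (?b I)) T"
      unfolding Q.lincomb_def
    proof (rule Q.finsum_reindex[OF _ injT])
      show "(\<lambda>v. smult ?Q (a v) v) \<in> ?b ` T \<rightarrow> carrier ?Q" using bC T(2) by (auto intro!: Q.smult_closed)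
    qed
    also have "\<dots> = coinv_class n (\<Sum>I\<in>T. hom_smult (a (?b I)) (?m I))"
      unfolding b using m T(2) by (intro finsum_coinvariants[OF T(1)]) blast
    finally show ?thesis .
  qed
  have indep: "Q.lin_indpt (?b ` admissible n)"
  proof
    assume "Q.lin_dep (?b ` admissible n)"
    then obtain A a v where A: "finite A" "A \<subseteq> ?b ` admissible n" "Q.lincomb a A = zero ?Q" "v \<in> A" "a v \<noteq> 0"
      unfolding Q.lin_dep_def by auto
    obtain T where T: "finite T" "T \<subseteq> admissible n" "A = ?b ` T"
      using finite_subset_image[OF A(1,2)] by blast
    obtain I where I: "I \<in> T" "v = ?b I" using A(4) T(3) by blast
    have "coinv_class n (\<Sum>I\<in>T. hom_smult (a (?b I)) (?m I)) = coinv_class n 0"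
      using A(3) unfolding T(3) lincomb[OF T(1,2)] coinvariants_simps .
    then have "(\<Sum>I\<in>T. hom_smult (a (?b I)) (?m I)) \<in> coinv_relations n"
      unfolding coinv_class_eq_iff by simp
    from independent_mod_relations[OF assms(2) T(1,2) this I(1)] show False using A(5) I(2) by simp
  qed
  have span: "Q.gen_set (?b ` admissible n)"
  proof
    show "Q.span (?b ` admissible n) \<subseteq> carrier ?Q" by (rule Q.span_is_subset2[OF bC])
    show "carrier ?Q \<subseteq> Q.span (?b ` admissible n)"
    proof
      fix X assume "X \<in> carrier ?Q"
      then obtain z where z: "z \<in> carrier (homology n)" "X = coinv_class n z" unfolding coinvariants_simps by blast
      obtain T c where T: "finite T" "T \<subseteq> admissible n"
        and zT: "z - (\<Sum>I\<in>T. hom_smult (c I) (?m I)) \<in> coinv_relations n"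
        using span_mod_relations[OF assms(2) z(1)] by blast
      \<comment> \<open>Coefficients in \<open>Q.lincomb\<close> are indexed by classes; injectivity
        lets those indexed by sequences be transported.\<close>
      define a where "a v = c (inv_into (admissible n) ?b v)" for v
      have "(\<Sum>I\<in>T. hom_smult (a (?b I)) (?m I)) = (\<Sum>I\<in>T. hom_smult (c I) (?m I))"
        using T(2) by (intro sum.cong refl) (simp add: a_def inv_into_f_f[OF inj] subset_iff)
      moreover have "coinv_class n z = coinv_class n (\<Sum>I\<in>T. hom_smult (c I) (?m I))"
        unfolding coinv_class_eq_iff by (rule zT)
      ultimately have "Q.lincomb a (?b ` T) = X"
        unfolding lincomb[OF T] z(2) by (simp only:)
      moreover have "Q.lincomb a (?b ` T) \<in> Q.span (?b ` admissible n)"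
        unfolding Q.span_def using T by (intro CollectI exI[of _ a] exI[of _ "?b ` T"]) auto
      ultimately show "X \<in> Q.span (?b ` admissible n)" by simp
    qed
  qed
  show ?thesis using inj indep span bC unfolding Q.basis_def by blast
qed

end
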